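(* Let $\mathcal{A}/\mathcal{O}_K$ be an abelian scheme of relative dimension $2$ with ordinary special fibre $\mathcal{A}_k$ and generic fibre $A$. Let $V_1=\mathcal{A}^\vee[2](\bar k)$, $V_2=\mathcal{A}[2](\bar k)$, $V=V_1\oplus V_2$, $W=A[2](\overline{K})$, and consider the exact sequence of $\mathbb{F}_2[\Gamma_K]$-modules \[( * )\qquad 0\to V_1\to W\to V_2\to 0.\] Let $G_W$ (resp. $G_V$) be the image of $\Gamma_K$ acting on $W$ (resp. $V$), and let $\ell$ be a prime. Then the following are equivalent: (1) there is an isomorphism of $\Gamma_K$-representations $\mathbb{Q}_\ell^{V}\simeq\mathbb{Q}_\ell^{W}$; (2) the extension $( * )$ splits; (3) $|G_W|=|G_V|$. If these properties hold, then the $\Gamma_K$-representation $W$ is unramified, i.e. factors through $\Gamma_k=\mathrm{Gal}(\bar k/k)$.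
   Context: $\mathcal{O}_K$ is a complete discrete valuation ring with fraction field $K$ of characteristic $0$ and perfect residue field $k$ of characteristic $2$; $\overline{K}$ an algebraic closure with residue field $\bar k$, $\Gamma_K=\mathrm{Gal}(\overline K/K)$. Ordinary means $\mathcal{A}_k[2](\bar k)\cong(\mathbb{Z}/2)^2$. The sequence $( * )$ is the connected-étale sequence $0\to\mathcal{A}[2]^\circ(\overline K)\to A[2](\overline K)\to\mathcal{A}[2](\bar k)\to 0$, where $\mathcal{A}[2]^\circ(\overline K)$ is identified with $\mathcal{A}^\vee[2](\bar k)$ via Cartier duality $\mathcal{A}[2]^\circ\cong\mathrm{Hom}(\mathcal{A}^\vee[2]^{\mathrm{et}},\mu_2)$ and $\mathrm{Hom}(\mathcal{A}^\vee[2](\bar k),\mathbb{F}_2)\cong\mathcal{A}^\vee[2](\bar k)$ (via $\wedge^2\mathcal{A}^\vee[2](\bar k)\cong\mathbb{F}_2$). For a finite $\Gamma$-set $X$, $\mathbb{Q}_\ell^X$ denotes the associated permutation representation. *)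

theory Defs
  imports "HOL-Algebra.Algebra" "HOL-Library.Nat_Bijection"
begin

no_notation var (\<open>X\<index>\<close>)

section \<open>Schemes over a ring as functors of points\<close>

text \<open>
  Schemes are treated in the style of Demazure and Gabriel: a scheme over a commutative ring
  \<open>R\<close> is a functor on commutative \<open>R\<close>-algebras that is a Zariski sheaf and has a cover by open
  affine subfunctors.  The test algebras are all \<open>R\<close>-algebras with carrier in one fixed type \<open>'a\<close>,
  the type of the elements of the base ring.  Below this is the type of the elements of an
  algebraic closure of a complete discretely valued field; it is infinite and at least as big as
  every base ring that is used, so up to isomorphism it contains all finitely generated algebras
  over these rings, all their quotients and localisations, and the residue fields of these.

  Structure maps and homomorphisms are extensional, so that restricting scalars along a composite
  agrees on the nose with restricting scalars twice.
\<close>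

record 'a alg = "'a ring" +
  smap :: "'a \<Rightarrow> 'a"

definition mk_alg :: "('a,'m) ring_scheme \<Rightarrow> ('a \<Rightarrow> 'a) \<Rightarrow> ('a,'n) ring_scheme \<Rightarrow> 'a alg" where
  "mk_alg R h S = \<lparr>carrier = carrier S, monoid.mult = monoid.mult S, one = monoid.one S,
     ring.zero = ring.zero S, add = ring.add S, smap = restrict h (carrier R)\<rparr>"

definition is_alg :: "('a,'m) ring_scheme \<Rightarrow> 'a alg \<Rightarrow> bool" where
  "is_alg R B \<longleftrightarrow> cring B \<and> smap B \<in> ring_hom R B \<and> smap B \<in> extensional (carrier R)"

definition field_alg :: "('a,'m) ring_scheme \<Rightarrow> 'a alg \<Rightarrow> bool" where
  "field_alg R F \<longleftrightarrow> is_alg R F \<and> field F"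

definition alg_hom :: "('a,'m) ring_scheme \<Rightarrow> 'a alg \<Rightarrow> 'a alg \<Rightarrow> ('a \<Rightarrow> 'a) set" where
  "alg_hom R B C = {f \<in> ring_hom B C. f \<in> extensional (carrier B) \<and>
     (\<forall>a\<in>carrier R. f (smap B a) = smap C a)}"

definition self_alg :: "('a,'m) ring_scheme \<Rightarrow> 'a alg" where
  "self_alg R = mk_alg R (\<lambda>a. a) R"

text \<open>For \<open>f : B \<rightarrow> C\<close> and a \<open>C\<close>-algebra \<open>D\<close>, the \<open>B\<close>-algebra underlying \<open>D\<close>.\<close>

definition restr_scalars :: "('a,'m) ring_scheme \<Rightarrow> ('a \<Rightarrow> 'a) \<Rightarrow> 'a alg \<Rightarrow> 'a alg" where
  "restr_scalars B f D = mk_alg B (\<lambda>b. smap D (f b)) D"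

definition fin_gen_alg :: "('a,'m) ring_scheme \<Rightarrow> 'a alg \<Rightarrow> bool" where
  "fin_gen_alg R C \<longleftrightarrow> (\<exists>S. finite S \<and> S \<subseteq> carrier C \<and>
     generate_ring C (smap C ` carrier R \<union> S) = carrier C)"

definition is_localisation :: "'a alg \<Rightarrow> 'a \<Rightarrow> 'a alg \<Rightarrow> ('a \<Rightarrow> 'a) \<Rightarrow> bool" where
  "is_localisation B f C l \<longleftrightarrow> l \<in> ring_hom B C \<and> l f \<in> Units C \<and>
     (\<forall>c\<in>carrier C. \<exists>b\<in>carrier B. \<exists>n::nat. c \<otimes>\<^bsub>C\<^esub> (l f [^]\<^bsub>C\<^esub> n) = l b) \<and>
     (\<forall>b\<in>carrier B. l b = \<zero>\<^bsub>C\<^esub> \<longrightarrow> (\<exists>n::nat. (f [^]\<^bsub>B\<^esub> n) \<otimes>\<^bsub>B\<^esub> b = \<zero>\<^bsub>B\<^esub>))"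

record ('a,'p) pfunctor =
  pts :: "'a alg \<Rightarrow> 'p set"
  push :: "'a alg \<Rightarrow> 'a alg \<Rightarrow> ('a \<Rightarrow> 'a) \<Rightarrow> 'p \<Rightarrow> 'p"

definition alg_functor :: "('a,'m) ring_scheme \<Rightarrow> ('a,'p,'n) pfunctor_scheme \<Rightarrow> bool" where
  "alg_functor R X \<longleftrightarrow>
     (\<forall>B C f x. is_alg R B \<and> is_alg R C \<and> f \<in> alg_hom R B C \<and> x \<in> pts X B
        \<longrightarrow> push X B C f x \<in> pts X C) \<and>
     (\<forall>B x. is_alg R B \<and> x \<in> pts X B \<longrightarrow> push X B B (\<lambda>b\<in>carrier B. b) x = x) \<and>
     (\<forall>B C D f g x. is_alg R B \<and> is_alg R C \<and> is_alg R D \<and> f \<in> alg_hom R B C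
          \<and> g \<in> alg_hom R C D \<and> x \<in> pts X B
        \<longrightarrow> push X B D (compose (carrier B) g f) x = push X C D g (push X B C f x))"

text \<open>The double overlap condition is phrased with all algebras \<open>D\<close> receiving \<open>C i\<close> and \<open>C j\<close>
  compatibly; the localisation of \<open>B\<close> at \<open>f i \<otimes> f j\<close> is the universal such \<open>D\<close>.\<close>

definition zariski_sheaf :: "('a,'m) ring_scheme \<Rightarrow> ('a,'p,'n) pfunctor_scheme \<Rightarrow> bool" where
  "zariski_sheaf R X \<longleftrightarrow> (\<forall>B (I::nat set) f C l x.
     is_alg R B \<and> finite I \<and> f ` I \<subseteq> carrier B \<and> genideal B (f ` I) = carrier B \<and>
     (\<forall>i\<in>I. is_alg R (C i) \<and> l i \<in> alg_hom R B (C i) \<and> is_localisation B (f i) (C i) (l i)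
        \<and> x i \<in> pts X (C i)) \<and>
     (\<forall>i\<in>I. \<forall>j\<in>I. \<forall>D u v. is_alg R D \<and> u \<in> alg_hom R (C i) D \<and> v \<in> alg_hom R (C j) D \<and>
        compose (carrier B) u (l i) = compose (carrier B) v (l j)
        \<longrightarrow> push X (C i) D u (x i) = push X (C j) D v (x j))
     \<longrightarrow> (\<exists>!y. y \<in> pts X B \<and> (\<forall>i\<in>I. push X B (C i) (l i) y = x i)))"

definition subfunctor ::
  "('a,'m) ring_scheme \<Rightarrow> ('a,'p,'n) pfunctor_scheme \<Rightarrow> ('a alg \<Rightarrow> 'p set) \<Rightarrow> bool" where
  "subfunctor R X U \<longleftrightarrow>
     (\<forall>B. is_alg R B \<longrightarrow> U B \<subseteq> pts X B) \<and>
     (\<forall>B C f x. is_alg R B \<and> is_alg R C \<and> f \<in> alg_hom R B C \<and> x \<in> U B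
        \<longrightarrow> push X B C f x \<in> U C)"

text \<open>A subfunctor is open (closed) if its inverse image in \<open>Spec B\<close> under every \<open>x \<in> X(B)\<close> is the
  open (closed) subscheme defined by some ideal \<open>I\<close> of \<open>B\<close>.\<close>

definition open_sub ::
  "('a,'m) ring_scheme \<Rightarrow> ('a,'p,'n) pfunctor_scheme \<Rightarrow> ('a alg \<Rightarrow> 'p set) \<Rightarrow> bool" where
  "open_sub R X U \<longleftrightarrow> subfunctor R X U \<and>
     (\<forall>B x. is_alg R B \<and> x \<in> pts X B \<longrightarrow> (\<exists>I. ideal I B \<and>
        (\<forall>C f. is_alg R C \<and> f \<in> alg_hom R B C \<longrightarrow>
           (push X B C f x \<in> U C \<longleftrightarrow> genideal C (f ` I) = carrier C))))"

definition closed_sub ::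
  "('a,'m) ring_scheme \<Rightarrow> ('a,'p,'n) pfunctor_scheme \<Rightarrow> ('a alg \<Rightarrow> 'p set) \<Rightarrow> bool" where
  "closed_sub R X Z \<longleftrightarrow> subfunctor R X Z \<and>
     (\<forall>B x. is_alg R B \<and> x \<in> pts X B \<longrightarrow> (\<exists>I. ideal I B \<and>
        (\<forall>C f. is_alg R C \<and> f \<in> alg_hom R B C \<longrightarrow>
           (push X B C f x \<in> Z C \<longleftrightarrow> f ` I \<subseteq> {\<zero>\<^bsub>C\<^esub>}))))"

text \<open>A family of open subfunctors covers iff it does so on points with values in fields.\<close>

definition covers ::
  "('a,'m) ring_scheme \<Rightarrow> ('a,'p,'n) pfunctor_scheme \<Rightarrow> ('a alg \<Rightarrow> 'p set) set \<Rightarrow> bool" where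
  "covers R X \<U> \<longleftrightarrow> (\<forall>F. field_alg R F \<longrightarrow> pts X F \<subseteq> (\<Union>U\<in>\<U>. U F))"

definition represented_by ::
  "('a,'m) ring_scheme \<Rightarrow> ('a,'p,'n) pfunctor_scheme \<Rightarrow> 'a alg \<Rightarrow> bool" where
  "represented_by R X C \<longleftrightarrow> is_alg R C \<and> (\<exists>x\<in>pts X C. \<forall>B. is_alg R B \<longrightarrow>
     (\<forall>y\<in>pts X B. \<exists>!g. g \<in> alg_hom R C B \<and> push X C B g x = y))"

definition affine_open ::
  "('a,'m) ring_scheme \<Rightarrow> ('a,'p,'n) pfunctor_scheme \<Rightarrow> ('a alg \<Rightarrow> 'p set) \<Rightarrow> 'a alg \<Rightarrow> bool" where
  "affine_open R X U C \<longleftrightarrow> open_sub R X U \<and> represented_by R (X\<lparr>pts := U\<rparr>) C"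

definition is_scheme :: "('a,'m) ring_scheme \<Rightarrow> ('a,'p,'n) pfunctor_scheme \<Rightarrow> bool" where
  "is_scheme R X \<longleftrightarrow> alg_functor R X \<and> zariski_sheaf R X \<and>
     (\<exists>\<U>. (\<forall>U\<in>\<U>. \<exists>C. affine_open R X U C) \<and> covers R X \<U>)"

definition finite_type :: "('a,'m) ring_scheme \<Rightarrow> ('a,'p,'n) pfunctor_scheme \<Rightarrow> bool" where
  "finite_type R X \<longleftrightarrow>
     (\<exists>\<U>. finite \<U> \<and> (\<forall>U\<in>\<U>. \<exists>C. affine_open R X U C \<and> fin_gen_alg R C) \<and> covers R X \<U>)"

definition base_change ::
  "('a,'m) ring_scheme \<Rightarrow> 'a alg \<Rightarrow> ('a,'p,'n) pfunctor_scheme \<Rightarrow> ('a,'p,'n) pfunctor_scheme" where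
  "base_change R B X = X\<lparr>
     pts := \<lambda>D. pts X (restr_scalars R (smap B) D),
     push := \<lambda>D E. push X (restr_scalars R (smap B) D) (restr_scalars R (smap B) E)\<rparr>"

definition separated :: "('a,'m) ring_scheme \<Rightarrow> ('a,'p,'n) pfunctor_scheme \<Rightarrow> bool" where
  "separated R X \<longleftrightarrow> (\<forall>B x y. is_alg R B \<and> x \<in> pts X B \<and> y \<in> pts X B \<longrightarrow>
     (\<exists>I. ideal I B \<and> (\<forall>C f. is_alg R C \<and> f \<in> alg_hom R B C \<longrightarrow>
        (push X B C f x = push X B C f y \<longleftrightarrow> f ` I \<subseteq> {\<zero>\<^bsub>C\<^esub>}))))"

text \<open>For every \<open>B\<close> and every closed subscheme \<open>Z\<close> of \<open>X\<^sub>B\<close>, the image of \<open>Z\<close> in \<open>Spec B\<close> is the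
  zero set of an ideal: the point of \<open>Spec B\<close> given by \<open>B \<rightarrow> F\<close> lies in the image iff \<open>Z\<close> has a
  point over some field extension \<open>F'\<close> of \<open>F\<close>.\<close>

definition universally_closed :: "('a,'m) ring_scheme \<Rightarrow> ('a,'p,'n) pfunctor_scheme \<Rightarrow> bool" where
  "universally_closed R X \<longleftrightarrow> (\<forall>B Z. is_alg R B \<and> closed_sub B (base_change R B X) Z \<longrightarrow>
     (\<exists>I. ideal I B \<and> (\<forall>F. field_alg B F \<longrightarrow>
        ((\<exists>F'. field_alg F F' \<and> Z (restr_scalars B (smap F) F') \<noteq> {})
           \<longleftrightarrow> smap F ` I \<subseteq> {\<zero>\<^bsub>F\<^esub>}))))"

definition proper_scheme :: "('a,'m) ring_scheme \<Rightarrow> ('a,'p,'n) pfunctor_scheme \<Rightarrow> bool" where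
  "proper_scheme R X \<longleftrightarrow> finite_type R X \<and> separated R X \<and> universally_closed R X"

text \<open>The infinitesimal lifting criterion.  Smoothness also needs local finite presentation;
  over the noetherian bases considered here that is implied by being of finite type.\<close>

definition formally_smooth :: "('a,'m) ring_scheme \<Rightarrow> ('a,'p,'n) pfunctor_scheme \<Rightarrow> bool" where
  "formally_smooth R X \<longleftrightarrow> (\<forall>B C q. is_alg R B \<and> is_alg R C \<and> q \<in> alg_hom R B C \<and>
     q ` carrier B = carrier C \<and>
     (\<forall>x\<in>carrier B. \<forall>y\<in>carrier B. q x = \<zero>\<^bsub>C\<^esub> \<and> q y = \<zero>\<^bsub>C\<^esub> \<longrightarrow> x \<otimes>\<^bsub>B\<^esub> y = \<zero>\<^bsub>B\<^esub>)
     \<longrightarrow> pts X C \<subseteq> push X B C q ` pts X B)"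

definition smooth_scheme :: "('a,'m) ring_scheme \<Rightarrow> ('a,'p,'n) pfunctor_scheme \<Rightarrow> bool" where
  "smooth_scheme R X \<longleftrightarrow> noetherian_ring R \<and> finite_type R X \<and> formally_smooth R X"

definition prime_chain :: "'a alg \<Rightarrow> nat \<Rightarrow> bool" where
  "prime_chain C n \<longleftrightarrow> (\<exists>p::nat \<Rightarrow> 'a set.
     (\<forall>i\<le>n. primeideal (p i) C) \<and> (\<forall>i<n. p i \<subset> p (Suc i)))"

definition scheme_dim :: "('a,'m) ring_scheme \<Rightarrow> ('a,'p,'n) pfunctor_scheme \<Rightarrow> nat \<Rightarrow> bool" where
  "scheme_dim R X d \<longleftrightarrow> (\<exists>U C. affine_open R X U C \<and> prime_chain C d) \<and>
     (\<forall>U C n. affine_open R X U C \<and> prime_chain C n \<longrightarrow> n \<le> d)"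

definition connected_scheme :: "('a,'m) ring_scheme \<Rightarrow> ('a,'p,'n) pfunctor_scheme \<Rightarrow> bool" where
  "connected_scheme R X \<longleftrightarrow>
     (\<exists>F. field_alg R F \<and> pts X F \<noteq> {}) \<and>
     (\<forall>U V. open_sub R X U \<and> open_sub R X V \<and> covers R X {U, V} \<and>
        (\<forall>F. field_alg R F \<longrightarrow> U F \<inter> V F = {})
        \<longrightarrow> (\<forall>F. field_alg R F \<longrightarrow> U F = {}) \<or> (\<forall>F. field_alg R F \<longrightarrow> V F = {}))"

section \<open>Abelian schemes\<close>

record ('a,'p) gfunctor = "('a,'p) pfunctor" +
  mul :: "'a alg \<Rightarrow> 'p \<Rightarrow> 'p \<Rightarrow> 'p"
  unit_pt :: "'a alg \<Rightarrow> 'p"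

definition grp :: "('a,'p) gfunctor \<Rightarrow> 'a alg \<Rightarrow> 'p monoid" where
  "grp A B = \<lparr>carrier = pts A B, monoid.mult = mul A B, one = unit_pt A B\<rparr>"

definition group_functor :: "('a,'m) ring_scheme \<Rightarrow> ('a,'p) gfunctor \<Rightarrow> bool" where
  "group_functor R A \<longleftrightarrow> alg_functor R A \<and> (\<forall>B. is_alg R B \<longrightarrow> group (grp A B)) \<and>
     (\<forall>B C f. is_alg R B \<and> is_alg R C \<and> f \<in> alg_hom R B C
        \<longrightarrow> push A B C f \<in> hom (grp A B) (grp A C))"

definition gbase_change ::
  "('a,'m) ring_scheme \<Rightarrow> 'a alg \<Rightarrow> ('a,'p) gfunctor \<Rightarrow> ('a,'p) gfunctor" where
  "gbase_change R B A = (base_change R B A)\<lparr>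
     mul := \<lambda>D. mul A (restr_scalars R (smap B) D),
     unit_pt := \<lambda>D. unit_pt A (restr_scalars R (smap B) D)\<rparr>"

text \<open>All field-valued points of the base are allowed, hence the fibres are geometrically
  connected.\<close>

definition abelian_scheme :: "('a,'m) ring_scheme \<Rightarrow> ('a,'p) gfunctor \<Rightarrow> nat \<Rightarrow> bool" where
  "abelian_scheme R A d \<longleftrightarrow>
     is_scheme R A \<and> group_functor R A \<and> smooth_scheme R A \<and> proper_scheme R A \<and>
     (\<forall>F. field_alg R F \<longrightarrow>
        connected_scheme F (base_change R F A) \<and> scheme_dim F (base_change R F A) d)"

definition two_torsion :: "('a,'p) gfunctor \<Rightarrow> ('a,'p) gfunctor" where
  "two_torsion A = A\<lparr>pts := \<lambda>B. {x \<in> pts A B. mul A B x x = unit_pt A B}\<rparr>"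

definition translate ::
  "('a,'m) ring_scheme \<Rightarrow> ('a,'p) gfunctor \<Rightarrow> 'p \<Rightarrow> 'a alg \<Rightarrow> 'p \<Rightarrow> 'p" where
  "translate R A x D y = mul A D (push A (self_alg R) D (smap D) x) y"

section \<open>Line bundles and the dual abelian scheme\<close>

text \<open>A line bundle is given by a Cech cocycle: a countable cover by open subfunctors and transition
  functions that are units.  (All schemes to which this is applied are quasi-compact.)
  Isomorphism means that the cocycles become cohomologous on a common refinement.\<close>

record ('a,'p) line_bdl =
  chart :: "nat \<Rightarrow> 'a alg \<Rightarrow> 'p set"
  trans_fun :: "nat \<Rightarrow> nat \<Rightarrow> 'a alg \<Rightarrow> 'p \<Rightarrow> 'a"

definition open_cover ::
  "('a,'m) ring_scheme \<Rightarrow> ('a,'p,'n) pfunctor_scheme \<Rightarrow> (nat \<Rightarrow> 'a alg \<Rightarrow> 'p set) \<Rightarrow> bool" where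
  "open_cover R X U \<longleftrightarrow> (\<forall>i. open_sub R X (U i)) \<and> covers R X (range U)"

definition unit_function ::
  "('a,'m) ring_scheme \<Rightarrow> ('a,'p,'n) pfunctor_scheme \<Rightarrow> ('a alg \<Rightarrow> 'p set)
     \<Rightarrow> ('a alg \<Rightarrow> 'p \<Rightarrow> 'a) \<Rightarrow> bool" where
  "unit_function R X U a \<longleftrightarrow>
     (\<forall>B x. is_alg R B \<and> x \<in> U B \<longrightarrow> a B x \<in> Units B) \<and>
     (\<forall>B C f x. is_alg R B \<and> is_alg R C \<and> f \<in> alg_hom R B C \<and> x \<in> U B
        \<longrightarrow> a C (push X B C f x) = f (a B x))"

definition line_bundle ::
  "('a,'m) ring_scheme \<Rightarrow> ('a,'p,'n) pfunctor_scheme \<Rightarrow> ('a,'p) line_bdl \<Rightarrow> bool" where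
  "line_bundle R X L \<longleftrightarrow> open_cover R X (chart L) \<and>
     (\<forall>i j. unit_function R X (\<lambda>B. chart L i B \<inter> chart L j B) (trans_fun L i j)) \<and>
     (\<forall>i j k B x. is_alg R B \<and> x \<in> chart L i B \<inter> chart L j B \<inter> chart L k B \<longrightarrow>
        trans_fun L i j B x \<otimes>\<^bsub>B\<^esub> trans_fun L j k B x = trans_fun L i k B x)"

definition line_bdl_iso ::
  "('a,'m) ring_scheme \<Rightarrow> ('a,'p,'n) pfunctor_scheme
     \<Rightarrow> ('a,'p) line_bdl \<Rightarrow> ('a,'p) line_bdl \<Rightarrow> bool" where
  "line_bdl_iso R X L M \<longleftrightarrow> (\<exists>W r s a. open_cover R X W \<and>
     (\<forall>k B. is_alg R B \<longrightarrow> W k B \<subseteq> chart L (r k) B \<inter> chart M (s k) B) \<and>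
     (\<forall>k. unit_function R X (W k) (a k)) \<and>
     (\<forall>k l B x. is_alg R B \<and> x \<in> W k B \<inter> W l B \<longrightarrow>
        a k B x \<otimes>\<^bsub>B\<^esub> trans_fun L (r k) (r l) B x
          = trans_fun M (s k) (s l) B x \<otimes>\<^bsub>B\<^esub> a l B x))"

definition trivial_bdl :: "('a,'p,'n) pfunctor_scheme \<Rightarrow> ('a,'p) line_bdl" where
  "trivial_bdl X = \<lparr>chart = \<lambda>i. pts X, trans_fun = \<lambda>i j B x. \<one>\<^bsub>B\<^esub>\<rparr>"

definition tensor_bdl :: "('a,'p) line_bdl \<Rightarrow> ('a,'p) line_bdl \<Rightarrow> ('a,'p) line_bdl" where
  "tensor_bdl L M = \<lparr>
     chart = \<lambda>k B. chart L (fst (prod_decode k)) B \<inter> chart M (snd (prod_decode k)) B,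
     trans_fun = \<lambda>k l B x.
       trans_fun L (fst (prod_decode k)) (fst (prod_decode l)) B x \<otimes>\<^bsub>B\<^esub>
       trans_fun M (snd (prod_decode k)) (snd (prod_decode l)) B x\<rparr>"

text \<open>Inverse image along a natural transformation \<open>t : Y \<rightarrow> X\<close>.\<close>

definition pullback_bdl ::
  "('a,'q,'n) pfunctor_scheme \<Rightarrow> ('a alg \<Rightarrow> 'q \<Rightarrow> 'p) \<Rightarrow> ('a,'p) line_bdl \<Rightarrow> ('a,'q) line_bdl" where
  "pullback_bdl Y t L = \<lparr>
     chart = \<lambda>i B. {y \<in> pts Y B. t B y \<in> chart L i B},
     trans_fun = \<lambda>i j B y. trans_fun L i j B (t B y)\<rparr>"

text \<open>Base change along \<open>f : B \<rightarrow> C\<close> of a line bundle on a \<open>B\<close>-scheme.\<close>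

definition base_change_bdl ::
  "('a,'m) ring_scheme \<Rightarrow> ('a \<Rightarrow> 'a) \<Rightarrow> ('a,'p) line_bdl \<Rightarrow> ('a,'p) line_bdl" where
  "base_change_bdl B f L = \<lparr>
     chart = \<lambda>i D. chart L i (restr_scalars B f D),
     trans_fun = \<lambda>i j D. trans_fun L i j (restr_scalars B f D)\<rparr>"

definition bdl_class ::
  "('a,'m) ring_scheme \<Rightarrow> ('a,'p,'n) pfunctor_scheme \<Rightarrow> ('a,'p) line_bdl \<Rightarrow> ('a,'p) line_bdl set" where
  "bdl_class R X L = {M. line_bundle R X M \<and> line_bdl_iso R X L M}"

definition base_functor :: "('a,unit) pfunctor" where
  "base_functor = \<lparr>pts = \<lambda>B. {()}, push = \<lambda>B C f x. ()\<rparr>"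

text \<open>Triviality of the inverse image along the zero section, i.e. \<open>L\<close> can be rigidified.\<close>

definition rigidifiable ::
  "('a,'m) ring_scheme \<Rightarrow> ('a,'p) gfunctor \<Rightarrow> ('a,'p) line_bdl \<Rightarrow> bool" where
  "rigidifiable R A L \<longleftrightarrow>
     line_bdl_iso R (base_functor :: ('a,unit) pfunctor)
       (pullback_bdl (base_functor :: ('a,unit) pfunctor) (\<lambda>D _. unit_pt A D) L)
       (trivial_bdl (base_functor :: ('a,unit) pfunctor))"

text \<open>On an abelian variety over an algebraically closed field, \<open>Pic\<^sup>0\<close> consists of the line bundles
  that are invariant under all translations (Mumford).  On an abelian scheme it is defined
  fibrewise on geometric fibres.\<close>

definition fibrewise_pic0 ::
  "('a,'m) ring_scheme \<Rightarrow> ('a,'p) gfunctor \<Rightarrow> ('a,'p) line_bdl \<Rightarrow> bool" where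
  "fibrewise_pic0 R A L \<longleftrightarrow> (\<forall>F. is_alg R F \<and> algebraically_closed F \<longrightarrow>
     (let A' = gbase_change R F A; L' = base_change_bdl R (smap F) L in
        \<forall>x\<in>pts A' (self_alg F). line_bdl_iso F A' (pullback_bdl A' (translate F A' x) L') L'))"

text \<open>The dual abelian scheme \<open>A\<^sup>\<or> = Pic\<^sup>0(A/R)\<close>: since \<open>A \<rightarrow> Spec R\<close> has a section,
  \<open>Pic(A/R)(B)\<close> is the group of classes of rigidifiable line bundles on \<open>A\<^sub>B\<close>.\<close>

definition dual_scheme ::
  "('a,'m) ring_scheme \<Rightarrow> ('a,'p) gfunctor \<Rightarrow> ('a, ('a,'p) line_bdl set) gfunctor" where
  "dual_scheme R A = \<lparr>
     pts = \<lambda>B. {bdl_class B (gbase_change R B A) L | L.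
        line_bundle B (gbase_change R B A) L \<and> rigidifiable B (gbase_change R B A) L \<and>
        fibrewise_pic0 B (gbase_change R B A) L},
     push = \<lambda>B C f \<xi>. \<Union>L\<in>\<xi>. bdl_class C (gbase_change R C A) (base_change_bdl B f L),
     mul = \<lambda>B \<xi> \<eta>. \<Union>L\<in>\<xi>. \<Union>M\<in>\<eta>. bdl_class B (gbase_change R B A) (tensor_bdl L M),
     unit_pt = \<lambda>B. bdl_class B (gbase_change R B A) (trivial_bdl (gbase_change R B A))\<rparr>"

text \<open>\<open>weil_pairing R A P L e\<close>: the Weil pairing \<open>A[2] \<times> A\<^sup>\<or>[2] \<rightarrow> \<mu>\<^sub>2\<close> over \<open>R\<close> takes the value \<open>e\<close> at
  \<open>P \<in> A[2](R)\<close> and the class of \<open>L\<close>.  If \<open>g\<close> is a trivialisation of \<open>[2]\<^sup>* L\<close>, then \<open>e\<close> is the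
  constant \<open>t\<^sub>P\<^sup>* g / g\<close>, which makes sense because \<open>[2] \<circ> t\<^sub>P = [2]\<close>.  Here \<open>g\<close> is given by the
  functions \<open>a k\<close> on the members \<open>W k\<close> of a cover of \<open>A\<close> with \<open>[2](W k)\<close> inside the chart \<open>r k\<close>; the
  transition function in the last clause compares the charts of \<open>x + P\<close> and of \<open>x\<close>.\<close>

definition weil_pairing ::
  "('a,'m) ring_scheme \<Rightarrow> ('a,'p) gfunctor \<Rightarrow> 'p \<Rightarrow> ('a,'p) line_bdl \<Rightarrow> 'a \<Rightarrow> bool" where
  "weil_pairing R A P L e \<longleftrightarrow> e \<in> Units R \<and> (\<exists>W r a. open_cover R A W \<and>
     (\<forall>k D x. is_alg R D \<and> x \<in> W k D \<longrightarrow> mul A D x x \<in> chart L (r k) D) \<and>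
     (\<forall>k. unit_function R A (W k) (a k)) \<and>
     (\<forall>k l D x. is_alg R D \<and> x \<in> W k D \<inter> W l D \<longrightarrow>
        a k D x \<otimes>\<^bsub>D\<^esub> trans_fun L (r k) (r l) D (mul A D x x) = a l D x) \<and>
     (\<forall>k l D x. is_alg R D \<and> x \<in> W l D \<and> translate R A P D x \<in> W k D \<longrightarrow>
        a k D (translate R A P D x) \<otimes>\<^bsub>D\<^esub> trans_fun L (r k) (r l) D (mul A D x x)
          = smap D e \<otimes>\<^bsub>D\<^esub> a l D x))"

section \<open>Modules over \<open>\<bbbF>\<^sub>2[\<Gamma>]\<close> and permutation representations\<close>

definition f2_module :: "('g,'m) monoid_scheme \<Rightarrow> 'v monoid \<Rightarrow> ('g \<Rightarrow> 'v \<Rightarrow> 'v) \<Rightarrow> bool" where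
  "f2_module G M \<phi> \<longleftrightarrow> comm_group M \<and> (\<forall>x\<in>carrier M. x \<otimes>\<^bsub>M\<^esub> x = \<one>\<^bsub>M\<^esub>) \<and>
     group_action G (carrier M) \<phi> \<and> (\<forall>g\<in>carrier G. \<phi> g \<in> hom M M)"

definition equivariant ::
  "('g,'m) monoid_scheme \<Rightarrow> 'u set \<Rightarrow> ('g \<Rightarrow> 'u \<Rightarrow> 'u) \<Rightarrow> ('g \<Rightarrow> 'v \<Rightarrow> 'v) \<Rightarrow> ('u \<Rightarrow> 'v) \<Rightarrow> bool" where
  "equivariant G X \<phi> \<psi> f \<longleftrightarrow> (\<forall>g\<in>carrier G. \<forall>x\<in>X. f (\<phi> g x) = \<psi> g (f x))"

definition short_exact ::
  "('g,'m) monoid_scheme \<Rightarrow> 'u monoid \<Rightarrow> ('g \<Rightarrow> 'u \<Rightarrow> 'u) \<Rightarrow> 'v monoid \<Rightarrow> ('g \<Rightarrow> 'v \<Rightarrow> 'v)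
     \<Rightarrow> 'w monoid \<Rightarrow> ('g \<Rightarrow> 'w \<Rightarrow> 'w) \<Rightarrow> ('u \<Rightarrow> 'v) \<Rightarrow> ('v \<Rightarrow> 'w) \<Rightarrow> bool" where
  "short_exact G M1 \<phi>1 M \<phi> M2 \<phi>2 i p \<longleftrightarrow>
     f2_module G M1 \<phi>1 \<and> f2_module G M \<phi> \<and> f2_module G M2 \<phi>2 \<and>
     i \<in> hom M1 M \<and> equivariant G (carrier M1) \<phi>1 \<phi> i \<and>
     p \<in> hom M M2 \<and> equivariant G (carrier M) \<phi> \<phi>2 p \<and>
     inj_on i (carrier M1) \<and> i ` carrier M1 = kernel M M2 p \<and> p ` carrier M = carrier M2"

definition seq_splits ::
  "('g,'m) monoid_scheme \<Rightarrow> 'v monoid \<Rightarrow> ('g \<Rightarrow> 'v \<Rightarrow> 'v)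
     \<Rightarrow> 'w monoid \<Rightarrow> ('g \<Rightarrow> 'w \<Rightarrow> 'w) \<Rightarrow> ('v \<Rightarrow> 'w) \<Rightarrow> bool" where
  "seq_splits G M \<phi> M2 \<phi>2 p \<longleftrightarrow>
     (\<exists>s\<in>hom M2 M. equivariant G (carrier M2) \<phi>2 \<phi> s \<and> (\<forall>x\<in>carrier M2. p (s x) = x))"

definition sum_action ::
  "'u monoid \<Rightarrow> ('g \<Rightarrow> 'u \<Rightarrow> 'u) \<Rightarrow> 'v monoid \<Rightarrow> ('g \<Rightarrow> 'v \<Rightarrow> 'v) \<Rightarrow> 'g \<Rightarrow> 'u \<times> 'v \<Rightarrow> 'u \<times> 'v" where
  "sum_action M \<phi> N \<psi> g = (\<lambda>(x, y)\<in>carrier M \<times> carrier N. (\<phi> g x, \<psi> g y))"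

definition alternating :: "'v monoid \<Rightarrow> ('v \<Rightarrow> 'v \<Rightarrow> int) \<Rightarrow> bool" where
  "alternating M b \<longleftrightarrow>
     (\<forall>x\<in>carrier M. b x \<in> hom M (integer_mod_group 2)) \<and>
     (\<forall>y\<in>carrier M. (\<lambda>x. b x y) \<in> hom M (integer_mod_group 2)) \<and>
     (\<forall>x\<in>carrier M. b x x = 0)"

text \<open>The alternating form \<open>\<omega>\<close> induces an isomorphism \<open>\<And>\<^sup>2 M \<cong> \<bbbF>\<^sub>2\<close>: it is nonzero, and by the
  universal property of \<open>\<And>\<^sup>2 M\<close> the \<open>\<bbbF>\<^sub>2\<close>-dual of \<open>\<And>\<^sup>2 M\<close> is \<open>{0, \<omega>}\<close>.\<close>

definition wedge2_iso_F2 :: "'v monoid \<Rightarrow> ('v \<Rightarrow> 'v \<Rightarrow> int) \<Rightarrow> bool" where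
  "wedge2_iso_F2 M \<omega> \<longleftrightarrow> alternating M \<omega> \<and>
     (\<exists>x\<in>carrier M. \<exists>y\<in>carrier M. \<omega> x y \<noteq> 0) \<and>
     (\<forall>b. alternating M b \<longrightarrow>
        (\<forall>x\<in>carrier M. \<forall>y\<in>carrier M. b x y = 0) \<or>
        (\<forall>x\<in>carrier M. \<forall>y\<in>carrier M. b x y = \<omega> x y))"

text \<open>\<open>\<rat>\<^sub>p\<close> is the completion of \<open>\<rat>\<close>: Cauchy sequences modulo null sequences for the \<open>p\<close>-adic
  topology, whose basic neighbourhoods of \<open>0\<close> are the \<open>p\<^sup>n \<int>\<^sub>(\<^sub>p\<^sub>)\<close>.\<close>

definition padic_nbhd :: "nat \<Rightarrow> nat \<Rightarrow> rat set" where
  "padic_nbhd p n = {of_int (int p ^ n * a) / of_int b | a b :: int. \<not> int p dvd b}"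

definition padic_cauchy_ring :: "nat \<Rightarrow> (nat \<Rightarrow> rat) ring" where
  "padic_cauchy_ring p = \<lparr>
     carrier = {s. \<forall>n. \<exists>N. \<forall>i\<ge>N. \<forall>j\<ge>N. s i - s j \<in> padic_nbhd p n},
     monoid.mult = \<lambda>s t i. s i * t i, monoid.one = \<lambda>i. 1, ring.zero = \<lambda>i. 0, add = \<lambda>s t i. s i + t i\<rparr>"

definition padic_field :: "nat \<Rightarrow> (nat \<Rightarrow> rat) set ring" where
  "padic_field p =
     padic_cauchy_ring p Quot {s. \<forall>n. \<exists>N. \<forall>i\<ge>N. s i \<in> padic_nbhd p n}"

text \<open>\<open>Q\<^sup>X\<close> is the space of functions \<open>X \<rightarrow> Q\<close> with \<open>(g \<cdot> f)(x) = f(g\<^sup>-\<^sup>1 x)\<close>.\<close>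

definition perm_act ::
  "('g,'m) monoid_scheme \<Rightarrow> 'x set \<Rightarrow> ('g \<Rightarrow> 'x \<Rightarrow> 'x) \<Rightarrow> 'g \<Rightarrow> ('x \<Rightarrow> 'q) \<Rightarrow> ('x \<Rightarrow> 'q)" where
  "perm_act G X \<phi> g f = (\<lambda>x\<in>X. f (\<phi> (inv\<^bsub>G\<^esub> g) x))"

definition perm_reps_iso ::
  "('q,'n) ring_scheme \<Rightarrow> ('g,'m) monoid_scheme \<Rightarrow> 'x set \<Rightarrow> ('g \<Rightarrow> 'x \<Rightarrow> 'x)
     \<Rightarrow> 'y set \<Rightarrow> ('g \<Rightarrow> 'y \<Rightarrow> 'y) \<Rightarrow> bool" where
  "perm_reps_iso Q G X \<phi> Y \<psi> \<longleftrightarrow>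
     (\<exists>T. bij_betw T (X \<rightarrow>\<^sub>E carrier Q) (Y \<rightarrow>\<^sub>E carrier Q) \<and>
       (\<forall>f\<in>X \<rightarrow>\<^sub>E carrier Q. \<forall>h\<in>X \<rightarrow>\<^sub>E carrier Q.
          T (\<lambda>x\<in>X. f x \<oplus>\<^bsub>Q\<^esub> h x) = (\<lambda>y\<in>Y. T f y \<oplus>\<^bsub>Q\<^esub> T h y)) \<and>
       (\<forall>c\<in>carrier Q. \<forall>f\<in>X \<rightarrow>\<^sub>E carrier Q.
          T (\<lambda>x\<in>X. c \<otimes>\<^bsub>Q\<^esub> f x) = (\<lambda>y\<in>Y. c \<otimes>\<^bsub>Q\<^esub> T f y)) \<and>
       equivariant G (X \<rightarrow>\<^sub>E carrier Q) (perm_act G X \<phi>) (perm_act G Y \<psi>) T)"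

section \<open>The arithmetic base\<close>

definition complete_dvr :: "('a,'m) ring_scheme \<Rightarrow> bool" where
  "complete_dvr R \<longleftrightarrow> principal_domain R \<and> (\<exists>!p. primeideal p R \<and> p \<noteq> {\<zero>\<^bsub>R\<^esub>}) \<and>
     (\<forall>\<pi>\<in>carrier R. primeideal (cgenideal R \<pi>) R \<and> \<pi> \<noteq> \<zero>\<^bsub>R\<^esub> \<longrightarrow>
       (\<forall>x::nat \<Rightarrow> 'a.
          (\<forall>n. x n \<in> carrier R \<and> x (Suc n) \<ominus>\<^bsub>R\<^esub> x n \<in> cgenideal R (\<pi> [^]\<^bsub>R\<^esub> n)) \<longrightarrow>
          (\<exists>y\<in>carrier R. \<forall>n. y \<ominus>\<^bsub>R\<^esub> x n \<in> cgenideal R (\<pi> [^]\<^bsub>R\<^esub> n))))"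

definition integral_closure :: "('a,'m) ring_scheme \<Rightarrow> 'a set \<Rightarrow> 'a set" where
  "integral_closure L S = {x \<in> carrier L. \<exists>f\<in>carrier (univ_poly L S).
     f \<noteq> [] \<and> lead_coeff f = \<one>\<^bsub>L\<^esub> \<and> ring.eval L f x = \<zero>\<^bsub>L\<^esub>}"

text \<open>\<open>r\<close> presents \<open>F\<close> as the residue field of the local ring \<open>R\<close>: its kernel is the set of
  non-units.\<close>

definition residue_map ::
  "('a,'m) ring_scheme \<Rightarrow> ('b,'n) ring_scheme \<Rightarrow> ('a \<Rightarrow> 'b) \<Rightarrow> bool" where
  "residue_map R F r \<longleftrightarrow> cring R \<and> field F \<and> r \<in> ring_hom R F \<and> r ` carrier R = carrier F \<and>
     (\<forall>x\<in>carrier R. r x = \<zero>\<^bsub>F\<^esub> \<longleftrightarrow> x \<notin> Units R)"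

definition gal :: "('a,'m) ring_scheme \<Rightarrow> 'a set \<Rightarrow> ('a \<Rightarrow> 'a) monoid" where
  "gal L K = (BijGroup (carrier L))\<lparr>carrier :=
     {\<sigma> \<in> Bij (carrier L). \<sigma> \<in> ring_hom L L \<and> (\<forall>x\<in>K. \<sigma> x = x)}\<rparr>"

text \<open>\<open>Kcl\<close> is an algebraic closure of \<open>Kset\<close>, the fraction field of \<open>Oset\<close>, and \<open>kcl\<close> is the residue
  field of \<open>Kcl\<close>, i.e. of the integral closure of \<open>Oset\<close> in \<open>Kcl\<close>, with residue map \<open>rmap\<close>.  The
  field \<open>kcl\<close> is also carried by \<open>'a\<close> because it has to be a test algebra.\<close>

record 'a base_data =
  Kcl :: "'a ring"
  Kset :: "'a set"
  Oset :: "'a set"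
  kcl :: "'a ring"
  rmap :: "'a \<Rightarrow> 'a"

definition OK :: "'a base_data \<Rightarrow> 'a ring" where
  "OK D = (Kcl D)\<lparr>carrier := Oset D\<rparr>"

definition OKcl :: "'a base_data \<Rightarrow> 'a ring" where
  "OKcl D = (Kcl D)\<lparr>carrier := integral_closure (Kcl D) (Oset D)\<rparr>"

text \<open>The residue field \<open>k\<close> of \<open>Oset\<close>, as a subfield of \<open>kcl\<close>.\<close>

definition kset :: "'a base_data \<Rightarrow> 'a set" where
  "kset D = rmap D ` Oset D"

definition base_setting :: "'a base_data \<Rightarrow> bool" where
  "base_setting D \<longleftrightarrow>
     algebraic_closure (Kcl D) (Kset D) \<and>
     (\<forall>n::nat. n > 0 \<longrightarrow> add_pow (Kcl D) n \<one>\<^bsub>Kcl D\<^esub> \<noteq> \<zero>\<^bsub>Kcl D\<^esub>) \<and>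
     subring (Oset D) (Kcl D) \<and> complete_dvr (OK D) \<and>
     Kset D = {x \<in> carrier (Kcl D). \<exists>a\<in>Oset D. \<exists>b\<in>Oset D.
        b \<noteq> \<zero>\<^bsub>Kcl D\<^esub> \<and> b \<otimes>\<^bsub>Kcl D\<^esub> x = a} \<and>
     residue_map (OKcl D) (kcl D) (rmap D) \<and>
     \<one>\<^bsub>kcl D\<^esub> \<oplus>\<^bsub>kcl D\<^esub> \<one>\<^bsub>kcl D\<^esub> = \<zero>\<^bsub>kcl D\<^esub> \<and>
     (\<forall>x\<in>kset D. \<exists>y\<in>kset D. y \<otimes>\<^bsub>kcl D\<^esub> y = x)"

abbreviation Kcl_alg :: "'a base_data \<Rightarrow> 'a alg" where
  "Kcl_alg D \<equiv> mk_alg (OK D) (\<lambda>x. x) (Kcl D)"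

abbreviation OKcl_alg :: "'a base_data \<Rightarrow> 'a alg" where
  "OKcl_alg D \<equiv> mk_alg (OK D) (\<lambda>x. x) (OKcl D)"

abbreviation kcl_alg :: "'a base_data \<Rightarrow> 'a alg" where
  "kcl_alg D \<equiv> mk_alg (OK D) (rmap D) (kcl D)"

definition GammaK :: "'a base_data \<Rightarrow> ('a \<Rightarrow> 'a) monoid" where
  "GammaK D = gal (Kcl D) (Kset D)"

definition Gammak :: "'a base_data \<Rightarrow> ('a \<Rightarrow> 'a) monoid" where
  "Gammak D = gal (kcl D) (kset D)"

definition res_gal :: "'a base_data \<Rightarrow> ('a \<Rightarrow> 'a) \<Rightarrow> ('a \<Rightarrow> 'a)" where
  "res_gal D \<sigma> = (\<lambda>y\<in>carrier (kcl D). rmap D (\<sigma> (inv_into (carrier (OKcl D)) (rmap D) y)))"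

section \<open>The connected-etale sequence of the 2-torsion\<close>

definition pt_action :: "('a,'p) gfunctor \<Rightarrow> 'a alg \<Rightarrow> ('a \<Rightarrow> 'a) \<Rightarrow> 'p \<Rightarrow> 'p" where
  "pt_action A B \<sigma> = restrict (push A B B \<sigma>) (pts A B)"

definition V1 :: "'a base_data \<Rightarrow> ('a,'p) gfunctor \<Rightarrow> ('a,'p) line_bdl set monoid" where
  "V1 D A = grp (two_torsion (dual_scheme (OK D) A)) (kcl_alg D)"

definition V2 :: "'a base_data \<Rightarrow> ('a,'p) gfunctor \<Rightarrow> 'p monoid" where
  "V2 D A = grp (two_torsion A) (kcl_alg D)"

definition W :: "'a base_data \<Rightarrow> ('a,'p) gfunctor \<Rightarrow> 'p monoid" where
  "W D A = grp (two_torsion A) (Kcl_alg D)"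

definition actV1 ::
  "'a base_data \<Rightarrow> ('a,'p) gfunctor \<Rightarrow> ('a \<Rightarrow> 'a) \<Rightarrow> ('a,'p) line_bdl set \<Rightarrow> ('a,'p) line_bdl set" where
  "actV1 D A \<sigma> = pt_action (two_torsion (dual_scheme (OK D) A)) (kcl_alg D) (res_gal D \<sigma>)"

definition actV2 :: "'a base_data \<Rightarrow> ('a,'p) gfunctor \<Rightarrow> ('a \<Rightarrow> 'a) \<Rightarrow> 'p \<Rightarrow> 'p" where
  "actV2 D A \<sigma> = pt_action (two_torsion A) (kcl_alg D) (res_gal D \<sigma>)"

definition actW :: "'a base_data \<Rightarrow> ('a,'p) gfunctor \<Rightarrow> ('a \<Rightarrow> 'a) \<Rightarrow> 'p \<Rightarrow> 'p" where
  "actW D A \<sigma> = pt_action (two_torsion A) (Kcl_alg D) \<sigma>"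

definition V :: "'a base_data \<Rightarrow> ('a,'p) gfunctor \<Rightarrow> (('a,'p) line_bdl set \<times> 'p) monoid" where
  "V D A = V1 D A \<times>\<times> V2 D A"

definition actV ::
  "'a base_data \<Rightarrow> ('a,'p) gfunctor \<Rightarrow> ('a \<Rightarrow> 'a)
     \<Rightarrow> ('a,'p) line_bdl set \<times> 'p \<Rightarrow> ('a,'p) line_bdl set \<times> 'p" where
  "actV D A = sum_action (V1 D A) (actV1 D A) (V2 D A) (actV2 D A)"

definition ordinary :: "'a base_data \<Rightarrow> ('a,'p) gfunctor \<Rightarrow> bool" where
  "ordinary D A \<longleftrightarrow>
     grp (two_torsion A) (kcl_alg D) \<cong> integer_mod_group 2 \<times>\<times> integer_mod_group 2"

text \<open>Reduction of points: by properness, a point over \<open>Kcl\<close> extends uniquely to the integral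
  closure of \<open>Oset\<close> in \<open>Kcl\<close>, which is a valuation ring.\<close>

definition reduction :: "'a base_data \<Rightarrow> ('a,'p) gfunctor \<Rightarrow> 'p \<Rightarrow> 'p" where
  "reduction D A w =
     push A (OKcl_alg D) (kcl_alg D) (restrict (rmap D) (carrier (OKcl D)))
       (THE x. x \<in> pts A (OKcl_alg D) \<and>
          push A (OKcl_alg D) (Kcl_alg D) (\<lambda>y\<in>carrier (OKcl D). y) x = w)"

text \<open>The map \<open>i : V1 \<rightarrow> W\<close> is the composite of \<open>V1 \<cong> Hom(V1, \<bbbF>\<^sub>2)\<close>, given by \<open>\<omega>\<close>, and the Cartier
  duality \<open>Hom(V1, \<mu>\<^sub>2) \<cong> A[2]\<^sup>\<circ>(Kcl)\<close>: the Weil pairing of \<open>i v\<close> with any lift \<open>\<eta>\<close> of \<open>v'\<close> to a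
  2-torsion point of the dual scheme is \<open>(-1)\<close> to the power \<open>\<omega> v v'\<close>.\<close>

definition cartier_identification ::
  "'a base_data \<Rightarrow> ('a,'p) gfunctor \<Rightarrow>
     (('a,'p) line_bdl set \<Rightarrow> ('a,'p) line_bdl set \<Rightarrow> int) \<Rightarrow> (('a,'p) line_bdl set \<Rightarrow> 'p) \<Rightarrow> bool" where
  "cartier_identification D A \<omega> i \<longleftrightarrow>
     (let A' = two_torsion (dual_scheme (OK D) A) in
      \<forall>v\<in>carrier (V1 D A). \<forall>v'\<in>carrier (V1 D A). \<forall>\<eta>\<in>pts A' (OKcl_alg D).
        push A' (OKcl_alg D) (kcl_alg D) (restrict (rmap D) (carrier (OKcl D))) \<eta> = v' \<longrightarrow>
        (\<forall>L\<in>push A' (OKcl_alg D) (Kcl_alg D) (\<lambda>y\<in>carrier (OKcl D). y) \<eta>.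
           weil_pairing (Kcl_alg D) (gbase_change (OK D) (Kcl_alg D) A) (i v) L
             (if \<omega> v v' = 0 then \<one>\<^bsub>Kcl D\<^esub> else \<ominus>\<^bsub>Kcl D\<^esub> \<one>\<^bsub>Kcl D\<^esub>)))"

definition connected_etale_seq ::
  "'a base_data \<Rightarrow> ('a,'p) gfunctor \<Rightarrow>
     (('a,'p) line_bdl set \<Rightarrow> ('a,'p) line_bdl set \<Rightarrow> int) \<Rightarrow> (('a,'p) line_bdl set \<Rightarrow> 'p) \<Rightarrow> bool" where
  "connected_etale_seq D A \<omega> i \<longleftrightarrow>
     wedge2_iso_F2 (V1 D A) \<omega> \<and> cartier_identification D A \<omega> i \<and>
     short_exact (GammaK D) (V1 D A) (actV1 D A) (W D A) (actW D A) (V2 D A) (actV2 D A)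
       i (reduction D A)"

definition unramified ::
  "'a base_data \<Rightarrow> 'v monoid \<Rightarrow> (('a \<Rightarrow> 'a) \<Rightarrow> 'v \<Rightarrow> 'v) \<Rightarrow> bool" where
  "unramified D M \<phi> \<longleftrightarrow>
     (\<exists>\<rho>. f2_module (Gammak D) M \<rho> \<and> (\<forall>\<sigma>\<in>carrier (GammaK D). \<phi> \<sigma> = \<rho> (res_gal D \<sigma>)))"

end

theory Submission
  imports Defs
begin

text \<open>
  Everything reduces to one implication: if every \<open>\<sigma>\<close> that acts trivially on \<open>V\<close> acts trivially on
  \<open>W\<close>, then the sequence splits.  An isomorphism of permutation representations forces this
  condition because an element acts trivially on \<open>Q\<^sup>X\<close> only if it fixes \<open>X\<close> pointwise, and equality
  of cardinalities forces it because \<open>G\<^sub>W\<close> maps onto \<open>G\<^sub>V\<close>.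

  To split the sequence, note that there are 9 pairs of nonzero vectors \<open>(v, z)\<close> in \<open>V\<^sub>1 \<times> V\<^sub>2\<close>.  The
  stabiliser of a pair acts on \<open>V\<close> through a subgroup of \<open>(\<int>/2)\<^sup>2\<close> that permutes a basis of each
  of \<open>V\<^sub>1\<close> and \<open>V\<^sub>2\<close>, and such a group fixes a section.  Choosing such sections compatibly with the
  group action on the pairs and adding up the 9 of them, an odd number, gives an equivariant section.

  For the last claim, a splitting identifies \<open>W\<close> with \<open>V\<^sub>1 \<oplus> V\<^sub>2\<close>, on which \<open>\<Gamma>\<^sub>k\<close> acts by functoriality.
  For \<open>V\<^sub>1\<close> this means transporting line bundles along automorphisms of the residue field.
\<close>

section \<open>Groups of exponent 2\<close>

text \<open>The number 9 has a Sylow-theoretic origin. The linear group of a plane over F_2 is S_3,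
  permuting the three nonzero vectors, and the stabiliser of a pair of vectors is a Sylow 2-subgroup
  of S_3 x S_3. The obstruction to splitting lies in an H^1 with coefficients killed by 2, so it is
  detected on a Sylow 2-subgroup; the sum over pairs is the corresponding transfer, written with
  sections instead of cocycles. The condition on kernels lets W be treated as a module over the
  image of the Galois group in S_3 x S_3.

  On a stabiliser the vanishing is Shapiro's lemma. V_2 is a permutation module there, so a section
  amounts to one fixed lift for each orbit of basis vectors, fixed under the stabiliser of a vector
  of that orbit. The latter group acts on V_1 trivially or through the regular representation of
  Z/2.

  On the geometric side the difficulty is the dual scheme, whose points are raw sets of cocycles:
  its functoriality has to be proved, here for automorphisms of the residue field.\<close>

locale boolean_group = comm_group M for M :: "'v monoid" (structure) +
  assumes sq: "x \<in> carrier M \<Longrightarrow> x \<otimes> x = \<one>"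
begin

lemma sq_cancel: "x \<in> carrier M \<Longrightarrow> y \<in> carrier M \<Longrightarrow> x \<otimes> (x \<otimes> y) = y"
  by (simp add: m_assoc[symmetric] sq)

lemma m_eq_iff: "x \<in> carrier M \<Longrightarrow> y \<in> carrier M \<Longrightarrow> z \<in> carrier M \<Longrightarrow> x \<otimes> y = z \<longleftrightarrow> y = x \<otimes> z"
  using sq_cancel by metis

lemma m_eq_one_iff: "x \<in> carrier M \<Longrightarrow> y \<in> carrier M \<Longrightarrow> x \<otimes> y = \<one> \<longleftrightarrow> y = x"
  using m_eq_iff[of x y \<one>] by simp

lemma inv_self: "x \<in> carrier M \<Longrightarrow> inv x = x"
  by (rule inv_unique'[symmetric]) (simp_all add: sq)

text \<open>Scalars act through their parity; the averaging argument multiplies an odd number of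
  equal factors.\<close>

lemma odd_power:
  assumes "x \<in> carrier M" "odd n"
  shows "x [^] (n::nat) = x"
proof -
  obtain m where n: "n = Suc (2 * m)" using assms(2) by (auto elim: oddE)
  have "x [^] (2 * m) = (x [^] (2::nat)) [^] m" using assms(1) by (simp add: nat_pow_pow)
  moreover have "x [^] (2::nat) = \<one>" using assms(1) by (simp add: numeral_2_eq_2 sq)
  ultimately show ?thesis using assms(1) by (simp add: n)
qed

text \<open>The vector \<open>v\<close> is prescribed because it will be the one fixed by a
  stabiliser; \<open>x\<close> completes it to a basis.\<close>

lemma card_4_basis:
  assumes card: "card (carrier M) = 4" and v: "v \<in> carrier M" "v \<noteq> \<one>"
  obtains x where "x \<in> carrier M" "x \<noteq> \<one>" "x \<noteq> v" "carrier M = {\<one>, v, x, x \<otimes> v}"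
proof -
  have fin: "finite (carrier M)" using card card.infinite by fastforce
  have "carrier M \<noteq> {\<one>, v}" using card v card_2_iff[of "{\<one>, v}"] by (auto simp: card_insert_if)
  then obtain x where x: "x \<in> carrier M" "x \<noteq> \<one>" "x \<noteq> v" using v by blast
  have ne: "x \<otimes> v \<noteq> \<one>" "x \<otimes> v \<noteq> x" "x \<otimes> v \<noteq> v"
    using x v m_eq_one_iff[of x v] by auto
  have "card {\<one>, v, x, x \<otimes> v} = 4" using x v ne by (auto simp: card_insert_if)
  moreover have "{\<one>, v, x, x \<otimes> v} \<subseteq> carrier M" using x v by auto
  ultimately have "carrier M = {\<one>, v, x, x \<otimes> v}"
    using fin card by (metis card_subset_eq)
  with x that show thesis by blast
qed

text \<open>\<open>M\<close> is not yet known to be finite, hence Zorn's lemma: a subgroup maximal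
  among those avoiding \<open>r\<close> has index 2, and \<open>h\<close> is the quotient
  map.\<close>

lemma ex_functional:
  assumes r: "r \<in> carrier M" "r \<noteq> \<one>"
  obtains h where "h \<in> hom M (integer_mod_group 2)" "h r = 1"
proof -
  define \<A> where "\<A> = {H. subgroup H M \<and> r \<notin> H}"
  have subI: "subgroup H M" if "H \<subseteq> carrier M" "\<one> \<in> H" "\<And>x y. x \<in> H \<Longrightarrow> y \<in> H \<Longrightarrow> x \<otimes> y \<in> H" for H
    by (rule subgroupI) (use that inv_self in \<open>auto simp: subset_iff\<close>)
  have "{\<one>} \<in> \<A>" using r by (auto simp: \<A>_def intro!: subI)
  moreover have "\<Union>\<C> \<in> \<A>" if ne: "\<C> \<noteq> {}" and ch: "subset.chain \<A> \<C>" for \<C>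
  proof -
    have sg: "subgroup H M \<and> r \<notin> H" if "H \<in> \<C>" for H
      using ch that by (auto simp: \<A>_def subset.chain_def)
    have "subgroup (\<Union>\<C>) M"
    proof (rule subI)
      show "\<Union>\<C> \<subseteq> carrier M" using sg subgroup.subset by blast
      show "\<one> \<in> \<Union>\<C>" using sg ne subgroup.one_closed by blast
      fix x y assume "x \<in> \<Union>\<C>" "y \<in> \<Union>\<C>"
      then obtain H K where HK: "H \<in> \<C>" "K \<in> \<C>" "x \<in> H" "y \<in> K" by auto
      then have "H \<subseteq> K \<or> K \<subseteq> H" using ch by (auto simp: subset.chain_def)
      then show "x \<otimes> y \<in> \<Union>\<C>" using HK sg subgroup.m_closed by (metis UnionI subsetD)
    qed
    then show ?thesis using sg by (auto simp: \<A>_def)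
  qed
  ultimately obtain H where H: "H \<in> \<A>" and max: "\<And>K. K \<in> \<A> \<Longrightarrow> H \<subseteq> K \<Longrightarrow> K = H"
    using subset_Zorn_nonempty[of \<A>] by blast
  have Hs: "subgroup H M" "r \<notin> H" using H by (auto simp: \<A>_def)
  note Hc = subgroup.mem_carrier[OF Hs(1)] and Hm = subgroup.m_closed[OF Hs(1)]
    and H1 = subgroup.one_closed[OF Hs(1)]
  \<comment> \<open>A vector \<open>z\<close> outside \<open>H\<close> enlarges \<open>H\<close> to
    the union of \<open>H\<close> and its coset of \<open>z\<close>, which by maximality contains
    \<open>r\<close>. So \<open>r\<close> and \<open>z\<close> lie in the same coset.\<close>
  have coset: "r \<otimes> z \<in> H" if z: "z \<in> carrier M" "z \<notin> H" for z
  proof -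
    let ?K = "H \<union> (\<lambda>h. z \<otimes> h) ` H"
    have sK: "subgroup ?K M"
    proof (rule subI)
      show "?K \<subseteq> carrier M" using z Hc by auto
      show "\<one> \<in> ?K" using H1 by simp
      fix x y assume xy: "x \<in> ?K" "y \<in> ?K"
      have 1: "h \<otimes> (z \<otimes> k) = z \<otimes> (h \<otimes> k)" "z \<otimes> h \<otimes> (z \<otimes> k) = h \<otimes> k" "z \<otimes> h \<otimes> k = z \<otimes> (h \<otimes> k)"
        if "h \<in> H" "k \<in> H" for h k
        using Hc[OF that(1)] Hc[OF that(2)] z by (simp_all add: m_ac sq_cancel sq)
      show "x \<otimes> y \<in> ?K" using xy by (auto simp: 1 Hm)
    qed
    have "z \<in> ?K" using H1 z by force
    then have "?K \<notin> \<A>" using max[of ?K] z by blast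
    then have "r \<in> ?K" using sK by (auto simp: \<A>_def)
    then obtain h where h: "h \<in> H" "r = z \<otimes> h" using Hs by auto
    have "r \<otimes> z = h" using h(2) Hc[OF h(1)] z by (simp add: m_ac sq_cancel sq)
    then show ?thesis using h by simp
  qed
  define h where "h z = (if z \<in> H then 0 else 1 :: int)" for z
  have mem: "x \<otimes> y \<in> H \<longleftrightarrow> (x \<in> H \<longleftrightarrow> y \<in> H)" if xy: "x \<in> carrier M" "y \<in> carrier M" for x y
  proof -
    have a: "y \<in> H" if "x \<in> H" "x \<otimes> y \<in> H" "y \<in> carrier M" for x y
      using Hm[OF that(1,2)] Hc[OF that(1)] that(3) by (simp add: sq_cancel)
    have b: "x \<otimes> y \<in> H" if "x \<notin> H" "y \<notin> H"
    proof -
      have "(r \<otimes> x) \<otimes> (r \<otimes> y) = x \<otimes> y" using xy r by (simp add: m_ac sq_cancel)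
      then show ?thesis using Hm[OF coset[OF xy(1) that(1)] coset[OF xy(2) that(2)]] by simp
    qed
    show ?thesis using a[of x y] a[of y x] b Hm[of x y] xy by (auto simp: m_comm)
  qed
  have "h \<in> hom M (integer_mod_group 2)"
    by (rule homI) (auto simp: h_def carrier_integer_mod_group mem)
  moreover have "h r = 1" using Hs by (simp add: h_def)
  ultimately show thesis using that by blast
qed

text \<open>A nonzero vector in the radical would give a second alternating form, the wedge product of
  \<open>\<omega>(y, \<cdot>)\<close> with a functional that does not vanish on it.\<close>

lemma card_wedge2_iso_F2:
  assumes "wedge2_iso_F2 M \<omega>"
  shows "card (carrier M) = 4"
proof -
  have alt: "alternating M \<omega>"
    and uniq: "\<And>b. alternating M b \<Longrightarrow> (\<forall>x\<in>carrier M. \<forall>y\<in>carrier M. b x y = 0) \<or>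
        (\<forall>x\<in>carrier M. \<forall>y\<in>carrier M. b x y = \<omega> x y)"
    using assms by (auto simp: wedge2_iso_F2_def)
  obtain x y where x: "x \<in> carrier M" and y: "y \<in> carrier M" and xy: "\<omega> x y \<noteq> 0"
    using assms by (auto simp: wedge2_iso_F2_def)
  have h1: "\<omega> u \<in> hom M (integer_mod_group 2)" "(\<lambda>w. \<omega> w u) \<in> hom M (integer_mod_group 2)"
    "\<omega> u u = 0" if "u \<in> carrier M" for u
    using alt that by (auto simp: alternating_def)
  have rng: "\<omega> u w = 0 \<or> \<omega> u w = 1" if "u \<in> carrier M" "w \<in> carrier M" for u w
    using hom_in_carrier[OF h1(1)[OF that(1)] that(2)] by (auto simp: carrier_integer_mod_group)
  have add: "\<omega> u (w \<otimes> z) = (\<omega> u w + \<omega> u z) mod 2" "\<omega> (w \<otimes> z) u = (\<omega> w u + \<omega> z u) mod 2"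
    if "u \<in> carrier M" "w \<in> carrier M" "z \<in> carrier M" for u w z
    using hom_mult[OF h1(1)] hom_mult[OF h1(2)] that by simp_all
  have one: "\<omega> u \<one> = 0" if "u \<in> carrier M" for u
    using hom_one[OF h1(1)[OF that]] by (simp add: is_group)
  have xy1: "\<omega> x y = 1" using rng[OF x y] xy by simp
  \<comment> \<open>Alternating forms are symmetric mod 2: expand \<open>\<omega>\<close> on the sum
    of \<open>x\<close> and \<open>y\<close> paired with itself.\<close>
  have yx1: "\<omega> y x = 1"
  proof -
    have "0 = \<omega> (x \<otimes> y) (x \<otimes> y)" using x y h1(3) by simp
    also have "\<dots> = (\<omega> x y + \<omega> y x) mod 2"
      using x y h1(3)[OF x] h1(3)[OF y] by (simp add: add mod_add_eq add.commute)
    finally show ?thesis using xy1 rng[OF y x] by auto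
  qed
  have rad: "r = \<one>" if r: "r \<in> carrier M" and r0: "\<omega> x r = 0" "\<omega> y r = 0" for r
  proof (rule ccontr)
    assume "r \<noteq> \<one>"
    then obtain h where h: "h \<in> hom M (integer_mod_group 2)" "h r = 1"
      using ex_functional r by blast
    have hadd: "h (u \<otimes> w) = (h u + h w) mod 2" if "u \<in> carrier M" "w \<in> carrier M" for u w
      using hom_mult[OF h(1)] that by simp
    have hr: "h u = 0 \<or> h u = 1" if "u \<in> carrier M" for u
      using hom_in_carrier[OF h(1) that] by (auto simp: carrier_integer_mod_group)
    \<comment> \<open>At \<open>(x, r)\<close> only the first term survives, with value
      \<open>\<omega> y x * h r = 1\<close>, whereas \<open>\<omega>\<close> vanishes there.\<close>
    define b where "b u w = (\<omega> y u * h w + \<omega> y w * h u) mod 2" for u w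
    have b_add: "b u (w \<otimes> z) = (b u w + b u z) mod 2"
      if "u \<in> carrier M" "w \<in> carrier M" "z \<in> carrier M" for u w z
      using rng[OF y that(1)] rng[OF y that(2)] rng[OF y that(3)] hr[OF that(1)]
        hr[OF that(2)] hr[OF that(3)]
      by (auto simp: b_def add[OF y that(2,3)] hadd[OF that(2,3)])
    have b_rng: "0 \<le> b u w" "b u w < 2" for u w by (simp_all add: b_def)
    have "alternating M b"
      unfolding alternating_def
    proof (intro conjI ballI)
      fix u assume u: "u \<in> carrier M"
      show "b u \<in> hom M (integer_mod_group 2)"
        by (rule homI) (use u in \<open>simp_all add: carrier_integer_mod_group b_add b_rng\<close>)
      moreover have "(\<lambda>x. b x u) = b u" by (simp add: b_def fun_eq_iff add.commute)
      ultimately show "(\<lambda>x. b x u) \<in> hom M (integer_mod_group 2)" by simp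
      show "b u u = 0" by (simp add: b_def)
    qed
    moreover have "b x r = 1" using h r0 yx1 by (simp add: b_def)
    moreover have "\<omega> x r = 0" by (fact r0)
    ultimately show False using uniq[of b] x r by (metis zero_neq_one)
  qed
  have "u \<in> {\<one>, x, y, x \<otimes> y}" if u: "u \<in> carrier M" for u
  proof -
    \<comment> \<open>The indices are crossed: pairing with \<open>x\<close> reads off the
      coefficient of \<open>y\<close>, and pairing with \<open>y\<close> that of \<open>x\<close>.
      Removing both components leaves a vector in the radical.\<close>
    let ?a = "if \<omega> x u = 0 then \<one> else y" and ?b = "if \<omega> y u = 0 then \<one> else x"
    have c: "?a \<in> carrier M" "?b \<in> carrier M" using x y by auto
    have "u \<otimes> (?a \<otimes> ?b) = \<one>"
      by (rule rad)
        (use x y u c rng[OF x u] rng[OF y u] in \<open>auto simp: add one h1(3) xy1 yx1\<close>)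
    then have "u = ?a \<otimes> ?b"
      using m_eq_one_iff[of u "?a \<otimes> ?b"] u c by auto
    then show ?thesis using x y by (auto simp: m_comm split: if_splits)
  qed
  then have carr: "carrier M = {\<one>, x, y, x \<otimes> y}" using x y by auto
  have ne: "x \<noteq> \<one>" "y \<noteq> \<one>" "x \<noteq> y" using xy1 yx1 one x y h1(3)[OF x] by auto
  then have "x \<otimes> y \<noteq> \<one>" "x \<otimes> y \<noteq> x" "x \<otimes> y \<noteq> y"
    using x y m_eq_one_iff[of x y] by auto
  with ne show ?thesis unfolding carr by (simp add: card_insert_if)
qed

end

lemma boolean_groupI: "f2_module G M \<phi> \<Longrightarrow> boolean_group M"
  by (simp add: f2_module_def boolean_group_def boolean_group_axioms_def)

section \<open>Averaging sections\<close>

locale f2_extension =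
  fixes G :: "('g,'m) monoid_scheme" (structure)
    and M1 :: "'u monoid" and \<phi>1 and M :: "'v monoid" and \<phi> and M2 :: "'w monoid" and \<phi>2
    and i :: "'u \<Rightarrow> 'v" and p :: "'v \<Rightarrow> 'w"
  assumes exact: "short_exact G M1 \<phi>1 M \<phi> M2 \<phi>2 i p"
begin

section \<open>Rules for the actions, the inclusion and the projection of an exact sequence\<close>

lemma f2_modules: "f2_module G M1 \<phi>1" "f2_module G M \<phi>" "f2_module G M2 \<phi>2"
  using exact by (auto simp: short_exact_def)

sublocale M1: boolean_group M1 using f2_modules(1) by (rule boolean_groupI)
sublocale M: boolean_group M using f2_modules(2) by (rule boolean_groupI)
sublocale M2: boolean_group M2 using f2_modules(3) by (rule boolean_groupI)

sublocale a1: group_action G "carrier M1" \<phi>1 using f2_modules(1) by (simp add: f2_module_def)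
sublocale a: group_action G "carrier M" \<phi> using f2_modules(2) by (simp add: f2_module_def)
sublocale a2: group_action G "carrier M2" \<phi>2 using f2_modules(3) by (simp add: f2_module_def)

sublocale group G using a.group_hom by (simp add: group_hom_def)

lemma act_hom:
  "g \<in> carrier G \<Longrightarrow> \<phi>1 g \<in> hom M1 M1"
  "g \<in> carrier G \<Longrightarrow> \<phi> g \<in> hom M M"
  "g \<in> carrier G \<Longrightarrow> \<phi>2 g \<in> hom M2 M2"
  using f2_modules by (auto simp: f2_module_def)

lemmas act_mult = act_hom[THEN hom_mult]

lemma act_closed [simp]:
  "g \<in> carrier G \<Longrightarrow> x \<in> carrier M1 \<Longrightarrow> \<phi>1 g x \<in> carrier M1"
  "g \<in> carrier G \<Longrightarrow> y \<in> carrier M \<Longrightarrow> \<phi> g y \<in> carrier M"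
  "g \<in> carrier G \<Longrightarrow> z \<in> carrier M2 \<Longrightarrow> \<phi>2 g z \<in> carrier M2"
  using act_hom by (auto intro: hom_in_carrier)

lemma act_comp:
  "g \<in> carrier G \<Longrightarrow> h \<in> carrier G \<Longrightarrow> x \<in> carrier M1 \<Longrightarrow> \<phi>1 (g \<otimes> h) x = \<phi>1 g (\<phi>1 h x)"
  "g \<in> carrier G \<Longrightarrow> h \<in> carrier G \<Longrightarrow> y \<in> carrier M \<Longrightarrow> \<phi> (g \<otimes> h) y = \<phi> g (\<phi> h y)"
  "g \<in> carrier G \<Longrightarrow> h \<in> carrier G \<Longrightarrow> z \<in> carrier M2 \<Longrightarrow> \<phi>2 (g \<otimes> h) z = \<phi>2 g (\<phi>2 h z)"
  by (auto intro: a1.composition_rule a.composition_rule a2.composition_rule)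

lemma act_one [simp]:
  "x \<in> carrier M1 \<Longrightarrow> \<phi>1 \<one> x = x" "y \<in> carrier M \<Longrightarrow> \<phi> \<one> y = y" "z \<in> carrier M2 \<Longrightarrow> \<phi>2 \<one> z = z"
  by (simp_all flip: a1.id_eq_one a.id_eq_one a2.id_eq_one)

lemma act_unit [simp]:
  assumes "g \<in> carrier G"
  shows "\<phi>1 g \<one>\<^bsub>M1\<^esub> = \<one>\<^bsub>M1\<^esub>" "\<phi> g \<one>\<^bsub>M\<^esub> = \<one>\<^bsub>M\<^esub>" "\<phi>2 g \<one>\<^bsub>M2\<^esub> = \<one>\<^bsub>M2\<^esub>"
  using act_hom[OF assms] by (auto intro: hom_one M1.is_group M.is_group M2.is_group)

lemma act_inj:
  "g \<in> carrier G \<Longrightarrow> x \<in> carrier M1 \<Longrightarrow> y \<in> carrier M1 \<Longrightarrow> \<phi>1 g x = \<phi>1 g y \<longleftrightarrow> x = y"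
  "g \<in> carrier G \<Longrightarrow> x' \<in> carrier M2 \<Longrightarrow> y' \<in> carrier M2 \<Longrightarrow> \<phi>2 g x' = \<phi>2 g y' \<longleftrightarrow> x' = y'"
  using inj_on_eq_iff[OF a1.inj_prop] inj_on_eq_iff[OF a2.inj_prop] by blast+

lemma i_hom: "i \<in> hom M1 M" and p_hom: "p \<in> hom M M2"
  using exact by (auto simp: short_exact_def)

lemmas i_mult = hom_mult[OF i_hom] and p_mult = hom_mult[OF p_hom]

lemma i_closed [simp]: "x \<in> carrier M1 \<Longrightarrow> i x \<in> carrier M"
  and p_closed [simp]: "y \<in> carrier M \<Longrightarrow> p y \<in> carrier M2"
  using i_hom p_hom by (auto intro: hom_in_carrier)

lemma i_one [simp]: "i \<one>\<^bsub>M1\<^esub> = \<one>\<^bsub>M\<^esub>" and p_one [simp]: "p \<one>\<^bsub>M\<^esub> = \<one>\<^bsub>M2\<^esub>"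
  using i_hom p_hom by (auto intro: hom_one M1.is_group M.is_group M2.is_group)

lemma i_equivariant: "g \<in> carrier G \<Longrightarrow> x \<in> carrier M1 \<Longrightarrow> \<phi> g (i x) = i (\<phi>1 g x)"
  and p_equivariant: "g \<in> carrier G \<Longrightarrow> y \<in> carrier M \<Longrightarrow> p (\<phi> g y) = \<phi>2 g (p y)"
  using exact by (auto simp: short_exact_def equivariant_def)

lemma i_inj: "inj_on i (carrier M1)"
  using exact by (auto simp: short_exact_def)

lemma p_i [simp]: "x \<in> carrier M1 \<Longrightarrow> p (i x) = \<one>\<^bsub>M2\<^esub>"
  using exact by (auto simp: short_exact_def kernel_def)

lemma kernelE:
  assumes "y \<in> carrier M" "p y = \<one>\<^bsub>M2\<^esub>"
  obtains x where "x \<in> carrier M1" "y = i x"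
proof -
  have "y \<in> i ` carrier M1" using assms exact by (auto simp: short_exact_def kernel_def)
  then show thesis using that by blast
qed

lemma lift:
  assumes "z \<in> carrier M2"
  obtains y where "y \<in> carrier M" "p y = z"
proof -
  have "z \<in> p ` carrier M" using assms exact by (auto simp: short_exact_def)
  then show thesis using that by blast
qed

lemma same_fibreE:
  assumes "y \<in> carrier M" "y' \<in> carrier M" "p y = p y'"
  obtains x where "x \<in> carrier M1" "y' = y \<otimes>\<^bsub>M\<^esub> i x"
proof -
  have "p (y \<otimes>\<^bsub>M\<^esub> y') = \<one>\<^bsub>M2\<^esub>" using assms by (simp add: p_mult M2.sq)
  then obtain x where "x \<in> carrier M1" "y \<otimes>\<^bsub>M\<^esub> y' = i x" using kernelE[of "y \<otimes>\<^bsub>M\<^esub> y'"] assms by auto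
  then show thesis using that M.m_eq_iff[of y y' "i x"] assms by auto
qed

section \<open>Equivariant sections by summation over a finite set\<close>

definition is_section :: "('w \<Rightarrow> 'v) \<Rightarrow> bool" where
  "is_section s \<longleftrightarrow> s \<in> hom M2 M \<and> (\<forall>x\<in>carrier M2. p (s x) = x)"

lemma seq_splits_iff:
  "seq_splits G M \<phi> M2 \<phi>2 p \<longleftrightarrow>
     (\<exists>s. is_section s \<and> (\<forall>g\<in>carrier G. \<forall>x\<in>carrier M2. s (\<phi>2 g x) = \<phi> g (s x)))"
  by (auto simp: seq_splits_def is_section_def equivariant_def)

text \<open>Multiplication by an odd number is the identity in characteristic 2, so a sum of an odd
  number of sections is a section. Acting by \<open>g\<close> permutes the summands, which makes the
  sum equivariant.\<close>

lemma seq_splits_average: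
  assumes fin: "finite E" and odd: "odd (card E)"
    and sec: "\<And>e. e \<in> E \<Longrightarrow> is_section (s e)"
    and bij: "\<And>g. g \<in> carrier G \<Longrightarrow> bij_betw (\<alpha> g) E E"
    and eqv: "\<And>g e x. g \<in> carrier G \<Longrightarrow> e \<in> E \<Longrightarrow> x \<in> carrier M2 \<Longrightarrow>
                s (\<alpha> g e) (\<phi>2 g x) = \<phi> g (s e x)"
  shows "seq_splits G M \<phi> M2 \<phi>2 p"
proof -
  define t where "t x = finprod M (\<lambda>e. s e x) E" for x
  have sc: "s e x \<in> carrier M" if "e \<in> E" "x \<in> carrier M2" for e x
    using sec[OF that(1)] that(2) by (auto simp: is_section_def intro: hom_in_carrier)
  have finprod_hom: "f (finprod M k E) = finprod N (\<lambda>e. f (k e)) E"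
    if "comm_group N" "f \<in> hom M N" "\<And>e. e \<in> E \<Longrightarrow> k e \<in> carrier M"
    for N :: "'x monoid" and f k
  proof -
    interpret N: comm_group N by fact
    interpret group_hom M N f
      using that(2) by (simp add: group_hom_def group_hom_axioms_def M.is_group N.is_group)
    show ?thesis using fin that(3)
      by (induction E rule: finite_induct) (simp_all add: Pi_def)
  qed
  have "is_section t"
    unfolding is_section_def
  proof (intro conjI ballI)
    have "t (x \<otimes>\<^bsub>M2\<^esub> y) = t x \<otimes>\<^bsub>M\<^esub> t y" if xy: "x \<in> carrier M2" "y \<in> carrier M2" for x y
    proof -
      have "t (x \<otimes>\<^bsub>M2\<^esub> y) = finprod M (\<lambda>e. s e x \<otimes>\<^bsub>M\<^esub> s e y) E"
        unfolding t_def
        by (rule M.finprod_cong') (use sec xy in \<open>auto simp: sc is_section_def hom_mult\<close>)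
      then show ?thesis using xy by (simp add: t_def M.finprod_multf sc Pi_def)
    qed
    then show "t \<in> hom M2 M" by (auto intro!: homI simp: t_def sc)
    fix x assume x: "x \<in> carrier M2"
    have "p (t x) = finprod M2 (\<lambda>e. p (s e x)) E"
      unfolding t_def by (rule finprod_hom) (use x sc p_hom M2.comm_group_axioms in auto)
    also have "\<dots> = finprod M2 (\<lambda>e. x) E"
      by (rule M2.finprod_cong') (use x sec in \<open>auto simp: is_section_def\<close>)
    also have "\<dots> = x" using x odd by (simp add: M2.finprod_const M2.odd_power)
    finally show "p (t x) = x" .
  qed
  moreover have "t (\<phi>2 g x) = \<phi> g (t x)" if gx: "g \<in> carrier G" "x \<in> carrier M2" for g x
  proof -
    have im: "\<alpha> g ` E = E" and inj: "inj_on (\<alpha> g) E" using bij[OF gx(1)] by (auto simp: bij_betw_def)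
    have "t (\<phi>2 g x) = finprod M (\<lambda>e. s e (\<phi>2 g x)) (\<alpha> g ` E)" by (simp add: t_def im)
    also have "\<dots> = finprod M (\<lambda>e. s (\<alpha> g e) (\<phi>2 g x)) E"
      by (rule M.finprod_reindex) (use inj im sc gx in auto)
    also have "\<dots> = finprod M (\<lambda>e. \<phi> g (s e x)) E"
      by (rule M.finprod_cong') (use gx in \<open>auto simp: sc eqv\<close>)
    also have "\<dots> = \<phi> g (t x)"
      unfolding t_def
      by (rule finprod_hom[symmetric]) (use gx sc act_hom M.comm_group_axioms in auto)
    finally show ?thesis .
  qed
  ultimately show ?thesis unfolding seq_splits_iff by blast
qed

text \<open>Sections chosen on one representative of each orbit are transported along the orbits.\<close>

lemma seq_splits_stabilizers:
  assumes fin: "finite E" and odd: "odd (card E)"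
    and cl: "\<And>g e. g \<in> carrier G \<Longrightarrow> e \<in> E \<Longrightarrow> \<alpha> g e \<in> E"
    and one: "\<And>e. e \<in> E \<Longrightarrow> \<alpha> \<one> e = e"
    and comp: "\<And>g h e. g \<in> carrier G \<Longrightarrow> h \<in> carrier G \<Longrightarrow> e \<in> E \<Longrightarrow> \<alpha> (g \<otimes> h) e = \<alpha> g (\<alpha> h e)"
    and stab: "\<And>e. e \<in> E \<Longrightarrow> \<exists>s. is_section s \<and>
       (\<forall>g\<in>carrier G. \<alpha> g e = e \<longrightarrow> (\<forall>x\<in>carrier M2. s (\<phi>2 g x) = \<phi> g (s x)))"
  shows "seq_splits G M \<phi> M2 \<phi>2 p"
proof -
  define orb where "orb e = {\<alpha> g e | g. g \<in> carrier G}" for e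
  \<comment> \<open>The choice is made from the orbit as a set, so all elements of one orbit receive
    the same representative.\<close>
  define rep where "rep e = (SOME e'. e' \<in> orb e)" for e
  define tr where "tr e = (SOME g. g \<in> carrier G \<and> \<alpha> g (rep e) = e)" for e
  obtain \<sigma> where \<sigma>: "\<And>e. e \<in> E \<Longrightarrow> is_section (\<sigma> e)"
    "\<And>e g x. e \<in> E \<Longrightarrow> g \<in> carrier G \<Longrightarrow> \<alpha> g e = e \<Longrightarrow> x \<in> carrier M2 \<Longrightarrow> \<sigma> e (\<phi>2 g x) = \<phi> g (\<sigma> e x)"
    using stab by metis
  have inv_act: "\<alpha> (inv g) (\<alpha> g e) = e" if "g \<in> carrier G" "e \<in> E" for g e
    using that by (simp flip: comp add: one)
  have orb_act: "orb (\<alpha> g e) = orb e" if ge: "g \<in> carrier G" "e \<in> E" for g e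
  proof -
    have 1: "\<exists>k. \<alpha> h (\<alpha> g e) = \<alpha> k e \<and> k \<in> carrier G" if "h \<in> carrier G" for h
      by (rule exI[of _ "h \<otimes> g"]) (use that ge in \<open>simp add: comp\<close>)
    have 2: "\<exists>k. \<alpha> h e = \<alpha> k (\<alpha> g e) \<and> k \<in> carrier G" if "h \<in> carrier G" for h
      by (rule exI[of _ "h \<otimes> inv g"]) (use that ge in \<open>simp add: comp cl inv_act\<close>)
    show ?thesis unfolding orb_def by (intro equalityI subsetI) (use 1 2 in auto)
  qed
  have rep_orb: "rep e \<in> orb e" if "e \<in> E" for e
    unfolding rep_def by (rule someI[of _ "\<alpha> \<one> e"]) (auto simp: orb_def)
  have rep_E: "rep e \<in> E" if "e \<in> E" for e
    using rep_orb[OF that] cl that by (auto simp: orb_def)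
  have tr: "tr e \<in> carrier G \<and> \<alpha> (tr e) (rep e) = e" if e: "e \<in> E" for e
  proof -
    obtain g where "g \<in> carrier G" "rep e = \<alpha> g e" using rep_orb[OF e] by (auto simp: orb_def)
    then have "inv g \<in> carrier G \<and> \<alpha> (inv g) (rep e) = e" using e by (simp add: inv_act)
    then show ?thesis unfolding tr_def by (rule someI)
  qed
  \<comment> \<open>The section at the representative is conjugated by an element carrying the
    representative to \<open>e\<close>.\<close>
  define s where "s e x = \<phi> (tr e) (\<sigma> (rep e) (\<phi>2 (inv tr e) x))" for e x
  have \<sigma>c: "\<sigma> e x \<in> carrier M" if "e \<in> E" "x \<in> carrier M2" for e x
    using \<sigma>(1)[OF that(1)] that(2) by (auto simp: is_section_def intro: hom_in_carrier)
  show ?thesis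
  proof (rule seq_splits_average[OF fin odd])
    show "is_section (s e)" if e: "e \<in> E" for e
      unfolding is_section_def
    proof (intro conjI ballI)
      have h: "\<sigma> (rep e) \<in> hom M2 M" and r: "\<And>x. x \<in> carrier M2 \<Longrightarrow> p (\<sigma> (rep e) x) = x"
        using \<sigma>(1)[OF rep_E[OF e]] by (auto simp: is_section_def)
      show "s e \<in> hom M2 M"
        by (rule homI)
          (use tr[OF e] rep_E[OF e] in \<open>auto simp: s_def \<sigma>c act_mult hom_mult[OF h]\<close>)
      show "p (s e x) = x" if x: "x \<in> carrier M2" for x
        using x tr[OF e] rep_E[OF e] by (simp add: s_def p_equivariant \<sigma>c r flip: act_comp)
    qed
    show "bij_betw (\<alpha> g) E E" if "g \<in> carrier G" for g
      by (rule bij_betw_byWitness[where f' = "\<alpha> (inv g)"])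
        (use that in \<open>auto simp: cl one simp flip: comp\<close>)
    show "s (\<alpha> g e) (\<phi>2 g x) = \<phi> g (s e x)"
      if ge: "g \<in> carrier G" "e \<in> E" and x: "x \<in> carrier M2" for g e x
    proof -
      let ?e' = "\<alpha> g e"
      have e': "?e' \<in> E" using ge cl by simp
      have rep_eq: "rep ?e' = rep e" using orb_act[OF ge] by (simp add: rep_def)
      \<comment> \<open>Two ways of reaching \<open>\<alpha> g e\<close> from the representative
        differ by \<open>k\<close>, which stabilises the representative; there equivariance of
        \<open>\<sigma>\<close> is known.\<close>
      define k where "k = inv (tr ?e') \<otimes> (g \<otimes> tr e)"
      have t: "tr e \<in> carrier G" "\<alpha> (tr e) (rep e) = e"
        "tr ?e' \<in> carrier G" "\<alpha> (tr ?e') (rep e) = ?e'" using tr[OF ge(2)] tr[OF e'] rep_eq by auto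
      have k: "k \<in> carrier G" using t ge by (simp add: k_def)
      have kfix: "\<alpha> k (rep e) = rep e"
        using t ge rep_E[OF ge(2)] e' inv_act[OF t(3) rep_E[OF ge(2)]]
        by (simp add: k_def comp cl)
      have tk: "tr ?e' \<otimes> k = g \<otimes> tr e" using t ge by (simp add: k_def flip: m_assoc)
      have kt: "inv (tr ?e') \<otimes> g = k \<otimes> inv (tr e)"
        using t ge by (simp add: k_def m_assoc)
      have "s ?e' (\<phi>2 g x) = \<phi> (tr ?e') (\<sigma> (rep e) (\<phi>2 (inv (tr ?e') \<otimes> g) x))"
        using t ge x by (simp add: s_def rep_eq act_comp)
      also have "\<dots> = \<phi> (tr ?e') (\<phi> k (\<sigma> (rep e) (\<phi>2 (inv (tr e)) x)))"
        using t k kfix x rep_E[OF ge(2)] by (simp add: kt act_comp \<sigma>(2))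
      also have "\<dots> = \<phi> g (s e x)"
        using t k ge x rep_E[OF ge(2)] by (simp add: s_def \<sigma>c tk flip: act_comp)
      finally show ?thesis .
    qed
  qed
qed


end

section \<open>Sections fixed by stabilisers\<close>

context f2_extension
begin

text \<open>Commutativity and exponent 2 are the only relations between two basis vectors, and they
  hold for any lifts. The proof runs through the 16 products of the Klein four-group.\<close>

lemma section_of_basis:
  assumes carr: "carrier M2 = {\<one>\<^bsub>M2\<^esub>, z, x, x \<otimes>\<^bsub>M2\<^esub> z}"
    and ne: "z \<noteq> \<one>\<^bsub>M2\<^esub>" "x \<noteq> \<one>\<^bsub>M2\<^esub>" "x \<noteq> z"
    and w: "w \<in> carrier M" "p w = x" and w': "w' \<in> carrier M" "p w' = z"
  obtains s where "is_section s" "s x = w" "s z = w'"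
proof -
  define y where "y = x \<otimes>\<^bsub>M2\<^esub> z"
  have c: "x \<in> carrier M2" "z \<in> carrier M2" unfolding carr by simp_all
  have c': "y \<in> carrier M2" using c by (simp add: y_def)
  have table: "x \<otimes>\<^bsub>M2\<^esub> z = y" "z \<otimes>\<^bsub>M2\<^esub> x = y" "x \<otimes>\<^bsub>M2\<^esub> y = z" "y \<otimes>\<^bsub>M2\<^esub> x = z"
    "y \<otimes>\<^bsub>M2\<^esub> z = x" "z \<otimes>\<^bsub>M2\<^esub> y = x" "x \<otimes>\<^bsub>M2\<^esub> x = \<one>\<^bsub>M2\<^esub>" "y \<otimes>\<^bsub>M2\<^esub> y = \<one>\<^bsub>M2\<^esub>"
    "z \<otimes>\<^bsub>M2\<^esub> z = \<one>\<^bsub>M2\<^esub>"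
    using c by (simp_all add: y_def M2.m_ac M2.sq_cancel M2.sq)
  have ne': "y \<noteq> \<one>\<^bsub>M2\<^esub>" "y \<noteq> x" "y \<noteq> z"
    using c ne M2.m_eq_one_iff[of x z] by (auto simp: y_def)
  define s where "s u = (if u = \<one>\<^bsub>M2\<^esub> then \<one>\<^bsub>M\<^esub> else if u = x then w else if u = z then w'
    else w \<otimes>\<^bsub>M\<^esub> w')" for u
  have s: "s \<one>\<^bsub>M2\<^esub> = \<one>\<^bsub>M\<^esub>" "s x = w" "s z = w'" "s y = w \<otimes>\<^bsub>M\<^esub> w'"
    using ne ne' by (auto simp: s_def)
  have carr': "u \<in> carrier M2 \<longleftrightarrow> u = \<one>\<^bsub>M2\<^esub> \<or> u = z \<or> u = x \<or> u = y" for u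
    unfolding carr y_def[symmetric] by auto
  have "s \<in> hom M2 M"
  proof (rule homI)
    show "s u \<in> carrier M" if "u \<in> carrier M2" for u
      using that w w' by (auto simp: s_def)
    show "s (u \<otimes>\<^bsub>M2\<^esub> u') = s u \<otimes>\<^bsub>M\<^esub> s u'" if "u \<in> carrier M2" "u' \<in> carrier M2" for u u'
      using that[unfolded carr'] c c' w w'
      by (elim disjE; simp add: s table M.m_ac M.sq_cancel M.sq)
  qed
  moreover have "p (s u) = u" if "u \<in> carrier M2" for u
    using that[unfolded carr'] w w' by (elim disjE; simp add: s p_mult table)
  ultimately show thesis using that s by (auto simp: is_section_def)
qed

lemma section_equivariant_of_basis:
  assumes carr: "carrier M2 = {\<one>\<^bsub>M2\<^esub>, z, x, x \<otimes>\<^bsub>M2\<^esub> z}"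
    and s: "is_section s" and g: "g \<in> carrier G"
    and eq: "s (\<phi>2 g x) = \<phi> g (s x)" "s (\<phi>2 g z) = \<phi> g (s z)" and u: "u \<in> carrier M2"
  shows "s (\<phi>2 g u) = \<phi> g (s u)"
proof -
  have c: "x \<in> carrier M2" "z \<in> carrier M2" unfolding carr by simp_all
  have s': "s \<in> hom M2 M" using s by (simp add: is_section_def)
  have sc: "s t \<in> carrier M" if "t \<in> carrier M2" for t
    using hom_in_carrier[OF s' that] .
  have s1: "s \<one>\<^bsub>M2\<^esub> = \<one>\<^bsub>M\<^esub>" using s' by (auto intro: hom_one M.is_group M2.is_group)
  have "u = \<one>\<^bsub>M2\<^esub> \<or> u = z \<or> u = x \<or> u = x \<otimes>\<^bsub>M2\<^esub> z" using u unfolding carr by auto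
  then show ?thesis
    using c g eq by (elim disjE) (simp_all add: s1 act_mult hom_mult[OF s'] sc)
qed

definition faithful_on_sum :: bool where
  "faithful_on_sum \<longleftrightarrow> (\<forall>g\<in>carrier G. (\<forall>x\<in>carrier M1. \<phi>1 g x = x) \<and> (\<forall>z\<in>carrier M2. \<phi>2 g z = z)
     \<longrightarrow> (\<forall>y\<in>carrier M. \<phi> g y = y))"

lemma faithfulD:
  "faithful_on_sum \<Longrightarrow> g \<in> carrier G \<Longrightarrow> (\<And>x. x \<in> carrier M1 \<Longrightarrow> \<phi>1 g x = x) \<Longrightarrow>
    (\<And>z. z \<in> carrier M2 \<Longrightarrow> \<phi>2 g z = z) \<Longrightarrow> y \<in> carrier M \<Longrightarrow> \<phi> g y = y"
  by (simp add: faithful_on_sum_def)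

text \<open>The elements fixing \<open>v\<close> act on \<open>M1\<close> through a group of order at most 2.  If \<open>q\<close> acts
  nontrivially, \<open>M1\<close> is free over the group algebra of \<open>\<langle>q\<rangle>\<close>, so the cocycle obstructing a
  fixed lift is a coboundary.\<close>

lemma fixed_lift:
  assumes faithful: faithful_on_sum and card1: "card (carrier M1) = 4"
    and v: "v \<in> carrier M1" "v \<noteq> \<one>\<^bsub>M1\<^esub>" and x: "x \<in> carrier M2"
  obtains w where "w \<in> carrier M" "p w = x"
    "\<And>g. g \<in> carrier G \<Longrightarrow> \<phi>1 g v = v \<Longrightarrow> (\<And>z. z \<in> carrier M2 \<Longrightarrow> \<phi>2 g z = z) \<Longrightarrow> \<phi> g w = w"
proof -
  obtain a where a: "a \<in> carrier M1" "a \<noteq> \<one>\<^bsub>M1\<^esub>" "a \<noteq> v"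
    and carr: "carrier M1 = {\<one>\<^bsub>M1\<^esub>, v, a, a \<otimes>\<^bsub>M1\<^esub> v}"
    using M1.card_4_basis[OF card1 v] by blast
  have cases1: "u = \<one>\<^bsub>M1\<^esub> \<or> u = v \<or> u = a \<or> u = a \<otimes>\<^bsub>M1\<^esub> v" if "u \<in> carrier M1" for u
    using that unfolding carr by auto
  have av: "a \<otimes>\<^bsub>M1\<^esub> v \<noteq> a" using a v by simp
  have triv1: "\<phi>1 g u = u" if "g \<in> carrier G" "\<phi>1 g v = v" "\<phi>1 g a = a" "u \<in> carrier M1" for g u
    using cases1[OF that(4)] that(1-3) a v by (elim disjE) (simp_all add: act_mult)
  have act_a: "\<phi>1 g a = a \<or> \<phi>1 g a = a \<otimes>\<^bsub>M1\<^esub> v" if g: "g \<in> carrier G" "\<phi>1 g v = v" for g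
  proof -
    have "\<phi>1 g a \<noteq> \<phi>1 g \<one>\<^bsub>M1\<^esub>" "\<phi>1 g a \<noteq> \<phi>1 g v" using g(1) a v by (simp_all add: act_inj del: act_unit)
    then show ?thesis using cases1[of "\<phi>1 g a"] g a by auto
  qed
  define K where "K = {g \<in> carrier G. \<phi>1 g v = v \<and> (\<forall>z\<in>carrier M2. \<phi>2 g z = z)}"
  have fixK: "\<phi> g y = y" if "g \<in> K" "\<phi>1 g a = a" "y \<in> carrier M" for g y
    using that triv1 by (intro faithfulD[OF faithful]) (auto simp: K_def)
  obtain w where w: "w \<in> carrier M" "p w = x" using lift[OF x] .
  have "\<exists>w'\<in>carrier M. p w' = x \<and> (\<forall>g\<in>K. \<phi> g w' = w')"
  proof (cases "\<exists>q\<in>K. \<phi>1 q a \<noteq> a")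
    case False
    then show ?thesis using w fixK by blast
  next
    case True
    then obtain q where q: "q \<in> K" "\<phi>1 q a \<noteq> a" by blast
    have qG: "q \<in> carrier G" and qv: "\<phi>1 q v = v" and q2: "\<And>z. z \<in> carrier M2 \<Longrightarrow> \<phi>2 q z = z"
      using q by (auto simp: K_def)
    have qa: "\<phi>1 q a = a \<otimes>\<^bsub>M1\<^esub> v" using act_a[OF qG qv] q by simp
    have qav: "\<phi>1 q (a \<otimes>\<^bsub>M1\<^esub> v) = a" using qG qv qa a v by (simp add: act_mult M1.m_ac M1.sq_cancel M1.sq)
    \<comment> \<open>Two elements of \<open>K\<close> that move \<open>a\<close> have a product
      that fixes \<open>a\<close> and hence acts trivially on \<open>M\<close>. With
      \<open>g = q\<close> this makes \<open>q\<close> an involution on \<open>M\<close>; in general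
      it makes \<open>g\<close> act like \<open>q\<close>.\<close>
    have qg: "\<phi> q (\<phi> g y) = y" if "g \<in> K" "\<phi>1 g a \<noteq> a" "y \<in> carrier M" for g y
    proof -
      have g: "g \<in> carrier G" "\<phi>1 g v = v" "\<phi>1 g a = a \<otimes>\<^bsub>M1\<^esub> v"
        using that act_a[of g] by (auto simp: K_def)
      have "q \<otimes> g \<in> K" using that q by (auto simp: K_def act_comp v)
      moreover have "\<phi>1 (q \<otimes> g) a = a" using g qG qav a by (simp add: act_comp)
      ultimately have "\<phi> (q \<otimes> g) y = y" using that(3) by (rule fixK)
      then show ?thesis using g qG that(3) by (simp add: act_comp)
    qed
    have "p w = p (\<phi> q w)" using w qG q2 x by (simp add: p_equivariant)
    then obtain u where u: "u \<in> carrier M1" "\<phi> q w = w \<otimes>\<^bsub>M\<^esub> i u"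
      using same_fibreE[of w "\<phi> q w"] w qG by auto
    \<comment> \<open>Applying \<open>q\<close> twice shows that \<open>u\<close> is fixed by
      \<open>q\<close>, and the fixed vectors of \<open>q\<close> are the unit and
      \<open>v\<close>.\<close>
    have "w = \<phi> q (\<phi> q w)" using qg[OF q w(1)] by simp
    also have "\<dots> = w \<otimes>\<^bsub>M\<^esub> (i u \<otimes>\<^bsub>M\<^esub> i (\<phi>1 q u))"
      using u w qG by (simp add: act_mult i_equivariant M.m_assoc)
    finally have "i u \<otimes>\<^bsub>M\<^esub> i (\<phi>1 q u) = \<one>\<^bsub>M\<^esub>" using u w qG by (simp add: M.m_eq_iff M.sq)
    then have "i (\<phi>1 q u) = i u" using M.m_eq_one_iff[of "i u" "i (\<phi>1 q u)"] u qG by simp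
    then have "\<phi>1 q u = u" using inj_onD[OF i_inj] u qG by simp
    then have u_cases: "u = \<one>\<^bsub>M1\<^esub> \<or> u = v" using cases1[OF u(1)] qa qav av by auto
    \<comment> \<open>\<open>v\<close> is the sum of \<open>a\<close> and its image under
      \<open>q\<close>, so adding \<open>i a\<close> to the lift cancels the defect
      \<open>u = v\<close>.\<close>
    define w' where "w' = (if u = \<one>\<^bsub>M1\<^esub> then w else w \<otimes>\<^bsub>M\<^esub> i a)"
    have w': "w' \<in> carrier M" "p w' = x" using w a x by (auto simp: w'_def p_mult)
    have qw': "\<phi> q w' = w'"
    proof (cases "u = \<one>\<^bsub>M1\<^esub>")
      case True
      then show ?thesis using u w by (simp add: w'_def)
    next
      case False
      then have "\<phi> q w' = (w \<otimes>\<^bsub>M\<^esub> i v) \<otimes>\<^bsub>M\<^esub> i (a \<otimes>\<^bsub>M1\<^esub> v)"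
        using u u_cases w a qG by (auto simp: w'_def act_mult i_equivariant qa)
      then show ?thesis using False w a v by (simp add: w'_def i_mult M.m_ac M.sq_cancel M.sq)
    qed
    have "\<phi> g w' = w'" if g: "g \<in> K" for g
    proof (cases "\<phi>1 g a = a")
      case False
      have "\<phi> q (\<phi> g w') = \<phi> q w'" using qg[OF g False w'(1)] qw' by simp
      then show ?thesis
        using inj_onD[OF a.inj_prop[OF qG]] w' g by (auto simp: K_def)
    qed (use fixK g w' in blast)
    then show ?thesis using w' by blast
  qed
  then show thesis using that by (auto simp: K_def)
qed

text \<open>The stabiliser of \<open>z\<close> permutes the basis \<open>{x, x z}\<close>; lifts of the two vectors are chosen so
  that they are permuted in the same way.\<close>

lemma stabilizer_section:
  assumes faithful: faithful_on_sum
    and card1: "card (carrier M1) = 4" and card2: "card (carrier M2) = 4"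
    and v: "v \<in> carrier M1" "v \<noteq> \<one>\<^bsub>M1\<^esub>" and z: "z \<in> carrier M2" "z \<noteq> \<one>\<^bsub>M2\<^esub>"
  shows "\<exists>s. is_section s \<and> (\<forall>g\<in>carrier G. \<phi>1 g v = v \<and> \<phi>2 g z = z \<longrightarrow>
           (\<forall>u\<in>carrier M2. s (\<phi>2 g u) = \<phi> g (s u)))"
proof -
  obtain x where x: "x \<in> carrier M2" "x \<noteq> \<one>\<^bsub>M2\<^esub>" "x \<noteq> z"
    and carr: "carrier M2 = {\<one>\<^bsub>M2\<^esub>, z, x, x \<otimes>\<^bsub>M2\<^esub> z}"
    using M2.card_4_basis[OF card2 z] by blast
  define y where "y = x \<otimes>\<^bsub>M2\<^esub> z"
  have y: "y \<in> carrier M2" using x z by (simp add: y_def)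
  have xy: "x \<noteq> y" using x z by (simp add: y_def)
  have yz: "y \<otimes>\<^bsub>M2\<^esub> z = x" using x z by (simp add: y_def M2.m_ac M2.sq)
  have cases2: "u = \<one>\<^bsub>M2\<^esub> \<or> u = z \<or> u = x \<or> u = y" if "u \<in> carrier M2" for u
    using that unfolding carr y_def by auto
  define H where "H = {g \<in> carrier G. \<phi>1 g v = v \<and> \<phi>2 g z = z}"
  have HG: "g \<in> carrier G" "\<phi>1 g v = v" "\<phi>2 g z = z" if "g \<in> H" for g using that by (auto simp: H_def)
  have H_mult: "g \<otimes> h \<in> H" if "g \<in> H" "h \<in> H" for g h using that v z by (auto simp: H_def act_comp)
  have H_inv: "inv g \<in> H" if "g \<in> H" for g
    using HG[OF that] v z act_comp(1)[of "inv g" g v] act_comp(3)[of "inv g" g z] by (simp add: H_def)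
  have act_y: "\<phi>2 g y = \<phi>2 g x \<otimes>\<^bsub>M2\<^esub> z" if "g \<in> H" for g
    using HG[OF that] x z by (simp add: y_def act_mult)
  have act_x: "\<phi>2 g x = x \<or> \<phi>2 g x = y" if g: "g \<in> H" for g
  proof -
    have "\<phi>2 g x \<noteq> \<phi>2 g \<one>\<^bsub>M2\<^esub>" "\<phi>2 g x \<noteq> \<phi>2 g z"
      using HG(1)[OF g] x z by (simp_all add: act_inj del: act_unit)
    then show ?thesis using cases2[of "\<phi>2 g x"] HG[OF g] x by auto
  qed
  have triv2: "\<phi>2 g u = u" if "g \<in> H" "\<phi>2 g x = x" "u \<in> carrier M2" for g u
    using cases2[OF that(3)] that HG[OF that(1)] act_y[OF that(1)] by (auto simp: y_def)
  \<comment> \<open>An element of \<open>H\<close> that fixes \<open>x\<close> also fixes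
    \<open>z\<close>, hence all of \<open>M2\<close>, as \<open>fixed_lift\<close> demands.\<close>
  obtain wx where wx: "wx \<in> carrier M" "p wx = x"
    and fx: "\<And>g. g \<in> H \<Longrightarrow> \<phi>2 g x = x \<Longrightarrow> \<phi> g wx = wx"
    using fixed_lift[OF faithful card1 v x(1)] HG triv2 by metis
  \<comment> \<open>If nothing in \<open>H\<close> swaps \<open>x\<close> and \<open>y\<close>, the
    second lift is chosen independently. If some \<open>t\<close> does, the second lift has to be
    \<open>\<phi> t wx\<close>, and it must be checked that every other swap gives the same
    vector.\<close>
  have "\<exists>wy\<in>carrier M. p wy = y \<and> (\<forall>g\<in>H. (\<phi>2 g x = x \<longrightarrow> \<phi> g wy = wy) \<and>
      (\<phi>2 g x = y \<longrightarrow> \<phi> g wx = wy \<and> \<phi> g wy = wx))"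
  proof (cases "\<exists>t\<in>H. \<phi>2 t x = y")
    case False
    obtain wy where "wy \<in> carrier M" "p wy = y"
      "\<And>g. g \<in> H \<Longrightarrow> \<phi>2 g x = x \<Longrightarrow> \<phi> g wy = wy"
      using fixed_lift[OF faithful card1 v y] HG triv2 by metis
    then show ?thesis using False by blast
  next
    case True
    then obtain t where t: "t \<in> H" "\<phi>2 t x = y" by blast
    note tG = HG(1)[OF t(1)]
    have ty: "\<phi>2 t y = x" using act_y[OF t(1)] t yz by simp
    have t'y: "\<phi>2 (inv t) y = x"
      using t tG x y act_comp(3)[of "inv t" t x] by simp
    have tt: "\<phi> t (\<phi> (inv t) m) = m" if "m \<in> carrier M" for m
      using that tG by (simp flip: act_comp)
    \<comment> \<open>Conjugation by \<open>t\<close> turns an element fixing \<open>y\<close> into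
      one fixing \<open>x\<close>.\<close>
    have 1: "\<phi> g (\<phi> t wx) = \<phi> t wx" if g: "g \<in> H" "\<phi>2 g x = x" for g
    proof -
      note gG = HG(1)[OF g(1)]
      have k: "inv t \<otimes> (g \<otimes> t) \<in> H" using g t H_mult H_inv by simp
      have gy: "\<phi>2 g y = y" using triv2[OF g y] .
      have "\<phi>2 (inv t \<otimes> (g \<otimes> t)) x = x"
        using gG tG t x gy t'y by (simp add: act_comp)
      then have "\<phi> (inv t \<otimes> (g \<otimes> t)) wx = wx" by (rule fx[OF k])
      then have "\<phi> (inv t) (\<phi> g (\<phi> t wx)) = wx" using gG tG wx by (simp add: act_comp)
      then show ?thesis using tt[of "\<phi> g (\<phi> t wx)"] gG tG wx by simp
    qed
    have 2: "\<phi> g wx = \<phi> t wx" if g: "g \<in> H" "\<phi>2 g x = y" for g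
    proof -
      note gG = HG(1)[OF g(1)]
      have "\<phi>2 (inv t \<otimes> g) x = x" using gG tG x g t'y by (simp add: act_comp)
      then have "\<phi> (inv t \<otimes> g) wx = wx" by (rule fx[OF H_mult[OF H_inv[OF t(1)] g(1)]])
      then have "\<phi> (inv t) (\<phi> g wx) = wx" using gG tG wx by (simp add: act_comp)
      then show ?thesis using tt[of "\<phi> g wx"] gG tG wx by simp
    qed
    have 3: "\<phi> g (\<phi> t wx) = wx" if g: "g \<in> H" "\<phi>2 g x = y" for g
    proof -
      note gG = HG(1)[OF g(1)]
      have "\<phi>2 (g \<otimes> t) x = x" using gG tG x t g act_y[OF g(1)] yz by (simp add: act_comp)
      then have "\<phi> (g \<otimes> t) wx = wx" by (rule fx[OF H_mult[OF g(1) t(1)]])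
      then show ?thesis using gG tG wx by (simp add: act_comp)
    qed
    have "\<phi> t wx \<in> carrier M" "p (\<phi> t wx) = y" using t tG wx by (simp_all add: p_equivariant)
    then show ?thesis using 1 2 3 by blast
  qed
  then obtain wy where wy: "wy \<in> carrier M" "p wy = y"
    and fy: "\<And>g. g \<in> H \<Longrightarrow> \<phi>2 g x = x \<Longrightarrow> \<phi> g wy = wy"
    and sw: "\<And>g. g \<in> H \<Longrightarrow> \<phi>2 g x = y \<Longrightarrow> \<phi> g wx = wy"
      "\<And>g. g \<in> H \<Longrightarrow> \<phi>2 g x = y \<Longrightarrow> \<phi> g wy = wx"
    by blast
  \<comment> \<open>\<open>z\<close> is the sum of \<open>x\<close> and \<open>y\<close>, and the
    sum of the two lifts is unchanged when they are swapped.\<close>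
  have "p (wx \<otimes>\<^bsub>M\<^esub> wy) = z" using wx wy x z by (simp add: p_mult y_def M2.sq_cancel)
  then obtain s where s: "is_section s" "s x = wx" "s z = wx \<otimes>\<^bsub>M\<^esub> wy"
    using section_of_basis[OF carr z(2) x(2,3) wx M.m_closed[OF wx(1) wy(1)]] by blast
  have "s (x \<otimes>\<^bsub>M2\<^esub> z) = s x \<otimes>\<^bsub>M\<^esub> s z" using s(1) x z by (simp add: is_section_def hom_mult)
  then have sy: "s y = wy" using s wx wy by (simp add: y_def M.sq_cancel)
  have "s (\<phi>2 g u) = \<phi> g (s u)" if g: "g \<in> H" and u: "u \<in> carrier M2" for g u
  proof (rule section_equivariant_of_basis[OF carr s(1) HG(1)[OF g] _ _ u])
    show "s (\<phi>2 g x) = \<phi> g (s x)"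
      using act_x[OF g] fx[OF g] sw(1)[OF g] s(2) sy by fastforce
    have "\<phi> g wx \<otimes>\<^bsub>M\<^esub> \<phi> g wy = wx \<otimes>\<^bsub>M\<^esub> wy"
      using act_x[OF g]
    proof
      assume "\<phi>2 g x = x"
      then show ?thesis using fx[OF g] fy[OF g] by simp
    next
      assume "\<phi>2 g x = y"
      then show ?thesis using sw[OF g] M.m_comm[OF wx(1) wy(1)] by simp
    qed
    then show "s (\<phi>2 g z) = \<phi> g (s z)"
      using HG[OF g] wx wy by (simp add: s(3) act_mult)
  qed
  then show ?thesis using s(1) by (auto simp: H_def)
qed

lemma seq_splits_if_faithful:
  assumes faithful: faithful_on_sum
    and card1: "card (carrier M1) = 4" and card2: "card (carrier M2) = 4"
  shows "seq_splits G M \<phi> M2 \<phi>2 p"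
proof (rule seq_splits_stabilizers)
  let ?E = "(carrier M1 - {\<one>\<^bsub>M1\<^esub>}) \<times> (carrier M2 - {\<one>\<^bsub>M2\<^esub>})"
  let ?\<alpha> = "\<lambda>g (v, z). (\<phi>1 g v, \<phi>2 g z)"
  have fin: "finite (carrier M1)" "finite (carrier M2)"
    using card1 card2 by (auto intro: card_ge_0_finite)
  then show "finite ?E" by simp
  have "card ?E = 9" using card1 card2 fin by (simp add: card_cartesian_product)
  then show "odd (card ?E)" by simp
  have ne: "\<phi>1 g v = \<one>\<^bsub>M1\<^esub> \<longleftrightarrow> v = \<one>\<^bsub>M1\<^esub>" "\<phi>2 g z = \<one>\<^bsub>M2\<^esub> \<longleftrightarrow> z = \<one>\<^bsub>M2\<^esub>"
    if "g \<in> carrier G" "v \<in> carrier M1" "z \<in> carrier M2" for g v z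
    using that act_inj(1)[of g v "\<one>\<^bsub>M1\<^esub>"] act_inj(2)[of g z "\<one>\<^bsub>M2\<^esub>"] by simp_all
  show "?\<alpha> g e \<in> ?E" if "g \<in> carrier G" "e \<in> ?E" for g e
    using that ne by auto
  show "?\<alpha> \<one> e = e" if "e \<in> ?E" for e using that by auto
  show "?\<alpha> (g \<otimes> h) e = ?\<alpha> g (?\<alpha> h e)" if "g \<in> carrier G" "h \<in> carrier G" "e \<in> ?E" for g h e
    using that by (auto simp: act_comp)
  show "\<exists>s. is_section s \<and> (\<forall>g\<in>carrier G. ?\<alpha> g e = e \<longrightarrow>
      (\<forall>x\<in>carrier M2. s (\<phi>2 g x) = \<phi> g (s x)))" if e_in: "e \<in> ?E" for e
  proof -
    obtain v z where e: "e = (v, z)" "v \<in> carrier M1" "v \<noteq> \<one>\<^bsub>M1\<^esub>"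
      "z \<in> carrier M2" "z \<noteq> \<one>\<^bsub>M2\<^esub>" using e_in by auto
    show ?thesis
      using stabilizer_section[OF faithful card1 card2 e(2-5)] by (simp add: e(1))
  qed
qed

end

section \<open>Consequences of a splitting\<close>

text \<open>Bijectivity follows from the group law, the inverse element supplying the inverse map.
  Extensionality is demanded because \<open>BijGroup\<close> consists of extensional maps.\<close>

lemma group_actionI:
  assumes "group G"
    and ext: "\<And>g. g \<in> carrier G \<Longrightarrow> \<phi> g \<in> extensional E"
    and cl: "\<And>g x. g \<in> carrier G \<Longrightarrow> x \<in> E \<Longrightarrow> \<phi> g x \<in> E"
    and one: "\<And>x. x \<in> E \<Longrightarrow> \<phi> \<one>\<^bsub>G\<^esub> x = x"
    and comp: "\<And>g h x. g \<in> carrier G \<Longrightarrow> h \<in> carrier G \<Longrightarrow> x \<in> E \<Longrightarrow> \<phi> (g \<otimes>\<^bsub>G\<^esub> h) x = \<phi> g (\<phi> h x)"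
  shows "group_action G E \<phi>"
proof -
  interpret group G by fact
  have inv: "\<phi> (inv\<^bsub>G\<^esub> g) (\<phi> g x) = x" "\<phi> g (\<phi> (inv\<^bsub>G\<^esub> g) x) = x" if "g \<in> carrier G" "x \<in> E" for g x
    using that by (simp_all add: one flip: comp)
  have bij: "\<phi> g \<in> Bij E" if "g \<in> carrier G" for g
    unfolding Bij_def using that ext
    by (auto intro!: bij_betw_byWitness[where f' = "\<phi> (inv\<^bsub>G\<^esub> g)"] simp: inv cl)
  have "\<phi> (g \<otimes>\<^bsub>G\<^esub> h) = compose E (\<phi> g) (\<phi> h)" if "g \<in> carrier G" "h \<in> carrier G" for g h
    by (rule extensionalityI[of _ E]) (use that ext comp in \<open>auto simp: compose_def\<close>)
  then have "\<phi> \<in> hom G (BijGroup E)" by (auto simp: BijGroup_def hom_def bij)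
  then show ?thesis
    by (simp add: group_action_def group_hom_def group_hom_axioms_def group_BijGroup is_group)
qed

text \<open>Functions are transported by composing with the inverse of \<open>\<theta>\<close>. Sums
  and multiples are pointwise, so this is linear over any coefficients.\<close>

lemma perm_reps_iso_if_equivariant_bij:
  assumes X: "group_action G X \<phi>" and Y: "group_action G Y \<psi>"
    and bij: "bij_betw \<theta> X Y"
    and eqv: "\<And>g x. g \<in> carrier G \<Longrightarrow> x \<in> X \<Longrightarrow> \<theta> (\<phi> g x) = \<psi> g (\<theta> x)"
  shows "perm_reps_iso Q G X \<phi> Y \<psi>"
proof -
  interpret X: group_action G X \<phi> by fact
  interpret Y: group_action G Y \<psi> by fact
  have grp: "group G" using X.group_hom by (simp add: group_hom_def)
  define \<theta>' where "\<theta>' = inv_into X \<theta>"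
  have \<theta>: "\<theta> x \<in> Y" "\<theta>' (\<theta> x) = x" if "x \<in> X" for x
    using that bij by (auto simp: \<theta>'_def bij_betw_def)
  have \<theta>': "\<theta>' y \<in> X" "\<theta> (\<theta>' y) = y" if "y \<in> Y" for y
    using that bij by (auto simp: \<theta>'_def bij_betw_def inv_into_into f_inv_into_f)
  have eqv': "\<theta>' (\<psi> g y) = \<phi> g (\<theta>' y)" if "g \<in> carrier G" "y \<in> Y" for g y
  proof -
    have "\<psi> g y = \<theta> (\<phi> g (\<theta>' y))" using that \<theta>' by (simp add: eqv)
    then show ?thesis using that \<theta> \<theta>' X.element_image by metis
  qed
  define T where "T f = (\<lambda>y\<in>Y. f (\<theta>' y))" for f :: "'c \<Rightarrow> 'e"
  define S where "S h = (\<lambda>x\<in>X. h (\<theta> x))" for h :: "'d \<Rightarrow> 'e"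
  have mem: "T f \<in> Y \<rightarrow>\<^sub>E carrier Q" if "f \<in> X \<rightarrow>\<^sub>E carrier Q" for f
    using that \<theta>' by (auto simp: T_def)
  have mem': "S h \<in> X \<rightarrow>\<^sub>E carrier Q" if "h \<in> Y \<rightarrow>\<^sub>E carrier Q" for h
    using that \<theta> by (auto simp: S_def)
  have ST: "S (T f) = f" if "f \<in> X \<rightarrow>\<^sub>E carrier Q" for f
    by (rule extensionalityI[of _ X]) (use that \<theta> in \<open>auto simp: S_def T_def PiE_def\<close>)
  have TS: "T (S h) = h" if "h \<in> Y \<rightarrow>\<^sub>E carrier Q" for h
    by (rule extensionalityI[of _ Y]) (use that \<theta>' in \<open>auto simp: S_def T_def PiE_def\<close>)
  have "bij_betw T (X \<rightarrow>\<^sub>E carrier Q) (Y \<rightarrow>\<^sub>E carrier Q)"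
    by (rule bij_betw_byWitness[where f' = S]) (use mem mem' ST TS in auto)
  moreover have "T (perm_act G X \<phi> g f) = perm_act G Y \<psi> g (T f)" if g: "g \<in> carrier G" for g f
    unfolding T_def perm_act_def
    using group.inv_closed[OF grp g] Y.element_image
    by (intro restrict_ext) (simp add: \<theta>' eqv')
  ultimately show ?thesis
    unfolding perm_reps_iso_def equivariant_def
    by (intro exI[of _ T]) (auto simp: T_def \<theta>' restrict_def)
qed

text \<open>An element fixing \<open>X\<close> pointwise acts trivially on functions on
  \<open>X\<close>, hence on functions on \<open>Y\<close>; a function separating \<open>y\<close>
  from the rest of \<open>Y\<close> then shows that \<open>y\<close> does not move.\<close>

lemma perm_reps_iso_fixes:
  assumes iso: "perm_reps_iso Q G X \<phi> Y \<psi>" and grp: "group G"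
    and Q: "c \<in> carrier Q" "d \<in> carrier Q" "c \<noteq> d"
    and g: "g \<in> carrier G" and fix_X: "\<And>x. x \<in> X \<Longrightarrow> \<phi> g x = x" and y: "y \<in> Y" and cl: "\<psi> g y \<in> Y"
  shows "\<psi> g y = y"
proof -
  obtain T where T: "bij_betw T (X \<rightarrow>\<^sub>E carrier Q) (Y \<rightarrow>\<^sub>E carrier Q)"
    and eqv: "\<And>g f. g \<in> carrier G \<Longrightarrow> f \<in> X \<rightarrow>\<^sub>E carrier Q \<Longrightarrow>
      T (perm_act G X \<phi> g f) = perm_act G Y \<psi> g (T f)"
    using iso unfolding perm_reps_iso_def equivariant_def by blast
  define h where "h = (\<lambda>u\<in>Y. if u = y then c else d)"
  have "h \<in> Y \<rightarrow>\<^sub>E carrier Q" using Q by (auto simp: h_def)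
  then have "h \<in> T ` (X \<rightarrow>\<^sub>E carrier Q)" using T unfolding bij_betw_def by simp
  then obtain f where f: "f \<in> X \<rightarrow>\<^sub>E carrier Q" "T f = h" by blast
  \<comment> \<open>\<open>perm_act\<close> evaluates at the inverse group element, so the inverse
    of \<open>g\<close> is used in order to see \<open>\<psi> g y\<close>.\<close>
  have "perm_act G X \<phi> (inv\<^bsub>G\<^esub> g) f = f"
    by (rule extensionalityI[of _ X])
      (use f g fix_X in \<open>auto simp: perm_act_def group.inv_inv[OF grp] PiE_def\<close>)
  then have inv_h: "perm_act G Y \<psi> (inv\<^bsub>G\<^esub> g) h = h"
    using eqv[of "inv\<^bsub>G\<^esub> g" f] f g by (simp add: group.inv_closed[OF grp])
  have "h (\<psi> g y) = h y"
    using y g fun_cong[OF inv_h, of y] by (simp add: perm_act_def group.inv_inv[OF grp])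
  then show ?thesis using Q y cl by (simp add: h_def split: if_splits)
qed

section \<open>Comparing the action on the middle term with that on the direct sum\<close>

context f2_extension
begin

abbreviation "act_sum \<equiv> sum_action M1 \<phi>1 M2 \<phi>2"

lemma sum_action_apply:
  "x \<in> carrier M1 \<Longrightarrow> z \<in> carrier M2 \<Longrightarrow> act_sum g (x, z) = (\<phi>1 g x, \<phi>2 g z)"
  by (simp add: sum_action_def)

lemma sum_action_group_action: "group_action G (carrier (M1 \<times>\<times> M2)) act_sum"
  by (rule group_actionI[OF is_group]) (auto simp: sum_action_apply act_comp sum_action_def)

text \<open>\<open>\<theta>\<close> is the isomorphism from the direct sum attached to a section.
  Equivariance of \<open>s\<close> is asked for only at the vector concerned, so bijectivity and
  additivity are available for every section.\<close>

lemma section_bij: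
  assumes s: "is_section s"
  defines "\<theta> \<equiv> \<lambda>(x, z). i x \<otimes>\<^bsub>M\<^esub> s z"
  shows "bij_betw \<theta> (carrier M1 \<times> carrier M2) (carrier M)"
    and "\<And>x x' z z'. x \<in> carrier M1 \<Longrightarrow> x' \<in> carrier M1 \<Longrightarrow> z \<in> carrier M2 \<Longrightarrow> z' \<in> carrier M2 \<Longrightarrow>
      \<theta> (x \<otimes>\<^bsub>M1\<^esub> x', z \<otimes>\<^bsub>M2\<^esub> z') = \<theta> (x, z) \<otimes>\<^bsub>M\<^esub> \<theta> (x', z')"
    and "\<And>g x z. g \<in> carrier G \<Longrightarrow> x \<in> carrier M1 \<Longrightarrow> z \<in> carrier M2 \<Longrightarrow>
      s (\<phi>2 g z) = \<phi> g (s z) \<Longrightarrow> \<theta> (\<phi>1 g x, \<phi>2 g z) = \<phi> g (\<theta> (x, z))"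
proof -
  have sh: "s \<in> hom M2 M" and ps: "\<And>z. z \<in> carrier M2 \<Longrightarrow> p (s z) = z"
    using s by (auto simp: is_section_def)
  have sc [simp]: "s z \<in> carrier M" if "z \<in> carrier M2" for z
    using hom_in_carrier[OF sh that] .
  show "bij_betw \<theta> (carrier M1 \<times> carrier M2) (carrier M)"
  proof (rule bij_betw_imageI)
    show "inj_on \<theta> (carrier M1 \<times> carrier M2)"
    proof (rule inj_onI, clarify)
      fix x z x' z'
      assume c: "x \<in> carrier M1" "z \<in> carrier M2" "x' \<in> carrier M1" "z' \<in> carrier M2"
        and eq: "\<theta> (x, z) = \<theta> (x', z')"
      have "p (\<theta> (x, z)) = z" "p (\<theta> (x', z')) = z'" using c by (simp_all add: \<theta>_def p_mult ps)
      then have z: "z = z'" using eq by simp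
      then have "i x = i x'" using eq c by (simp add: \<theta>_def)
      then show "x = x' \<and> z = z'" using z c inj_onD[OF i_inj] by simp
    qed
    have "y \<in> \<theta> ` (carrier M1 \<times> carrier M2)" if y: "y \<in> carrier M" for y
    proof -
      have "p (s (p y)) = p y" using y ps by simp
      then obtain x where "x \<in> carrier M1" "y = s (p y) \<otimes>\<^bsub>M\<^esub> i x"
        using same_fibreE[of "s (p y)" y] y by auto
      then have "y = \<theta> (x, p y)" using y M.m_comm by (simp add: \<theta>_def)
      then show ?thesis using y \<open>x \<in> carrier M1\<close> by (intro image_eqI) auto
    qed
    then show "\<theta> ` (carrier M1 \<times> carrier M2) = carrier M" by (auto simp: \<theta>_def)
  qed
  show "\<theta> (x \<otimes>\<^bsub>M1\<^esub> x', z \<otimes>\<^bsub>M2\<^esub> z') = \<theta> (x, z) \<otimes>\<^bsub>M\<^esub> \<theta> (x', z')"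
    if "x \<in> carrier M1" "x' \<in> carrier M1" "z \<in> carrier M2" "z' \<in> carrier M2" for x x' z z'
    using that by (simp add: \<theta>_def i_mult hom_mult[OF sh] M.m_ac)
  show "\<theta> (\<phi>1 g x, \<phi>2 g z) = \<phi> g (\<theta> (x, z))"
    if "g \<in> carrier G" "x \<in> carrier M1" "z \<in> carrier M2" "s (\<phi>2 g z) = \<phi> g (s z)" for g x z
    using that by (simp add: \<theta>_def act_mult i_equivariant)
qed

lemma faithful_if_perm_reps_iso:
  assumes "perm_reps_iso Q G (carrier (M1 \<times>\<times> M2)) act_sum (carrier M) \<phi>"
    and "c \<in> carrier Q" "d \<in> carrier Q" "c \<noteq> d"
  shows faithful_on_sum
  unfolding faithful_on_sum_def
proof (intro ballI impI, elim conjE)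
  fix g y assume g: "g \<in> carrier G" and y: "y \<in> carrier M"
    and triv: "\<forall>x\<in>carrier M1. \<phi>1 g x = x" "\<forall>z\<in>carrier M2. \<phi>2 g z = z"
  show "\<phi> g y = y"
    by (rule perm_reps_iso_fixes[OF assms(1) is_group assms(2-) g _ y])
      (use triv g y in \<open>auto simp: sum_action_apply\<close>)
qed

lemma perm_reps_iso_if_splits:
  assumes "seq_splits G M \<phi> M2 \<phi>2 p"
  shows "perm_reps_iso Q G (carrier (M1 \<times>\<times> M2)) act_sum (carrier M) \<phi>"
proof -
  obtain s where s: "is_section s"
    and eqv: "\<And>g x. g \<in> carrier G \<Longrightarrow> x \<in> carrier M2 \<Longrightarrow> s (\<phi>2 g x) = \<phi> g (s x)"
    using assms unfolding seq_splits_iff by blast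
  show ?thesis
    by (rule perm_reps_iso_if_equivariant_bij
          [OF sum_action_group_action a.group_action_axioms, where \<theta> = "\<lambda>(x, z). i x \<otimes>\<^bsub>M\<^esub> s z"])
      (use section_bij(1)[OF s] section_bij(3)[OF s] eqv in \<open>auto simp: sum_action_apply\<close>)
qed

text \<open>\<open>M1\<close> embeds in \<open>M\<close> and \<open>M2\<close> is a quotient of it,
  so both actions can be read off from the one on \<open>M\<close>. This gives the map from
  \<open>G_W\<close> to \<open>G_V\<close>.\<close>

lemma act_sum_eq_if_act_eq:
  assumes g: "g \<in> carrier G" and h: "h \<in> carrier G" and eq: "\<phi> g = \<phi> h"
  shows "act_sum g = act_sum h"
proof -
  have "\<phi>1 g x = \<phi>1 h x" if "x \<in> carrier M1" for x
    using that g h eq inj_onD[OF i_inj, of "\<phi>1 g x" "\<phi>1 h x"] by (simp flip: i_equivariant)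
  moreover have "\<phi>2 g z = \<phi>2 h z" if z: "z \<in> carrier M2" for z
  proof -
    obtain y where "y \<in> carrier M" "p y = z" using lift[OF z] .
    then show ?thesis using p_equivariant[OF g, of y] p_equivariant[OF h, of y] eq by simp
  qed
  ultimately show ?thesis unfolding sum_action_def by (intro restrict_ext) auto
qed

text \<open>A surjection from a finite set preserves cardinality exactly when it is injective.
  Finiteness of \<open>M\<close> makes the image of \<open>G\<close> finite, while \<open>G\<close>
  itself may be infinite.\<close>

lemma act_image_card_eq_iff:
  assumes fin: "finite (carrier M)"
  shows "card (\<phi> ` carrier G) = card (act_sum ` carrier G) \<longleftrightarrow>
    (\<forall>g\<in>carrier G. \<forall>h\<in>carrier G. act_sum g = act_sum h \<longrightarrow> \<phi> g = \<phi> h)" (is "_ \<longleftrightarrow> ?inj")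
proof -
  define F where "F f = act_sum (inv_into (carrier G) \<phi> f)" for f
  have F: "F (\<phi> g) = act_sum g" if g: "g \<in> carrier G" for g
    unfolding F_def
    by (rule act_sum_eq_if_act_eq) (use g in \<open>simp_all add: inv_into_into f_inv_into_f\<close>)
  have im: "F ` \<phi> ` carrier G = act_sum ` carrier G" by (simp add: image_image F)
  have "\<phi> ` carrier G \<subseteq> carrier M \<rightarrow>\<^sub>E carrier M"
    using a.bij_prop0 by (auto simp: PiE_def Bij_def)
  then have "finite (\<phi> ` carrier G)" by (rule finite_subset) (simp add: finite_PiE fin)
  then have "card (\<phi> ` carrier G) = card (act_sum ` carrier G) \<longleftrightarrow> inj_on F (\<phi> ` carrier G)"
    by (simp add: inj_on_iff_eq_card im eq_commute)
  also have "\<dots> \<longleftrightarrow> ?inj" by (simp add: inj_on_def F)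
  finally show ?thesis .
qed

lemma faithful_if_card_eq:
  assumes fin: "finite (carrier M)" and card: "card (\<phi> ` carrier G) = card (act_sum ` carrier G)"
  shows faithful_on_sum
  unfolding faithful_on_sum_def
proof (intro ballI impI, elim conjE)
  fix g y assume g: "g \<in> carrier G" and y: "y \<in> carrier M"
    and triv: "\<forall>x\<in>carrier M1. \<phi>1 g x = x" "\<forall>z\<in>carrier M2. \<phi>2 g z = z"
  have "act_sum g = act_sum \<one>" unfolding sum_action_def by (intro restrict_ext) (use triv in auto)
  then have "\<phi> g = \<phi> \<one>" using g card unfolding act_image_card_eq_iff[OF fin] by blast
  then show "\<phi> g y = y" using y by simp
qed

lemma card_eq_if_splits:
  assumes fin: "finite (carrier M)" and splits: "seq_splits G M \<phi> M2 \<phi>2 p"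
  shows "card (\<phi> ` carrier G) = card (act_sum ` carrier G)"
  unfolding act_image_card_eq_iff[OF fin]
proof (intro ballI impI)
  fix g h assume gh: "g \<in> carrier G" "h \<in> carrier G" and eq: "act_sum g = act_sum h"
  obtain s where s: "is_section s"
    and eqv: "\<And>g x. g \<in> carrier G \<Longrightarrow> x \<in> carrier M2 \<Longrightarrow> s (\<phi>2 g x) = \<phi> g (s x)"
    using splits unfolding seq_splits_iff by blast
  show "\<phi> g = \<phi> h"
  proof (rule extensionalityI[of _ "carrier M"])
    fix y assume "y \<in> carrier M"
    then have "y \<in> (\<lambda>(x, z). i x \<otimes>\<^bsub>M\<^esub> s z) ` (carrier M1 \<times> carrier M2)"
      using section_bij(1)[OF s] unfolding bij_betw_def by simp
    then obtain x z where xz: "x \<in> carrier M1" "z \<in> carrier M2" and y: "y = i x \<otimes>\<^bsub>M\<^esub> s z"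
      by auto
    have "\<phi>1 g x = \<phi>1 h x" "\<phi>2 g z = \<phi>2 h z"
      using fun_cong[OF eq, of "(x, z)"] xz by (simp_all add: sum_action_apply)
    then show "\<phi> g y = \<phi> h y"
      using section_bij(3)[OF s gh(1) xz eqv] section_bij(3)[OF s gh(2) xz eqv] gh xz
      by (simp add: y)
  qed (use gh a.bij_prop0 in \<open>auto simp: Bij_def\<close>)
qed

text \<open>A set-theoretic choice of lifts already parametrises \<open>M\<close> by pairs.\<close>

lemma finite_carrier:
  assumes "finite (carrier M1)" "finite (carrier M2)"
  shows "finite (carrier M)"
proof -
  define l where "l z = (SOME y. y \<in> carrier M \<and> p y = z)" for z
  have l: "l z \<in> carrier M \<and> p (l z) = z" if z: "z \<in> carrier M2" for z
    unfolding l_def by (rule someI_ex) (use lift[OF z] in blast)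
  have "carrier M \<subseteq> (\<lambda>(x, z). l z \<otimes>\<^bsub>M\<^esub> i x) ` (carrier M1 \<times> carrier M2)"
  proof
    fix y assume y: "y \<in> carrier M"
    then obtain x where "x \<in> carrier M1" "y = l (p y) \<otimes>\<^bsub>M\<^esub> i x"
      using same_fibreE[of "l (p y)" y] l[of "p y"] by auto
    then show "y \<in> (\<lambda>(x, z). l z \<otimes>\<^bsub>M\<^esub> i x) ` (carrier M1 \<times> carrier M2)"
      using y by (intro image_eqI[of _ _ "(x, p y)"]) auto
  qed
  then show ?thesis using assms by (auto intro: finite_subset)
qed

text \<open>The action of \<open>H\<close> on the direct sum is carried to \<open>M\<close> along
  the splitting isomorphism. With \<open>H\<close> the Galois group of the residue field and
  \<open>r\<close> the reduction of automorphisms, this says that \<open>W\<close> is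
  unramified.\<close>

lemma inflation_if_splits:
  assumes splits: "seq_splits G M \<phi> M2 \<phi>2 p"
    and \<rho>1: "f2_module H M1 \<rho>1" and \<rho>2: "f2_module H M2 \<rho>2"
    and r: "\<And>g. g \<in> carrier G \<Longrightarrow> \<phi>1 g = \<rho>1 (r g)" "\<And>g. g \<in> carrier G \<Longrightarrow> \<phi>2 g = \<rho>2 (r g)"
  shows "\<exists>\<rho>. f2_module H M \<rho> \<and> (\<forall>g\<in>carrier G. \<phi> g = \<rho> (r g))"
proof -
  obtain s where s: "is_section s"
    and eqv: "\<And>g x. g \<in> carrier G \<Longrightarrow> x \<in> carrier M2 \<Longrightarrow> s (\<phi>2 g x) = \<phi> g (s x)"
    using splits unfolding seq_splits_iff by blast
  define \<theta> where "\<theta> = (\<lambda>(x, z). i x \<otimes>\<^bsub>M\<^esub> s z)"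
  note \<theta> = section_bij[OF s, folded \<theta>_def]
  define \<theta>1 where "\<theta>1 y = fst (inv_into (carrier M1 \<times> carrier M2) \<theta> y)" for y
  define \<theta>2 where "\<theta>2 y = snd (inv_into (carrier M1 \<times> carrier M2) \<theta> y)" for y
  have \<theta>_closed: "\<theta> (x, z) \<in> carrier M" if "x \<in> carrier M1" "z \<in> carrier M2" for x z
    using \<theta>(1) that by (auto simp: bij_betw_def)
  have inv1: "\<theta>1 (\<theta> (x, z)) = x" "\<theta>2 (\<theta> (x, z)) = z" if "x \<in> carrier M1" "z \<in> carrier M2" for x z
    using that by (simp_all add: \<theta>1_def \<theta>2_def bij_betw_inv_into_left[OF \<theta>(1)])
  have inv2: "\<theta>1 y \<in> carrier M1" "\<theta>2 y \<in> carrier M2" "\<theta> (\<theta>1 y, \<theta>2 y) = y" if "y \<in> carrier M" for y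
  proof -
    have "inv_into (carrier M1 \<times> carrier M2) \<theta> y \<in> carrier M1 \<times> carrier M2"
      using \<theta>(1) that unfolding bij_betw_def by (metis inv_into_into)
    then show "\<theta>1 y \<in> carrier M1" "\<theta>2 y \<in> carrier M2"
      by (auto simp: \<theta>1_def \<theta>2_def mem_Times_iff)
    show "\<theta> (\<theta>1 y, \<theta>2 y) = y"
      using \<theta>(1) that by (simp add: \<theta>1_def \<theta>2_def bij_betw_inv_into_right)
  qed
  define \<rho> where "\<rho> h = (\<lambda>y\<in>carrier M. \<theta> (\<rho>1 h (\<theta>1 y), \<rho>2 h (\<theta>2 y)))" for h
  interpret b1: group_action H "carrier M1" \<rho>1 using \<rho>1 by (simp add: f2_module_def)
  interpret b2: group_action H "carrier M2" \<rho>2 using \<rho>2 by (simp add: f2_module_def)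
  have bh: "\<rho>1 h \<in> hom M1 M1" "\<rho>2 h \<in> hom M2 M2" if "h \<in> carrier H" for h
    using that \<rho>1 \<rho>2 by (auto simp: f2_module_def)
  have bc: "x \<in> carrier M1 \<Longrightarrow> \<rho>1 h x \<in> carrier M1" "z \<in> carrier M2 \<Longrightarrow> \<rho>2 h z \<in> carrier M2"
    if "h \<in> carrier H" for h x z
    using that bh by (auto intro: hom_in_carrier)
  have \<rho>_\<theta>: "\<rho> h (\<theta> (x, z)) = \<theta> (\<rho>1 h x, \<rho>2 h z)" if "x \<in> carrier M1" "z \<in> carrier M2" for h x z
    using that by (simp add: \<rho>_def \<theta>_closed inv1)
  have b_one: "x \<in> carrier M1 \<Longrightarrow> \<rho>1 \<one>\<^bsub>H\<^esub> x = x" "z \<in> carrier M2 \<Longrightarrow> \<rho>2 \<one>\<^bsub>H\<^esub> z = z" for x z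
    by (simp_all flip: b1.id_eq_one b2.id_eq_one)
  have \<theta>_cases: "\<exists>x z. x \<in> carrier M1 \<and> z \<in> carrier M2 \<and> y = \<theta> (x, z)" if "y \<in> carrier M" for y
    using inv2[OF that] by metis
  have "group_action H (carrier M) \<rho>"
  proof (rule group_actionI)
    show "group H" using b1.group_hom by (simp add: group_hom_def)
    show "\<rho> h \<in> extensional (carrier M)" for h by (simp add: \<rho>_def)
    show "\<rho> h y \<in> carrier M" if "h \<in> carrier H" "y \<in> carrier M" for h y
      using that by (simp add: \<rho>_def \<theta>_closed bc inv2)
    show "\<rho> \<one>\<^bsub>H\<^esub> y = y" if "y \<in> carrier M" for y
      using that by (simp add: \<rho>_def b_one inv2)
    show "\<rho> (g \<otimes>\<^bsub>H\<^esub> h) y = \<rho> g (\<rho> h y)" if "g \<in> carrier H" "h \<in> carrier H" "y \<in> carrier M" for g h y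
      using \<theta>_cases[OF that(3)] that(1,2)
      by (auto simp: \<rho>_\<theta> bc b1.composition_rule b2.composition_rule)
  qed
  moreover have "\<rho> h \<in> hom M M" if h: "h \<in> carrier H" for h
  proof (rule homI)
    show "\<rho> h y \<in> carrier M" if "y \<in> carrier M" for y
      using that h by (simp add: \<rho>_def \<theta>_closed bc inv2)
    show "\<rho> h (y \<otimes>\<^bsub>M\<^esub> y') = \<rho> h y \<otimes>\<^bsub>M\<^esub> \<rho> h y'" if y_in: "y \<in> carrier M" "y' \<in> carrier M" for y y'
    proof -
      obtain x z x' z' where xz: "x \<in> carrier M1" "z \<in> carrier M2" "x' \<in> carrier M1" "z' \<in> carrier M2"
        and y: "y = \<theta> (x, z)" "y' = \<theta> (x', z')" using \<theta>_cases[OF y_in(1)] \<theta>_cases[OF y_in(2)] by blast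
      have "\<rho> h (\<theta> (x \<otimes>\<^bsub>M1\<^esub> x', z \<otimes>\<^bsub>M2\<^esub> z')) = \<rho> h y \<otimes>\<^bsub>M\<^esub> \<rho> h y'"
        using xz h by (simp add: y \<rho>_\<theta> hom_mult[OF bh(1)] hom_mult[OF bh(2)] bc flip: \<theta>(2))
      then show ?thesis using xz by (simp add: y \<theta>(2))
    qed
  qed
  moreover have "\<phi> g = \<rho> (r g)" if g: "g \<in> carrier G" for g
  proof (rule extensionalityI[of _ "carrier M"])
    show "\<phi> g \<in> extensional (carrier M)" using a.bij_prop0[OF g] by (simp add: Bij_def)
    show "\<rho> (r g) \<in> extensional (carrier M)" by (simp add: \<rho>_def)
    fix y assume "y \<in> carrier M"
    then obtain x z where xz: "x \<in> carrier M1" "z \<in> carrier M2" and y: "y = \<theta> (x, z)"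
      using \<theta>_cases by blast
    show "\<phi> g y = \<rho> (r g) y"
      using \<theta>(3)[OF g xz eqv[OF g xz(2)]] xz by (simp add: y \<rho>_\<theta> r[OF g, symmetric])
  qed
  ultimately show ?thesis
    using f2_modules(2) by (intro exI[of _ \<rho>]) (auto simp: f2_module_def)
qed

end

section \<open>Line bundles and automorphisms of the base\<close>

lemma mk_alg_simps [simp]:
  "carrier (mk_alg R h S) = carrier S" "monoid.mult (mk_alg R h S) = monoid.mult S"
  "\<one>\<^bsub>mk_alg R h S\<^esub> = \<one>\<^bsub>S\<^esub>" "\<zero>\<^bsub>mk_alg R h S\<^esub> = \<zero>\<^bsub>S\<^esub>" "add (mk_alg R h S) = add S"
  "smap (mk_alg R h S) = restrict h (carrier R)"
  by (simp_all add: mk_alg_def)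

lemma Units_mk_alg [simp]: "Units (mk_alg R h S) = Units S"
  by (simp add: Units_def)

lemma monoid_mk_alg [simp]: "monoid (mk_alg R h S) \<longleftrightarrow> monoid S"
  unfolding monoid_def mk_alg_simps ..

lemma abelian_group_mk_alg [simp]: "abelian_group (mk_alg R h S) \<longleftrightarrow> abelian_group S"
  unfolding abelian_group_def abelian_group_axioms_def abelian_monoid_def comm_group_def group_def
    group_axioms_def comm_monoid_def comm_monoid_axioms_def monoid_def Units_def mk_alg_simps
    partial_object.select_convs monoid.select_convs ..

lemma ring_mk_alg [simp]: "ring (mk_alg R h S) \<longleftrightarrow> ring S"
  unfolding ring_def ring_axioms_def monoid_mk_alg abelian_group_mk_alg mk_alg_simps ..

lemma cring_mk_alg [simp]: "cring (mk_alg R h S) \<longleftrightarrow> cring S"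
  unfolding cring_def comm_monoid_def comm_monoid_axioms_def ring_mk_alg monoid_mk_alg mk_alg_simps ..

lemma field_mk_alg [simp]: "field (mk_alg R h S) \<longleftrightarrow> field S"
  unfolding field_def domain_def field_axioms_def domain_axioms_def cring_mk_alg Units_mk_alg
    mk_alg_simps ..

lemma ideal_mk_alg [simp]: "ideal I (mk_alg R h S) \<longleftrightarrow> ideal I S"
  unfolding ideal_def additive_subgroup_def subgroup_def m_inv_def ideal_axioms_def ring_mk_alg
    mk_alg_simps partial_object.select_convs monoid.select_convs ..

lemma genideal_mk_alg [simp]: "genideal (mk_alg R h S) = genideal S"
  by (simp add: genideal_def fun_eq_iff)

lemma ring_hom_mk_alg [simp]:
  "ring_hom (mk_alg R h S) S' = ring_hom S S'" "ring_hom S' (mk_alg R h S) = ring_hom S' S"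
  by (simp_all add: ring_hom_def)

lemma eval_mk_alg:
  assumes "ring S"
  shows "ring.eval (mk_alg R h S) p = ring.eval S p"
proof -
  interpret S: ring S by fact
  interpret S': ring "mk_alg R h S" using assms by simp
  have pow: "x [^]\<^bsub>mk_alg R h S\<^esub> n = x [^]\<^bsub>S\<^esub> n" for x and n :: nat
    by (induction n) simp_all
  show ?thesis by (induction p) (simp_all add: pow)
qed

text \<open>Polynomials and their values involve only the ring operations. This keeps a geometric
  point geometric when its structure map is twisted.\<close>

lemma algebraically_closed_mk_alg:
  assumes "algebraically_closed S"
  shows "algebraically_closed (mk_alg R h S)"
proof -
  interpret S: algebraically_closed S by fact
  interpret S': field "mk_alg R h S" using S.field_axioms by simp
  have ring: "ring S" by (rule S.ring_axioms)
  show ?thesis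
  proof (rule S'.algebraically_closedI)
    fix p assume p: "p \<in> carrier (poly_ring (mk_alg R h S))" "degree p > 1"
    then have pS: "p \<in> carrier (poly_ring S)" by (simp add: univ_poly_def polynomial_def)
    then have "S.splitted p" by (rule S.roots_over_carrier)
    then have "S.roots p \<noteq> {#}" using p(2) by (auto simp: S.splitted_def)
    then obtain x where "x \<in># S.roots p" by blast
    then have "S.is_root p x" using S.roots_mem_iff_is_root[OF pS] by simp
    then show "\<exists>x\<in>carrier (mk_alg R h S). S'.eval p x = \<zero>\<^bsub>mk_alg R h S\<^esub>"
      by (auto simp: S.is_root_def eval_mk_alg[OF ring])
  qed
qed

text \<open>A base enters through its ring structure alone; hence a field \<open>F\<close> and its
  twist have the same test algebras.\<close>

lemma is_alg_mk_alg [simp]: "is_alg (mk_alg R h S) = is_alg S"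
  by (simp add: is_alg_def fun_eq_iff)

lemma alg_hom_mk_alg [simp]: "alg_hom (mk_alg R h S) = alg_hom S"
  by (simp add: alg_hom_def fun_eq_iff)

lemma line_bdl_iso_mk_alg [simp]: "line_bdl_iso (mk_alg R h S) = line_bdl_iso S"
  by (simp add: line_bdl_iso_def open_cover_def open_sub_def subfunctor_def covers_def
      field_alg_def unit_function_def fun_eq_iff)

lemma self_alg_mk_alg [simp]: "self_alg (mk_alg R h S) = self_alg S"
  by (simp add: self_alg_def mk_alg_def)

lemma translate_mk_alg [simp]: "translate (mk_alg R h S) = translate S"
  by (simp add: translate_def fun_eq_iff)

text \<open>Cocycles may differ at arguments that are not algebras: twisting forth and back restores
  the structure map only when that map is extensional.\<close>

definition same_bdl :: "('a,'m) ring_scheme \<Rightarrow> ('a,'p) line_bdl \<Rightarrow> ('a,'p) line_bdl \<Rightarrow> bool" where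
  "same_bdl R L M \<longleftrightarrow> (\<forall>B. is_alg R B \<longrightarrow> (\<forall>i. chart L i B = chart M i B) \<and>
     (\<forall>i j. trans_fun L i j B = trans_fun M i j B))"

lemma same_bdl_sym: "same_bdl R L M \<Longrightarrow> same_bdl R M L"
  by (simp add: same_bdl_def)

lemma same_bdl_refl: "same_bdl R L L"
  by (simp add: same_bdl_def)

lemma line_bdl_iso_cong:
  assumes "same_bdl R L L'" "same_bdl R M M'" "line_bdl_iso R X L M"
  shows "line_bdl_iso R X L' M'"
proof -
  obtain W r s a where W: "open_cover R X W"
     "\<forall>k B. is_alg R B \<longrightarrow> W k B \<subseteq> chart L (r k) B \<inter> chart M (s k) B"
     "\<forall>k. unit_function R X (W k) (a k)"
     "\<forall>k l B x. is_alg R B \<and> x \<in> W k B \<inter> W l B \<longrightarrow>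
        a k B x \<otimes>\<^bsub>B\<^esub> trans_fun L (r k) (r l) B x
          = trans_fun M (s k) (s l) B x \<otimes>\<^bsub>B\<^esub> a l B x"
    using assms(3) unfolding line_bdl_iso_def by blast
  then show ?thesis
    using assms(1,2) unfolding line_bdl_iso_def same_bdl_def
    by (intro exI[of _ W] exI[of _ r] exI[of _ s] exI[of _ a]) simp
qed

lemma bdl_class_cong:
  assumes "same_bdl R L L'"
  shows "bdl_class R X L = bdl_class R X L'"
  using line_bdl_iso_cong[OF assms same_bdl_refl]
    line_bdl_iso_cong[OF same_bdl_sym[OF assms] same_bdl_refl]
  unfolding bdl_class_def by blast

lemma line_bdl_iso_refl:
  assumes "line_bundle R X L"
  shows "line_bdl_iso R X L L"
proof -
  have unit: "trans_fun L i j B x \<in> Units B" if "is_alg R B" "x \<in> chart L i B \<inter> chart L j B" for i j B x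
    using assms that unfolding line_bundle_def unit_function_def by blast
  have "\<one>\<^bsub>B\<^esub> \<otimes>\<^bsub>B\<^esub> trans_fun L i j B x = trans_fun L i j B x \<otimes>\<^bsub>B\<^esub> \<one>\<^bsub>B\<^esub>"
    if "is_alg R B" "x \<in> chart L i B \<inter> chart L j B" for i j B x
  proof -
    interpret cring B using that by (simp add: is_alg_def)
    show ?thesis using unit[OF that] by (simp add: Units_closed)
  qed
  moreover have "unit_function R X (chart L k) (\<lambda>B x. \<one>\<^bsub>B\<^esub>)" for k
    unfolding unit_function_def
  proof (intro conjI allI impI, elim conjE)
    fix B assume "is_alg R B"
    then interpret cring B by (simp add: is_alg_def)
    show "\<one>\<^bsub>B\<^esub> \<in> Units B" by simp
  qed (auto simp: alg_hom_def dest: ring_hom_one)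
  moreover have "open_cover R X (chart L)" using assms by (simp add: line_bundle_def)
  ultimately show ?thesis
    unfolding line_bdl_iso_def
    by (intro exI[of _ "chart L"] exI[of _ id] exI[of _ "\<lambda>k B x. \<one>\<^bsub>B\<^esub>"]) simp
qed

lemma mem_bdl_class_same:
  assumes "line_bundle R X M" "same_bdl R L M"
  shows "M \<in> bdl_class R X L"
  using line_bdl_iso_cong[OF same_bdl_sym[OF assms(2)] same_bdl_refl line_bdl_iso_refl[OF assms(1)]]
    assms(1) by (simp add: bdl_class_def)

text \<open>Restriction of scalars along an \<open>R\<close>-automorphism \<open>f\<close> of \<open>B\<close> permutes the test algebras over
  \<open>B\<close> and does not change the underlying \<open>R\<close>-algebras, so it acts on everything that is defined in
  terms of a functor that comes from \<open>R\<close>.\<close>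

locale alg_automorphism =
  fixes R :: "('a,'m) ring_scheme" and B :: "'a alg" and f f'
  assumes alg: "is_alg R B"
    and hom: "f \<in> alg_hom R B B" and hom': "f' \<in> alg_hom R B B"
    and inv: "b \<in> carrier B \<Longrightarrow> f (f' b) = b" and inv': "b \<in> carrier B \<Longrightarrow> f' (f b) = b"
begin

lemma f_closed [simp]: "b \<in> carrier B \<Longrightarrow> f b \<in> carrier B" and
  f'_closed [simp]: "b \<in> carrier B \<Longrightarrow> f' b \<in> carrier B"
  using hom hom' by (auto simp: alg_hom_def dest: ring_hom_closed)

abbreviation "T \<equiv> restr_scalars B f"
abbreviation "T' \<equiv> restr_scalars B f'"
abbreviation "bc \<equiv> base_change_bdl B f"
abbreviation "bc' \<equiv> base_change_bdl B f'"

lemma T_ring [simp]: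
  "carrier (T D) = carrier D" "monoid.mult (T D) = monoid.mult D" "\<one>\<^bsub>T D\<^esub> = \<one>\<^bsub>D\<^esub>"
  "\<zero>\<^bsub>T D\<^esub> = \<zero>\<^bsub>D\<^esub>" "Units (T D) = Units D" "field (T D) \<longleftrightarrow> field D"
  "ideal I (T D) \<longleftrightarrow> ideal I D" "genideal (T D) = genideal D"
  by (simp_all add: restr_scalars_def)

lemma is_alg_T:
  assumes "is_alg B D"
  shows "is_alg B (T D)"
proof -
  interpret B: cring B using alg by (simp add: is_alg_def)
  have "smap D \<circ> f \<in> ring_hom B D"
    using assms hom by (intro ring_hom_trans[of f B B]) (simp_all add: is_alg_def alg_hom_def)
  then have "(\<lambda>b\<in>carrier B. smap D (f b)) \<in> ring_hom B D"
    by (rule B.ring_hom_restrict) simp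
  then show ?thesis using assms by (simp add: is_alg_def restr_scalars_def)
qed

text \<open>Restriction of scalars is contravariant: the structure map of \<open>T (T' D)\<close> is
  \<open>smap D \<circ> f' \<circ> f\<close>.\<close>

lemma T_T':
  assumes "is_alg B D"
  shows "T (T' D) = D"
proof -
  have "(\<lambda>b\<in>carrier B. restrict (\<lambda>b. smap D (f' b)) (carrier B) (f b)) = smap D"
    using assms by (intro extensionalityI[of _ "carrier B"]) (auto simp: is_alg_def inv')
  then show ?thesis by (simp add: restr_scalars_def mk_alg_def)
qed

text \<open>As \<open>f\<close> is surjective, compatibility at all \<open>f b\<close> is
  compatibility at all \<open>b\<close>.\<close>

lemma alg_hom_T: "alg_hom B (T D) (T E) = alg_hom B D E"
proof -
  have "(\<forall>b\<in>carrier B. g (smap D (f b)) = smap E (f b)) \<longleftrightarrow>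
      (\<forall>b\<in>carrier B. g (smap D b) = smap E b)" for g
    using inv f_closed f'_closed by metis
  then show ?thesis by (simp add: alg_hom_def restr_scalars_def)
qed

definition invariant :: "('a,'p,'n) pfunctor_scheme \<Rightarrow> bool" where
  "invariant X \<longleftrightarrow> (\<forall>D E. pts X (T D) = pts X D \<and> push X (T D) (T E) = push X D E)"

text \<open>For a point over \<open>D\<close>, the ideal found over \<open>T D\<close> serves as
  well, since \<open>D\<close> and \<open>T D\<close> have the same ideals and the same
  homomorphisms.\<close>

lemma open_sub_T:
  assumes X: "invariant X" and U: "open_sub B X U"
  shows "open_sub B X (\<lambda>D. U (T D))"
proof -
  have X': "pts X (T D) = pts X D" "push X (T D) (T E) = push X D E" for D E
    using X by (simp_all add: invariant_def)
  have sub: "U D \<subseteq> pts X D" if "is_alg B D" for D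
    using U that by (simp add: open_sub_def subfunctor_def)
  have push: "push X D E g x \<in> U E" if "is_alg B D" "is_alg B E" "g \<in> alg_hom B D E" "x \<in> U D" for D E g x
    using U that by (simp add: open_sub_def subfunctor_def)
  have ex: "\<exists>I. ideal I D \<and> (\<forall>E g. is_alg B E \<and> g \<in> alg_hom B D E \<longrightarrow>
      (push X D E g x \<in> U E \<longleftrightarrow> genideal E (g ` I) = carrier E))"
    if "is_alg B D" "x \<in> pts X D" for D x
    using U that by (simp add: open_sub_def)
  have "\<exists>I. ideal I D \<and> (\<forall>E g. is_alg B E \<and> g \<in> alg_hom B D E \<longrightarrow>
      (push X D E g x \<in> U (T E) \<longleftrightarrow> genideal E (g ` I) = carrier E))"
    if D: "is_alg B D" "x \<in> pts X D" for D x
  proof -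
    obtain I where I: "ideal I (T D)" and I': "\<forall>E g. is_alg B E \<and> g \<in> alg_hom B (T D) E \<longrightarrow>
        (push X (T D) E g x \<in> U E \<longleftrightarrow> genideal E (g ` I) = carrier E)"
      using ex[OF is_alg_T[OF D(1)], of x] D X' by auto
    have "push X D E g x \<in> U (T E) \<longleftrightarrow> genideal E (g ` I) = carrier E"
      if "is_alg B E" "g \<in> alg_hom B D E" for E g
      using I'[rule_format, of "T E" g] that by (simp add: is_alg_T alg_hom_T X')
    then show ?thesis using I by auto
  qed
  moreover have "push X D E g x \<in> U (T E)"
    if "is_alg B D" "is_alg B E" "g \<in> alg_hom B D E" "x \<in> U (T D)" for D E g x
    using push[of "T D" "T E" g x] that by (simp add: is_alg_T alg_hom_T X')
  moreover have "U (T D) \<subseteq> pts X D" if "is_alg B D" for D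
    using sub[OF is_alg_T[OF that]] by (simp add: X')
  ultimately show ?thesis by (simp add: open_sub_def subfunctor_def)
qed

lemma open_cover_T:
  assumes X: "invariant X" and U: "open_cover B X U"
  shows "open_cover B X (\<lambda>i D. U i (T D))"
proof -
  have "pts X F \<subseteq> (\<Union>i. U i (T F))" if "field_alg B F" for F
  proof -
    have "field_alg B (T F)" using that is_alg_T by (simp add: field_alg_def)
    then have "pts X (T F) \<subseteq> (\<Union>i. U i (T F))" using U by (simp add: open_cover_def covers_def)
    then show ?thesis using X by (simp add: invariant_def)
  qed
  then show ?thesis using U open_sub_T[OF X] by (simp add: open_cover_def covers_def)
qed

lemma unit_function_T:
  assumes X: "invariant X" and a: "unit_function B X U a"
  shows "unit_function B X (\<lambda>D. U (T D)) (\<lambda>D. a (T D))"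
proof -
  have unit: "a D x \<in> Units D" if "is_alg B D" "x \<in> U D" for D x
    using a that by (simp add: unit_function_def)
  have nat: "a E (push X D E g x) = g (a D x)"
    if "is_alg B D" "is_alg B E" "g \<in> alg_hom B D E" "x \<in> U D" for D E g x
    using a that by (simp add: unit_function_def)
  have "a (T E) (push X D E g x) = g (a (T D) x)"
    if "is_alg B D" "is_alg B E" "g \<in> alg_hom B D E" "x \<in> U (T D)" for D E g x
    using nat[of "T D" "T E" g x] that X by (simp add: is_alg_T alg_hom_T invariant_def)
  moreover have "a (T D) x \<in> Units D" if "is_alg B D" "x \<in> U (T D)" for D x
    using unit[OF is_alg_T[OF that(1)] that(2)] by simp
  ultimately show ?thesis by (simp add: unit_function_def)
qed

lemma line_bundle_T:
  assumes X: "invariant X" and L: "line_bundle B X L"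
  shows "line_bundle B X (bc L)"
proof -
  have L1: "open_cover B X (chart L)"
    and L2: "unit_function B X (\<lambda>D. chart L i D \<inter> chart L j D) (trans_fun L i j)"
    and L3: "is_alg B D \<Longrightarrow> x \<in> chart L i D \<inter> chart L j D \<inter> chart L k D \<Longrightarrow>
        trans_fun L i j D x \<otimes>\<^bsub>D\<^esub> trans_fun L j k D x = trans_fun L i k D x" for i j k D x
    using L by (simp_all add: line_bundle_def)
  show ?thesis
    using open_cover_T[OF X L1] unit_function_T[OF X L2] L3[OF is_alg_T]
    by (simp add: line_bundle_def base_change_bdl_def)
qed

lemma line_bdl_iso_T:
  assumes X: "invariant X" and iso: "line_bdl_iso B X L M"
  shows "line_bdl_iso B X (bc L) (bc M)"
proof -
  obtain W r s a where W: "open_cover B X W"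
     "\<And>k D. is_alg B D \<Longrightarrow> W k D \<subseteq> chart L (r k) D \<inter> chart M (s k) D"
     "\<And>k. unit_function B X (W k) (a k)"
     "\<And>k l D x. is_alg B D \<Longrightarrow> x \<in> W k D \<inter> W l D \<Longrightarrow>
        a k D x \<otimes>\<^bsub>D\<^esub> trans_fun L (r k) (r l) D x
          = trans_fun M (s k) (s l) D x \<otimes>\<^bsub>D\<^esub> a l D x"
    using iso unfolding line_bdl_iso_def by blast
  show ?thesis
    unfolding line_bdl_iso_def
    using open_cover_T[OF X W(1)] W(2)[OF is_alg_T] unit_function_T[OF X W(3)] W(4)[OF is_alg_T]
    by (intro exI[of _ "\<lambda>k D. W k (T D)"] exI[of _ r] exI[of _ s] exI[of _ "\<lambda>k D. a k (T D)"])
      (simp add: base_change_bdl_def)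
qed

lemma bc'_bc: "same_bdl B (bc' (bc L)) L"
  by (simp add: same_bdl_def base_change_bdl_def T_T')

lemma tensor_bdl_T: "tensor_bdl (bc L) (bc M) = bc (tensor_bdl L M)"
  by (simp add: tensor_bdl_def base_change_bdl_def)

lemma trivial_bdl_T: "invariant X \<Longrightarrow> bc (trivial_bdl X) = trivial_bdl X"
  by (simp add: trivial_bdl_def base_change_bdl_def invariant_def)

text \<open>\<open>f\<close> is a homomorphism of \<open>R\<close>-algebras and so fixes the image
  of \<open>R\<close>; therefore functors coming from \<open>R\<close> cannot distinguish
  \<open>D\<close> from \<open>T D\<close>.\<close>

lemma restr_scalars_T: "restr_scalars R (smap B) (T D) = restr_scalars R (smap B) D"
proof -
  have "f (smap B r) = smap B r" "smap B r \<in> carrier B" if "r \<in> carrier R" for r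
    using that hom alg by (auto simp: alg_hom_def is_alg_def dest: ring_hom_closed)
  then show ?thesis by (simp add: restr_scalars_def mk_alg_def restrict_def fun_eq_iff)
qed

lemma restr_scalars_smap_T: "restr_scalars B (smap (T F)) D = T (restr_scalars B (smap F) D)"
  by (simp add: restr_scalars_def mk_alg_def restrict_def fun_eq_iff)

context
  fixes A :: "('a,'p) gfunctor" and X
  defines "X \<equiv> gbase_change R B A"
begin

lemma gbase_change_T:
  "pts X (T D) = pts X D" "push X (T D) (T E) = push X D E" "mul X (T D) = mul X D"
  "unit_pt X (T D) = unit_pt X D"
  by (simp_all add: X_def gbase_change_def base_change_def restr_scalars_T)

lemma invariant_gbase_change: "invariant X"
  by (simp add: invariant_def gbase_change_T)

text \<open>The zero section is defined over \<open>R\<close>, so restriction to it commutes with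
  the twist.\<close>

lemma rigidifiable_T:
  assumes "rigidifiable B X L"
  shows "rigidifiable B X (bc L)"
proof -
  let ?S = "base_functor :: ('a,unit) pfunctor"
  have S: "invariant ?S" by (simp add: invariant_def base_functor_def)
  have "pullback_bdl ?S (\<lambda>D _. unit_pt X D) (bc L) = bc (pullback_bdl ?S (\<lambda>D _. unit_pt X D) L)"
    using S by (simp add: pullback_bdl_def base_change_bdl_def gbase_change_T invariant_def)
  then show ?thesis
    using line_bdl_iso_T[OF S] assms trivial_bdl_T[OF S] by (metis rigidifiable_def)
qed

text \<open>The twist permutes the geometric points: the fibre of \<open>bc L\<close> at
  \<open>F\<close> is the fibre of \<open>L\<close> at \<open>T F\<close>, and the fibres of
  \<open>X\<close> at these two points coincide.\<close>

lemma fibrewise_pic0_T: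
  assumes L: "fibrewise_pic0 B X L"
  shows "fibrewise_pic0 B X (bc L)"
  unfolding fibrewise_pic0_def Let_def
proof (intro allI impI ballI)
  fix F x assume F: "is_alg B F \<and> algebraically_closed F"
    and x: "x \<in> pts (gbase_change B F X) (self_alg F)"
  have TF: "is_alg B (T F)" "algebraically_closed (T F)"
    using F is_alg_T algebraically_closed_mk_alg[of F] by (auto simp: restr_scalars_def)
  have X': "gbase_change B (T F) X = gbase_change B F X"
    by (simp add: gbase_change_def base_change_def restr_scalars_smap_T gbase_change_T)
  have L': "base_change_bdl B (smap F) (bc L) = base_change_bdl B (smap (T F)) L"
    by (simp add: base_change_bdl_def restr_scalars_smap_T)
  have base: "line_bdl_iso (T F) = line_bdl_iso F" "self_alg (T F) = self_alg F"
    "translate (T F) = translate F"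
    by (simp_all add: restr_scalars_def)
  show "line_bdl_iso F (gbase_change B F X)
      (pullback_bdl (gbase_change B F X) (translate F (gbase_change B F X) x)
        (base_change_bdl B (smap F) (bc L)))
      (base_change_bdl B (smap F) (bc L))"
    using L TF x unfolding fibrewise_pic0_def Let_def L' by (metis X' base)
qed

end

end

section \<open>The action on points of the dual scheme\<close>

text \<open>Restriction of scalars reverses composition, and evaluating a cocycle on restricted
  algebras reverses it again, whence the order here.\<close>

lemma base_change_bdl_compose:
  assumes "f \<in> carrier B \<rightarrow> carrier B"
  shows "base_change_bdl B (compose (carrier B) g f) L = base_change_bdl B g (base_change_bdl B f L)"
proof -
  have "restr_scalars B (compose (carrier B) g f) D = restr_scalars B f (restr_scalars B g D)" for D
    using assms by (simp add: restr_scalars_def mk_alg_def restrict_def compose_def fun_eq_iff Pi_def)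
  then show ?thesis by (simp add: base_change_bdl_def)
qed

lemma same_bdl_base_change_id: "same_bdl B (base_change_bdl B (\<lambda>b\<in>carrier B. b) L) L"
proof -
  have "restr_scalars B (\<lambda>b\<in>carrier B. b) D = D" if "is_alg B D" for D
  proof -
    have "(\<lambda>b\<in>carrier B. smap D ((\<lambda>b\<in>carrier B. b) b)) = smap D"
      using that by (intro extensionalityI[of _ "carrier B"]) (auto simp: is_alg_def)
    then show ?thesis by (simp add: restr_scalars_def mk_alg_def)
  qed
  then show ?thesis by (simp add: same_bdl_def base_change_bdl_def)
qed

lemma two_torsion_simps [simp]:
  "pts (two_torsion A) B = {x \<in> pts A B. mul A B x x = unit_pt A B}"
  "push (two_torsion A) = push A" "mul (two_torsion A) = mul A" "unit_pt (two_torsion A) = unit_pt A"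
  by (simp_all add: two_torsion_def)

lemma grp_simps [simp]:
  "carrier (grp A B) = pts A B" "monoid.mult (grp A B) = mul A B" "\<one>\<^bsub>grp A B\<^esub> = unit_pt A B"
  by (simp_all add: grp_def)

text \<open>Pushing along the identity yields all line bundles to which a member of
  \<open>\<xi>\<close> is isomorphic, so a point fixed by the identity is closed under
  isomorphism.\<close>

lemma dual_push_id:
  "push (dual_scheme R A) B B (\<lambda>b\<in>carrier B. b) \<xi> = (\<Union>L\<in>\<xi>. bdl_class B (gbase_change R B A) L)"
  by (simp add: dual_scheme_def bdl_class_cong[OF same_bdl_base_change_id])

text \<open>This closure property stands in for transitivity of \<open>line_bdl_iso\<close>: from a
  member of \<open>\<xi>\<close> one may pass to any line bundle isomorphic to it.\<close>

definition saturated ::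
  "('a,'m) ring_scheme \<Rightarrow> 'a alg \<Rightarrow> ('a,'p) gfunctor \<Rightarrow> ('a,'p) line_bdl set \<Rightarrow> bool" where
  "saturated R B A \<xi> \<longleftrightarrow> (\<forall>L\<in>\<xi>. bdl_class B (gbase_change R B A) L \<subseteq> \<xi>)"

context alg_automorphism
begin

lemma inverse: "alg_automorphism R B f' f"
  using alg hom hom' inv inv' by unfold_locales

context
  fixes A :: "('a,'p) gfunctor" and X
  defines "X \<equiv> gbase_change R B A"
begin

lemma line_bundle_bc: "line_bundle B X L \<Longrightarrow> line_bundle B X (bc L)"
  and line_bundle_bc': "line_bundle B X L \<Longrightarrow> line_bundle B X (bc' L)"
  unfolding X_def
  using line_bundle_T[OF invariant_gbase_change]
    alg_automorphism.line_bundle_T[OF inverse alg_automorphism.invariant_gbase_change[OF inverse]]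
  by blast+

lemma line_bdl_iso_bc: "line_bdl_iso B X L M \<Longrightarrow> line_bdl_iso B X (bc L) (bc M)"
  and line_bdl_iso_bc': "line_bdl_iso B X L M \<Longrightarrow> line_bdl_iso B X (bc' L) (bc' M)"
  unfolding X_def
  using line_bdl_iso_T[OF invariant_gbase_change]
    alg_automorphism.line_bdl_iso_T[OF inverse alg_automorphism.invariant_gbase_change[OF inverse]]
  by blast+

lemma bc_bc': "same_bdl B (bc (bc' L)) L"
  by (rule alg_automorphism.bc'_bc[OF inverse])

lemma mem_bdl_class_bc:
  assumes N: "line_bundle B X N"
  shows "N \<in> bdl_class B X (bc L) \<longleftrightarrow> bc' N \<in> bdl_class B X L"
proof
  assume "N \<in> bdl_class B X (bc L)"
  then have "line_bdl_iso B X (bc' (bc L)) (bc' N)"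
    by (intro line_bdl_iso_bc') (simp add: bdl_class_def)
  then show "bc' N \<in> bdl_class B X L"
    using line_bdl_iso_cong[OF bc'_bc same_bdl_refl] line_bundle_bc'[OF N]
    by (simp add: bdl_class_def)
next
  assume "bc' N \<in> bdl_class B X L"
  then have "line_bdl_iso B X (bc L) (bc (bc' N))"
    by (intro line_bdl_iso_bc) (simp add: bdl_class_def)
  then show "N \<in> bdl_class B X (bc L)"
    using line_bdl_iso_cong[OF same_bdl_refl bc_bc'] N by (simp add: bdl_class_def)
qed

lemma dual_push_eq: "push (dual_scheme R A) B B f \<xi> = (\<Union>L\<in>\<xi>. bdl_class B X (bc L))"
  by (simp add: dual_scheme_def X_def)

text \<open>A union of classes becomes a preimage: \<open>bc'\<close> inverts \<open>bc\<close> up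
  to \<open>same_bdl\<close>, and saturation absorbs the choice of a member.\<close>

lemma mem_dual_push_iff:
  assumes sat: "saturated R B A \<xi>"
  shows "N \<in> push (dual_scheme R A) B B f \<xi> \<longleftrightarrow> line_bundle B X N \<and> bc' N \<in> \<xi>"
proof
  assume "N \<in> push (dual_scheme R A) B B f \<xi>"
  then obtain L where L: "L \<in> \<xi>" "N \<in> bdl_class B X (bc L)" by (auto simp: dual_push_eq)
  then have N: "line_bundle B X N" by (simp add: bdl_class_def)
  then show "line_bundle B X N \<and> bc' N \<in> \<xi>"
    using L sat mem_bdl_class_bc[OF N] by (auto simp: saturated_def X_def)
next
  assume N: "line_bundle B X N \<and> bc' N \<in> \<xi>"
  then have "N \<in> bdl_class B X (bc (bc' N))" using mem_bdl_class_same bc_bc' by blast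
  then show "N \<in> push (dual_scheme R A) B B f \<xi>" using N unfolding dual_push_eq by blast
qed

lemma dual_push_bdl_class:
  assumes "saturated R B A (bdl_class B X L)"
  shows "push (dual_scheme R A) B B f (bdl_class B X L) = bdl_class B X (bc L)"
proof (rule Set.set_eqI)
  fix N
  have "N \<in> bdl_class B X (bc L) \<Longrightarrow> line_bundle B X N" by (simp add: bdl_class_def)
  then show "N \<in> push (dual_scheme R A) B B f (bdl_class B X L) \<longleftrightarrow> N \<in> bdl_class B X (bc L)"
    unfolding mem_dual_push_iff[OF assms] using mem_bdl_class_bc by blast
qed

lemma dual_pts_eq: "pts (dual_scheme R A) B =
  {bdl_class B X L | L. line_bundle B X L \<and> rigidifiable B X L \<and> fibrewise_pic0 B X L}"
  by (simp add: dual_scheme_def X_def)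

lemma dual_push_closed:
  assumes "\<xi> \<in> pts (dual_scheme R A) B" "saturated R B A \<xi>"
  shows "push (dual_scheme R A) B B f \<xi> \<in> pts (dual_scheme R A) B"
proof -
  obtain L where L: "\<xi> = bdl_class B X L" "line_bundle B X L" "rigidifiable B X L" "fibrewise_pic0 B X L"
    using assms(1) unfolding dual_pts_eq by blast
  have "rigidifiable B X (bc L)" "fibrewise_pic0 B X (bc L)"
    using rigidifiable_T fibrewise_pic0_T L(3,4) unfolding X_def by blast+
  then show ?thesis
    using line_bundle_bc[OF L(2)] dual_push_bdl_class assms(2) unfolding dual_pts_eq L(1) by blast
qed

lemma mem_dual_mul_iff:
  "N \<in> mul (dual_scheme R A) B \<xi> \<eta> \<longleftrightarrow> (\<exists>L\<in>\<xi>. \<exists>M\<in>\<eta>. N \<in> bdl_class B X (tensor_bdl L M))"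
  by (simp add: dual_scheme_def X_def)

text \<open>The twist commutes with tensor products of cocycles on the nose; membership is tested by
  moving line bundles with \<open>bc\<close> and \<open>bc'\<close>.\<close>

lemma dual_push_mul:
  assumes \<xi>: "\<xi> \<in> pts (dual_scheme R A) B" "saturated R B A \<xi>"
    and \<eta>: "\<eta> \<in> pts (dual_scheme R A) B" "saturated R B A \<eta>"
    and sat: "saturated R B A (mul (dual_scheme R A) B \<xi> \<eta>)"
  shows "push (dual_scheme R A) B B f (mul (dual_scheme R A) B \<xi> \<eta>) =
    mul (dual_scheme R A) B (push (dual_scheme R A) B B f \<xi>) (push (dual_scheme R A) B B f \<eta>)"
    (is "?l = ?r")
proof (rule Set.set_eqI)
  fix N
  have lb: "line_bundle B X L" if "L \<in> \<zeta>" "\<zeta> \<in> pts (dual_scheme R A) B" for L \<zeta>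
    using that unfolding dual_pts_eq by (auto simp: bdl_class_def)
  have bc_mem: "bc L \<in> push (dual_scheme R A) B B f \<zeta>"
    if "L \<in> \<zeta>" "\<zeta> \<in> pts (dual_scheme R A) B" "saturated R B A \<zeta>" for L \<zeta>
  proof -
    have L: "line_bundle B X L" using lb that by blast
    have "bc' (bc L) \<in> bdl_class B X L"
      by (rule mem_bdl_class_same[OF line_bundle_bc'[OF line_bundle_bc[OF L]]])
        (rule same_bdl_sym[OF bc'_bc])
    then show ?thesis
      using that L line_bundle_bc unfolding mem_dual_push_iff[OF that(3)]
      by (auto simp: saturated_def X_def)
  qed
  show "N \<in> ?l \<longleftrightarrow> N \<in> ?r"
  proof
    assume "N \<in> ?l"
    then have N: "line_bundle B X N" and "bc' N \<in> mul (dual_scheme R A) B \<xi> \<eta>"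
      unfolding mem_dual_push_iff[OF sat] by auto
    then obtain L M where LM: "L \<in> \<xi>" "M \<in> \<eta>" "bc' N \<in> bdl_class B X (tensor_bdl L M)"
      unfolding mem_dual_mul_iff by blast
    then have "N \<in> bdl_class B X (tensor_bdl (bc L) (bc M))"
      unfolding tensor_bdl_T using mem_bdl_class_bc[OF N] by blast
    then show "N \<in> ?r" unfolding mem_dual_mul_iff using bc_mem LM \<xi> \<eta> by blast
  next
    assume "N \<in> ?r"
    then obtain L M where "L \<in> push (dual_scheme R A) B B f \<xi>" "M \<in> push (dual_scheme R A) B B f \<eta>"
      and N: "N \<in> bdl_class B X (tensor_bdl L M)"
      unfolding mem_dual_mul_iff by blast
    then have L: "bc' L \<in> \<xi>" and M: "bc' M \<in> \<eta>"
      using mem_dual_push_iff[OF \<xi>(2)] mem_dual_push_iff[OF \<eta>(2)] by blast+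
    have N': "line_bundle B X N" using N by (simp add: bdl_class_def)
    \<comment> \<open>Members of the pushed sets need not be twists, so \<open>L\<close> and
      \<open>M\<close> are replaced by the twists of \<open>bc' L\<close> and
      \<open>bc' M\<close>.\<close>
    have "same_bdl B (tensor_bdl L M) (bc (tensor_bdl (bc' L) (bc' M)))"
      using bc_bc'[of L] bc_bc'[of M] unfolding tensor_bdl_T[symmetric]
      by (simp add: same_bdl_def tensor_bdl_def)
    then have "bc' N \<in> bdl_class B X (tensor_bdl (bc' L) (bc' M))"
      using N bdl_class_cong mem_bdl_class_bc[OF N'] by blast
    then show "N \<in> ?l"
      unfolding mem_dual_push_iff[OF sat] mem_dual_mul_iff using L M N' by blast
  qed
qed

lemma dual_push_unit:
  assumes "saturated R B A (unit_pt (dual_scheme R A) B)"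
  shows "push (dual_scheme R A) B B f (unit_pt (dual_scheme R A) B) = unit_pt (dual_scheme R A) B"
proof -
  have "unit_pt (dual_scheme R A) B = bdl_class B X (trivial_bdl X)"
    by (simp add: dual_scheme_def X_def)
  moreover have "bc (trivial_bdl X) = trivial_bdl X"
    unfolding X_def by (rule trivial_bdl_T[OF invariant_gbase_change])
  ultimately show ?thesis using assms dual_push_bdl_class by metis
qed

end

end

section \<open>Galois groups and the main theorem\<close>

lemma gal_simps:
  "\<sigma> \<in> carrier (gal L K) \<longleftrightarrow> \<sigma> \<in> Bij (carrier L) \<and> \<sigma> \<in> ring_hom L L \<and> (\<forall>x\<in>K. \<sigma> x = x)"
  "\<one>\<^bsub>gal L K\<^esub> = (\<lambda>x\<in>carrier L. x)"
  by (auto simp: gal_def BijGroup_def)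

lemma gal_mult:
  "\<sigma> \<in> carrier (gal L K) \<Longrightarrow> \<tau> \<in> carrier (gal L K) \<Longrightarrow> \<sigma> \<otimes>\<^bsub>gal L K\<^esub> \<tau> = compose (carrier L) \<sigma> \<tau>"
  by (simp add: gal_def BijGroup_def)

lemma group_gal:
  assumes "ring L" "K \<subseteq> carrier L"
  shows "group (gal L K)"
proof -
  interpret ring L by fact
  let ?G = "BijGroup (carrier L)" and ?H = "carrier (gal L K)"
  interpret G: group ?G by (rule group_BijGroup)
  have GH: "?H \<subseteq> carrier ?G" by (auto simp: gal_simps BijGroup_def)
  have "subgroup ?H ?G"
  proof (rule G.subgroupI[OF GH])
    have "(\<lambda>x\<in>carrier L. x) \<in> ?H"
      using assms(2) by (auto simp: gal_simps id_Bij intro!: ring_hom_memI)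
    then show "?H \<noteq> {}" by blast
    fix \<sigma> assume \<sigma>: "\<sigma> \<in> ?H"
    then have bij: "\<sigma> \<in> Bij (carrier L)" and hom: "\<sigma> \<in> ring_hom L L" and fix_K: "\<And>x. x \<in> K \<Longrightarrow> \<sigma> x = x"
      by (auto simp: gal_simps)
    let ?\<tau> = "\<lambda>x\<in>carrier L. inv_into (carrier L) \<sigma> x"
    have inv_eq: "inv_into (carrier L) \<sigma> (\<sigma> x) = x" if "x \<in> carrier L" for x
      using bij that bij_betw_inv_into_left[of \<sigma>] by (auto simp: Bij_def)
    have "?\<tau> \<in> ring_hom L L"
    proof (rule ring_hom_memI)
      fix x y assume xy: "x \<in> carrier L" "y \<in> carrier L"
      show "?\<tau> x \<in> carrier L" using xy bij by (simp add: Bij_inv_into_mem)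
      show "?\<tau> (x \<otimes>\<^bsub>L\<^esub> y) = ?\<tau> x \<otimes>\<^bsub>L\<^esub> ?\<tau> y"
        using xy Bij_inv_into_lemma[of "carrier L" \<sigma> "monoid.mult L" x y] bij hom
        by (simp add: ring_hom_mult Pi_def)
      show "?\<tau> (x \<oplus>\<^bsub>L\<^esub> y) = ?\<tau> x \<oplus>\<^bsub>L\<^esub> ?\<tau> y"
        using xy Bij_inv_into_lemma[of "carrier L" \<sigma> "add L" x y] bij hom
        by (simp add: ring_hom_add Pi_def)
    next
      show "?\<tau> \<one>\<^bsub>L\<^esub> = \<one>\<^bsub>L\<^esub>" using inv_eq[of "\<one>\<^bsub>L\<^esub>"] ring_hom_one[OF hom] by simp
    qed
    moreover have "?\<tau> x = x" if "x \<in> K" for x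
      using inv_eq[of x] fix_K[OF that] that assms(2) by auto
    ultimately show "inv\<^bsub>?G\<^esub> \<sigma> \<in> ?H"
      using bij by (simp add: gal_simps inv_BijGroup restrict_inv_into_Bij)
    fix \<tau> assume \<tau>: "\<tau> \<in> ?H"
    then have bij': "\<tau> \<in> Bij (carrier L)" and hom': "\<tau> \<in> ring_hom L L" and fix_K': "\<And>x. x \<in> K \<Longrightarrow> \<tau> x = x"
      by (auto simp: gal_simps)
    have "compose (carrier L) \<sigma> \<tau> \<in> ring_hom L L"
      by (rule ring_hom_restrict[OF ring_hom_trans[OF hom' hom]]) (simp add: compose_eq)
    moreover have "compose (carrier L) \<sigma> \<tau> x = x" if "x \<in> K" for x
      using that assms(2) fix_K fix_K' by (simp add: compose_eq subset_iff)
    ultimately have "compose (carrier L) \<sigma> \<tau> \<in> ?H"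
      unfolding gal_simps using compose_Bij[OF bij bij'] by blast
    then show "\<sigma> \<otimes>\<^bsub>?G\<^esub> \<tau> \<in> ?H" using gal_mult[OF \<sigma> \<tau>] by (simp add: gal_def)
  qed
  then have "group (?G\<lparr>carrier := ?H\<rparr>)" by (rule subgroup.subgroup_is_group) (rule group_BijGroup)
  then show ?thesis by (simp add: gal_def)
qed

lemma gal_alg_hom:
  assumes "\<sigma> \<in> carrier (gal L K)" "h ` carrier R \<subseteq> K"
  shows "\<sigma> \<in> alg_hom R (mk_alg R h L) (mk_alg R h L)"
  using assms by (auto simp: alg_hom_def gal_simps Bij_def)

lemma gal_alg_automorphism:
  assumes B: "is_alg R (mk_alg R h L)" and K: "K \<subseteq> carrier L" "h ` carrier R \<subseteq> K"
    and \<sigma>: "\<sigma> \<in> carrier (gal L K)"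
  shows "alg_automorphism R (mk_alg R h L) \<sigma> (inv\<^bsub>gal L K\<^esub> \<sigma>)"
proof -
  interpret L: cring L using B by (simp add: is_alg_def)
  interpret group "gal L K" using group_gal L.ring_axioms K(1) .
  have inv: "\<sigma>' (\<tau> x) = x" if "\<sigma>' \<otimes>\<^bsub>gal L K\<^esub> \<tau> = \<one>\<^bsub>gal L K\<^esub>" "\<sigma>' \<in> carrier (gal L K)"
    "\<tau> \<in> carrier (gal L K)" "x \<in> carrier L" for \<sigma>' \<tau> x
  proof -
    have "compose (carrier L) \<sigma>' \<tau> x = x" using that by (simp flip: gal_mult add: gal_simps(2))
    then show ?thesis using that(4) by (simp add: compose_eq)
  qed
  show ?thesis
    using B gal_alg_hom[OF \<sigma> K(2)] gal_alg_hom[OF inv_closed[OF \<sigma>] K(2)]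
      inv[OF r_inv[OF \<sigma>] \<sigma> inv_closed[OF \<sigma>]] inv[OF l_inv[OF \<sigma>] inv_closed[OF \<sigma>] \<sigma>]
    by unfold_locales simp_all
qed

text \<open>The restriction makes each map extensional, as an element of \<open>BijGroup\<close>
  must be.\<close>

lemma f2_module_restrictI:
  assumes H: "group H" and M: "comm_group M" "\<And>x. x \<in> carrier M \<Longrightarrow> x \<otimes>\<^bsub>M\<^esub> x = \<one>\<^bsub>M\<^esub>"
    and cl: "\<And>h x. h \<in> carrier H \<Longrightarrow> x \<in> carrier M \<Longrightarrow> \<psi> h x \<in> carrier M"
    and one: "\<And>x. x \<in> carrier M \<Longrightarrow> \<psi> \<one>\<^bsub>H\<^esub> x = x"
    and comp: "\<And>g h x. g \<in> carrier H \<Longrightarrow> h \<in> carrier H \<Longrightarrow> x \<in> carrier M \<Longrightarrow>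
      \<psi> (g \<otimes>\<^bsub>H\<^esub> h) x = \<psi> g (\<psi> h x)"
    and mult: "\<And>h x y. h \<in> carrier H \<Longrightarrow> x \<in> carrier M \<Longrightarrow> y \<in> carrier M \<Longrightarrow>
      \<psi> h (x \<otimes>\<^bsub>M\<^esub> y) = \<psi> h x \<otimes>\<^bsub>M\<^esub> \<psi> h y"
  shows "f2_module H M (\<lambda>h. restrict (\<psi> h) (carrier M))"
proof -
  interpret comm_group M by fact
  have "group_action H (carrier M) (\<lambda>h. restrict (\<psi> h) (carrier M))"
    by (rule group_actionI[OF H]) (simp_all add: cl one comp)
  then show ?thesis
    using M cl mult by (auto simp: f2_module_def intro!: homI)
qed

text \<open>Two distinct scalars are what the separating function above takes from the p-adic
  numbers. The constants 0 and 1 differ modulo null sequences because 1 is not a multiple of p in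
  the localisation of the integers at p.\<close>

lemma padic_field_two_elements:
  assumes "Factorial_Ring.prime p"
  obtains c d where "c \<in> carrier (padic_field p)" "d \<in> carrier (padic_field p)" "c \<noteq> d"
proof -
  let ?R = "padic_cauchy_ring p"
  define I :: "(nat \<Rightarrow> rat) set" where "I = {s. \<forall>n. \<exists>N. \<forall>i\<ge>N. s i \<in> padic_nbhd p n}"
  have unit: "\<not> int p dvd 1" using assms by (simp add: prime_nat_iff)
  have zero: "0 \<in> padic_nbhd p n" for n
    unfolding padic_nbhd_def using unit by (intro CollectI exI[of _ 0] exI[of _ 1]) simp
  have one: "1 \<notin> padic_nbhd p 1"
  proof
    assume "1 \<in> padic_nbhd p 1"
    then obtain a b :: int where ab: "1 = rat_of_int (int p * a) / rat_of_int b" "\<not> int p dvd b"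
      by (auto simp: padic_nbhd_def)
    then have "b \<noteq> 0" by auto
    then have "rat_of_int b = rat_of_int (int p * a)" using ab(1) by (simp add: field_simps)
    then have "b = int p * a" by (simp only: of_int_eq_iff)
    then show False using ab(2) by simp
  qed
  have coset: "a_r_coset ?R I (\<lambda>i. r) = {(\<lambda>i. h i + r) | h. h \<in> I}" for r
    unfolding a_r_coset_def' by (auto simp: padic_cauchy_ring_def)
  have mem: "a_r_coset ?R I (\<lambda>i. r) \<in> carrier (padic_field p)" for r :: rat
  proof -
    have "(\<lambda>i. r) \<in> carrier ?R" using zero by (simp add: padic_cauchy_ring_def)
    then show ?thesis unfolding padic_field_def FactRing_def A_RCOSETS_def' I_def[symmetric] by auto
  qed
  have "(\<lambda>i. 0) \<in> I" using zero by (simp add: I_def)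
  then have "(\<lambda>i. 1) \<in> a_r_coset ?R I (\<lambda>i. 1)"
    unfolding coset by force
  moreover have "(\<lambda>i. 1) \<notin> I"
  proof
    assume "(\<lambda>i. 1) \<in> I"
    then have "\<exists>N. \<forall>i\<ge>N :: nat. (1 :: rat) \<in> padic_nbhd p 1" unfolding I_def mem_Collect_eq by (rule spec)
    then obtain N where "\<forall>i\<ge>N :: nat. (1 :: rat) \<in> padic_nbhd p 1" by (rule exE)
    then have "1 \<in> padic_nbhd p 1" by (elim allE[of _ N] impE) simp
    then show False using one by contradiction
  qed
  then have "(\<lambda>i. 1) \<notin> a_r_coset ?R I (\<lambda>i. 0)" unfolding coset by simp
  ultimately show thesis using that[OF mem mem, of 1 0] by metis
qed

lemma card_ordinary:
  assumes "ordinary D A"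
  shows "card (carrier (V2 D A)) = 4"
proof -
  obtain h where "bij_betw h (carrier (V2 D A))
      (carrier (integer_mod_group 2 \<times>\<times> integer_mod_group 2))"
    using assms by (auto simp: ordinary_def V2_def is_iso_def iso_def)
  then show ?thesis
    by (auto dest: bij_betw_same_card simp: carrier_integer_mod_group card_cartesian_product)
qed

lemma subset_integral_closure:
  assumes "field L" "subring S L"
  shows "S \<subseteq> integral_closure L S"
proof
  interpret field L by fact
  interpret S: subring S L by fact
  fix a assume a: "a \<in> S"
  then have aL: "a \<in> carrier L" using S.subset by blast
  \<comment> \<open>The monic witness is X - a, with the leading coefficient first.\<close>
  have "[\<one>\<^bsub>L\<^esub>, \<ominus>\<^bsub>L\<^esub> a] \<in> carrier (univ_poly L S)"
    using a subringE(5)[OF assms(2)] by (simp add: univ_poly_def polynomial_def)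
  moreover have "ring.eval L [\<one>\<^bsub>L\<^esub>, \<ominus>\<^bsub>L\<^esub> a] a = \<zero>\<^bsub>L\<^esub>" using aL by (simp add: r_neg)
  ultimately show "a \<in> integral_closure L S"
    using aL unfolding integral_closure_def
    by (intro CollectI conjI bexI[of _ "[\<one>\<^bsub>L\<^esub>, \<ominus>\<^bsub>L\<^esub> a]"]) auto
qed

section \<open>The Galois group of the residue field acting on \<open>V1\<close> and
  \<open>V2\<close>\<close>

context
  fixes D :: "'a base_data"
  assumes base: "base_setting D"
begin

lemma field_kcl: "field (kcl D)"
  using base by (simp add: base_setting_def residue_map_def)

lemma field_Kcl: "field (Kcl D)" and subring_Oset: "subring (Oset D) (Kcl D)"
  using base unfolding base_setting_def by (blast dest: algebraic_closure.axioms(1))+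

lemma Oset_subset: "Oset D \<subseteq> carrier (OKcl D)"
  unfolding OKcl_def using subset_integral_closure[OF field_Kcl subring_Oset] by simp

lemma kset_subset: "kset D \<subseteq> carrier (kcl D)"
proof -
  have "rmap D ` carrier (OKcl D) = carrier (kcl D)"
    using base unfolding base_setting_def residue_map_def by blast
  then show ?thesis using Oset_subset unfolding kset_def by blast
qed

lemma rmap_OK: "rmap D ` carrier (OK D) \<subseteq> kset D"
  by (simp add: kset_def OK_def)

lemma is_alg_kcl: "is_alg (OK D) (kcl_alg D)"
proof -
  have hom: "rmap D \<in> ring_hom (OKcl D) (kcl D)"
    using base unfolding base_setting_def residue_map_def by blast
  have "ring (OK D)"
    using ring.subring_is_ring[OF _ subring_Oset] field_Kcl
    by (simp add: OK_def field_def domain_def cring_def)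
  moreover have "rmap D \<in> ring_hom (OK D) (kcl D)"
    using ring_hom_closed[OF hom] ring_hom_mult[OF hom] ring_hom_add[OF hom] ring_hom_one[OF hom]
      subsetD[OF Oset_subset]
    by (intro ring_hom_memI) (simp_all add: OK_def OKcl_def)
  ultimately have "restrict (rmap D) (carrier (OK D)) \<in> ring_hom (OK D) (kcl D)"
    by (rule ring.ring_hom_restrict) simp
  then show ?thesis
    using field_kcl by (simp add: is_alg_def field_def domain_def)
qed

lemma group_Gammak: "group (Gammak D)"
  unfolding Gammak_def
  using field_kcl kset_subset by (intro group_gal) (auto simp: field_def domain_def cring_def)

lemma Gammak_automorphism:
  "\<tau> \<in> carrier (Gammak D) \<Longrightarrow> alg_automorphism (OK D) (kcl_alg D) \<tau> (inv\<^bsub>Gammak D\<^esub> \<tau>)"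
  unfolding Gammak_def
  by (rule gal_alg_automorphism[OF is_alg_kcl kset_subset rmap_OK])

lemma Gammak_mult:
  "\<sigma> \<in> carrier (Gammak D) \<Longrightarrow> \<tau> \<in> carrier (Gammak D) \<Longrightarrow>
    \<sigma> \<otimes>\<^bsub>Gammak D\<^esub> \<tau> = compose (carrier (kcl_alg D)) \<sigma> \<tau>"
  by (simp add: Gammak_def gal_mult)

lemma Gammak_one: "\<one>\<^bsub>Gammak D\<^esub> = (\<lambda>y\<in>carrier (kcl_alg D). y)"
  by (simp add: Gammak_def gal_simps)

text \<open>A lift of \<open>y\<close> chosen by \<open>inv_into\<close> reduces back to
  \<open>y\<close>. This converts the trivial action of the identity of \<open>GammaK D\<close> into
  a statement about \<open>push\<close> along the identity of the residue field.\<close>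

lemma res_gal_one: "res_gal D \<one>\<^bsub>GammaK D\<^esub> = (\<lambda>y\<in>carrier (kcl_alg D). y)"
proof -
  have im: "rmap D ` carrier (OKcl D) = carrier (kcl D)"
    using base by (simp add: base_setting_def residue_map_def)
  have sub: "carrier (OKcl D) \<subseteq> carrier (Kcl D)" by (auto simp: OKcl_def integral_closure_def)
  have "rmap D (\<one>\<^bsub>GammaK D\<^esub> (inv_into (carrier (OKcl D)) (rmap D) y)) = y"
    if "y \<in> carrier (kcl D)" for y
  proof -
    have "y \<in> rmap D ` carrier (OKcl D)" using that im by simp
    then show ?thesis
      using inv_into_into[of y "rmap D" "carrier (OKcl D)"] sub
      by (auto simp: GammaK_def gal_simps f_inv_into_f)
  qed
  then show ?thesis by (simp add: res_gal_def restrict_def fun_eq_iff)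
qed

text \<open>The action comes from functoriality of \<open>A\<close>. Commutativity and exponent 2
  are taken over from the module structure under \<open>GammaK D\<close>.\<close>

lemma f2_module_V2:
  assumes A: "group_functor (OK D) A" and V2: "f2_module (GammaK D) (V2 D A) (actV2 D A)"
  shows "f2_module (Gammak D) (V2 D A) (pt_action (two_torsion A) (kcl_alg D))"
proof -
  let ?B = "kcl_alg D"
  have fnct: "alg_functor (OK D) A" and grp: "group (grp A ?B)"
    and hom: "\<And>\<tau>. \<tau> \<in> alg_hom (OK D) ?B ?B \<Longrightarrow> push A ?B ?B \<tau> \<in> hom (grp A ?B) (grp A ?B)"
    using A is_alg_kcl by (auto simp: group_functor_def)
  have id: "push A ?B ?B (\<lambda>b\<in>carrier ?B. b) x = x" if "x \<in> pts A ?B" for x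
    using fnct that is_alg_kcl unfolding alg_functor_def by blast
  have comp: "push A ?B ?B (compose (carrier ?B) \<sigma> \<tau>) x = push A ?B ?B \<sigma> (push A ?B ?B \<tau> x)"
    if "\<sigma> \<in> alg_hom (OK D) ?B ?B" "\<tau> \<in> alg_hom (OK D) ?B ?B" "x \<in> pts A ?B" for \<sigma> \<tau> x
    using fnct that is_alg_kcl unfolding alg_functor_def by blast
  have al: "\<tau> \<in> alg_hom (OK D) ?B ?B" if "\<tau> \<in> carrier (Gammak D)" for \<tau>
    using Gammak_automorphism[OF that] by (simp add: alg_automorphism_def)
  have mult: "push A ?B ?B \<tau> (mul A ?B x y) = mul A ?B (push A ?B ?B \<tau> x) (push A ?B ?B \<tau> y)"
    and cl: "push A ?B ?B \<tau> x \<in> pts A ?B"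
    and unit: "push A ?B ?B \<tau> (unit_pt A ?B) = unit_pt A ?B"
    if "\<tau> \<in> carrier (Gammak D)" "x \<in> pts A ?B" "y \<in> pts A ?B" for \<tau> x y
    using hom_mult[OF hom[OF al[OF that(1)]]] hom_in_carrier[OF hom[OF al[OF that(1)]]]
      hom_one[OF hom[OF al[OF that(1)]] grp grp] that by simp_all
  have "f2_module (Gammak D) (V2 D A) (\<lambda>\<tau>. restrict (push A ?B ?B \<tau>) (carrier (V2 D A)))"
  proof (rule f2_module_restrictI[OF group_Gammak])
    show "comm_group (V2 D A)" "\<And>x. x \<in> carrier (V2 D A) \<Longrightarrow> x \<otimes>\<^bsub>V2 D A\<^esub> x = \<one>\<^bsub>V2 D A\<^esub>"
      using V2 by (simp_all add: f2_module_def)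
    show "push A ?B ?B \<tau> x \<in> carrier (V2 D A)" if "\<tau> \<in> carrier (Gammak D)" "x \<in> carrier (V2 D A)" for \<tau> x
      using that mult[of \<tau> x x] cl[of \<tau> x x] unit[of \<tau> x x] by (simp add: V2_def)
    show "push A ?B ?B \<one>\<^bsub>Gammak D\<^esub> x = x" if "x \<in> carrier (V2 D A)" for x
      using that id unfolding Gammak_one by (simp add: V2_def)
    show "push A ?B ?B (\<sigma> \<otimes>\<^bsub>Gammak D\<^esub> \<tau>) x = push A ?B ?B \<sigma> (push A ?B ?B \<tau> x)"
      if "\<sigma> \<in> carrier (Gammak D)" "\<tau> \<in> carrier (Gammak D)" "x \<in> carrier (V2 D A)" for \<sigma> \<tau> x
      using that al comp unfolding Gammak_mult[OF that(1,2)] by (simp add: V2_def)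
    show "push A ?B ?B \<tau> (x \<otimes>\<^bsub>V2 D A\<^esub> y) = push A ?B ?B \<tau> x \<otimes>\<^bsub>V2 D A\<^esub> push A ?B ?B \<tau> y"
      if "\<tau> \<in> carrier (Gammak D)" "x \<in> carrier (V2 D A)" "y \<in> carrier (V2 D A)" for \<tau> x y
      using that mult by (simp add: V2_def)
  qed
  moreover have "pt_action (two_torsion A) ?B = (\<lambda>\<tau>. restrict (push A ?B ?B \<tau>) (carrier (V2 D A)))"
    by (rule ext) (simp add: pt_action_def V2_def)
  ultimately show ?thesis by simp
qed

text \<open>Since the identity acts trivially, the classes of line bundles that make up the points of
  \<open>V1\<close> are closed under isomorphism.\<close>

lemma f2_module_V1:
  assumes V1: "f2_module (GammaK D) (V1 D A) (actV1 D A)"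
  shows "f2_module (Gammak D) (V1 D A) (pt_action (two_torsion (dual_scheme (OK D) A)) (kcl_alg D))"
proof -
  let ?B = "kcl_alg D" and ?P = "dual_scheme (OK D) A"
  let ?push = "push ?P ?B ?B"
  interpret V1: comm_group "V1 D A" using V1 by (simp add: f2_module_def)
  interpret a1: group_action "GammaK D" "carrier (V1 D A)" "actV1 D A"
    using V1 by (simp add: f2_module_def)
  have V1_iff: "\<xi> \<in> carrier (V1 D A) \<longleftrightarrow> \<xi> \<in> pts ?P ?B \<and> mul ?P ?B \<xi> \<xi> = unit_pt ?P ?B" for \<xi>
    by (simp add: V1_def)
  have V1_mul: "\<xi> \<otimes>\<^bsub>V1 D A\<^esub> \<eta> = mul ?P ?B \<xi> \<eta>" and V1_one: "\<one>\<^bsub>V1 D A\<^esub> = unit_pt ?P ?B" for \<xi> \<eta>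
    by (simp_all add: V1_def)
  have id: "?push (\<lambda>b\<in>carrier ?B. b) \<xi> = \<xi>" if "\<xi> \<in> carrier (V1 D A)" for \<xi>
  proof -
    have "actV1 D A \<one>\<^bsub>GammaK D\<^esub> \<xi> = \<xi>" using that by (simp flip: a1.id_eq_one)
    then show ?thesis using that by (simp add: actV1_def pt_action_def res_gal_one V1_def)
  qed
  have sat: "saturated (OK D) ?B A \<xi>" if "\<xi> \<in> carrier (V1 D A)" for \<xi>
    using id[OF that] unfolding dual_push_id saturated_def by blast
  \<comment> \<open>The product of two elements lies in \<open>V1\<close> again, which is how it is
    known to be saturated.\<close>
  have mult: "?push \<tau> (mul ?P ?B \<xi> \<eta>) = mul ?P ?B (?push \<tau> \<xi>) (?push \<tau> \<eta>)"
    if "\<tau> \<in> carrier (Gammak D)" "\<xi> \<in> carrier (V1 D A)" "\<eta> \<in> carrier (V1 D A)" for \<tau> \<xi> \<eta>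
    using that alg_automorphism.dual_push_mul[OF Gammak_automorphism[OF that(1)] _ sat[OF that(2)] _
        sat[OF that(3)] sat[OF V1.m_closed[OF that(2,3)], unfolded V1_mul]]
    by (simp add: V1_iff)
  have unit: "?push \<tau> (unit_pt ?P ?B) = unit_pt ?P ?B" if "\<tau> \<in> carrier (Gammak D)" for \<tau>
    using alg_automorphism.dual_push_unit[OF Gammak_automorphism[OF that]
        sat[OF V1.one_closed, unfolded V1_one]] .
  have "f2_module (Gammak D) (V1 D A) (\<lambda>\<tau>. restrict (?push \<tau>) (carrier (V1 D A)))"
  proof (rule f2_module_restrictI[OF group_Gammak V1.comm_group_axioms])
    show "\<xi> \<otimes>\<^bsub>V1 D A\<^esub> \<xi> = \<one>\<^bsub>V1 D A\<^esub>" if "\<xi> \<in> carrier (V1 D A)" for \<xi>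
      using that V1 by (simp add: f2_module_def)
    show "?push \<tau> \<xi> \<in> carrier (V1 D A)" if "\<tau> \<in> carrier (Gammak D)" "\<xi> \<in> carrier (V1 D A)" for \<tau> \<xi>
      using alg_automorphism.dual_push_closed[OF Gammak_automorphism[OF that(1)] _ sat[OF that(2)]]
        mult[OF that that(2)] unit[OF that(1)] that(2) by (simp add: V1_iff)
    show "?push \<one>\<^bsub>Gammak D\<^esub> \<xi> = \<xi>" if "\<xi> \<in> carrier (V1 D A)" for \<xi>
      using id[OF that] by (simp add: Gammak_one)
    show "?push \<tau> (\<xi> \<otimes>\<^bsub>V1 D A\<^esub> \<eta>) = ?push \<tau> \<xi> \<otimes>\<^bsub>V1 D A\<^esub> ?push \<tau> \<eta>"
      if "\<tau> \<in> carrier (Gammak D)" "\<xi> \<in> carrier (V1 D A)" "\<eta> \<in> carrier (V1 D A)" for \<tau> \<xi> \<eta>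
      using mult[OF that] by (simp add: V1_mul)
    fix \<sigma> \<tau> \<xi>
    assume \<sigma>: "\<sigma> \<in> carrier (Gammak D)" and \<tau>: "\<tau> \<in> carrier (Gammak D)" and \<xi>: "\<xi> \<in> carrier (V1 D A)"
    interpret group "Gammak D" by (rule group_Gammak)
    let ?cls = "bdl_class ?B (gbase_change (OK D) ?B A)"
    \<comment> \<open>Composites are compared on a representing line bundle, where base change along
      a composite is an equality of cocycles.\<close>
    obtain L where L: "\<xi> = ?cls L"
      using \<xi> unfolding V1_iff dual_scheme_def by auto
    have push_cls: "?push \<rho> (?cls M) = ?cls (base_change_bdl ?B \<rho> M)"
      if "\<rho> \<in> carrier (Gammak D)" "?cls M \<in> carrier (V1 D A)" for \<rho> M
      using alg_automorphism.dual_push_bdl_class[OF Gammak_automorphism[OF that(1)] sat[OF that(2)]] .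
    have "?push \<tau> \<xi> \<in> carrier (V1 D A)"
      using alg_automorphism.dual_push_closed[OF Gammak_automorphism[OF \<tau>] _ sat[OF \<xi>]]
        mult[OF \<tau> \<xi> \<xi>] unit[OF \<tau>] \<xi> by (simp add: V1_iff)
    moreover have "\<tau> \<in> carrier ?B \<rightarrow> carrier ?B"
      using \<tau> by (auto simp: Gammak_def gal_simps Bij_def bij_betw_def)
    ultimately have "?push \<sigma> (?push \<tau> \<xi>) = ?cls (base_change_bdl ?B (\<sigma> \<otimes>\<^bsub>Gammak D\<^esub> \<tau>) L)"
      using push_cls[OF \<tau> \<xi>[unfolded L]] push_cls[OF \<sigma>]
      unfolding L Gammak_mult[OF \<sigma> \<tau>] by (metis base_change_bdl_compose)
    then show "?push (\<sigma> \<otimes>\<^bsub>Gammak D\<^esub> \<tau>) \<xi> = ?push \<sigma> (?push \<tau> \<xi>)"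
      using push_cls[OF m_closed[OF \<sigma> \<tau>] \<xi>[unfolded L]] unfolding L by (rule trans[OF _ sym, rotated])
  qed
  moreover have "pt_action (two_torsion ?P) ?B = (\<lambda>\<tau>. restrict (?push \<tau>) (carrier (V1 D A)))"
    by (rule ext) (simp add: pt_action_def V1_def)
  ultimately show ?thesis by simp
qed

end

theorem theorem4p6:
  fixes D :: "'a base_data" and A :: "('a,'p) gfunctor" and l :: nat
    and \<omega> :: "('a,'p) line_bdl set \<Rightarrow> ('a,'p) line_bdl set \<Rightarrow> int"
    and i :: "('a,'p) line_bdl set \<Rightarrow> 'p"
  assumes "base_setting D"
    and "abelian_scheme (OK D) A 2"
    and "ordinary D A"
    and "connected_etale_seq D A \<omega> i"
    and "Factorial_Ring.prime l"
  defines "perm_iso \<equiv> perm_reps_iso (padic_field l) (GammaK D)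
             (carrier (V D A)) (actV D A) (carrier (W D A)) (actW D A)"
    and "splits \<equiv> seq_splits (GammaK D) (W D A) (actW D A) (V2 D A) (actV2 D A) (reduction D A)"
    and "GW \<equiv> actW D A ` carrier (GammaK D)"
    and "GV \<equiv> actV D A ` carrier (GammaK D)"
  shows "(perm_iso \<longleftrightarrow> splits) \<and> (splits \<longleftrightarrow> card GW = card GV) \<and>
         (splits \<longrightarrow> unramified D (W D A) (actW D A))"
proof -
  interpret f2_extension "GammaK D" "V1 D A" "actV1 D A" "W D A" "actW D A" "V2 D A" "actV2 D A"
    i "reduction D A"
    using assms(4) by unfold_locales (simp add: connected_etale_seq_def)
  \<comment> \<open>The order of \<open>V1\<close> is read off from \<open>\<omega>\<close>, that of
    \<open>V2\<close> from ordinarity.\<close>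
  have card1: "card (carrier (V1 D A)) = 4"
    using assms(4) M1.card_wedge2_iso_F2[of \<omega>] by (simp add: connected_etale_seq_def)
  have card2: "card (carrier (V2 D A)) = 4" using assms(3) by (rule card_ordinary)
  have fin: "finite (carrier (W D A))"
    using card1 card2 by (intro finite_carrier) (auto intro: card_ge_0_finite)
  have V: "V D A = V1 D A \<times>\<times> V2 D A" "actV D A = act_sum"
    by (simp_all add: V_def actV_def)
  have splits_if: splits if faithful_on_sum
    unfolding splits_def using that card1 card2 by (rule seq_splits_if_faithful)
  obtain c d where cd: "c \<in> carrier (padic_field l)" "d \<in> carrier (padic_field l)" "c \<noteq> d"
    using padic_field_two_elements[OF assms(5)] .
  have "perm_iso \<Longrightarrow> splits"
    unfolding perm_iso_def V by (rule splits_if, rule faithful_if_perm_reps_iso[OF _ cd])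
  moreover have "splits \<Longrightarrow> perm_iso"
    unfolding splits_def perm_iso_def V by (rule perm_reps_iso_if_splits)
  moreover have "card GW = card GV \<Longrightarrow> splits"
    unfolding GW_def GV_def V by (rule splits_if, rule faithful_if_card_eq[OF fin])
  moreover have "splits \<Longrightarrow> card GW = card GV"
    unfolding splits_def GW_def GV_def V by (rule card_eq_if_splits[OF fin])
  moreover have "unramified D (W D A) (actW D A)" if splits
    unfolding unramified_def
  proof (rule inflation_if_splits)
    show "seq_splits (GammaK D) (W D A) (actW D A) (V2 D A) (actV2 D A) (reduction D A)"
      using that by (simp add: splits_def)
    show "f2_module (Gammak D) (V1 D A) (pt_action (two_torsion (dual_scheme (OK D) A)) (kcl_alg D))"
      by (rule f2_module_V1[OF assms(1) f2_modules(1)])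
    show "f2_module (Gammak D) (V2 D A) (pt_action (two_torsion A) (kcl_alg D))"
      using assms(2) by (intro f2_module_V2[OF assms(1) _ f2_modules(3)]) (simp add: abelian_scheme_def)
  \<comment> \<open>Both actions are defined as point actions composed with \<open>res_gal\<close>,
    so compatibility with the reduction of automorphisms is definitional.\<close>
  qed (simp_all add: actV1_def actV2_def)
  ultimately show ?thesis by blast
qed

end
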